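(* Let $m\ge1$ be an integer, $\rho>0$, $\eta>0$, and let $n_*>m$ be an integer. For the Erlang A birth–death process $N(t)$ let $\tau(n_* )=\min\{t: N(t)=n_*\}$ and $\widehat Q_n(\theta)=E\left[e^{-\theta\tau(n_* )}\mid N(0)=n\right]$ for $\mathrm{Re}(\theta)>0$ and $0\le n\le n_*$. Then, writing $F_n=F_n(\theta)$, $H_n=H_n(\theta;m)$, $I_n=I_n(\theta;m)$, $$\widehat Q_n(\theta)=\rho^{n_*-n}\frac{n!}{m!}\,\eta^{m-n_*+1}\left(\frac\rho\eta\right)^{\frac{m+\theta}{\eta}}\frac{e^{\rho/\eta}}{\Gamma\!\left(\frac\theta\eta\right)\Gamma\!\left(n_*-m+1+\frac m\eta\right)}$$ $$\times\frac{F_n}{(m+\eta)(H_{n_*}I_{m+1}-I_{n_*}H_{m+1})F_m+(m+1)(H_mI_{n_*}-H_{n_*}I_m)F_{m+1}},\qquad 0\le n\le m,$$ and $$\widehat Q_n(\theta)=\rho^{n_*-n}\eta^{n-n_*}\frac{\Gamma\!\left(n-m+1+\frac m\eta\right)}{\Gamma\!\left(n_*-m+1+\frac m\eta\right)}$$ $$\times\frac{(m+\eta)(H_nI_{m+1}-I_nH_{m+1})F_m+(m+1)(H_mI_n-H_nI_m)F_{m+1}}{(m+\eta)(H_{n_*}I_{m+1}-I_{n_*}H_{m+1})F_m+(m+1)(H_mI_{n_*}-H_{n_*}I_m)F_{m+1}},\qquad m\le n\le n_*.$$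
   Context: Erlang A model ($M/M/m+M$ queue) with service rate $\mu=1$: $N(t)$ is the birth–death process on $\{0,1,2,\dots\}$ with birth rate $\rho$ in every state, and death rate $n$ in state $n$ for $0\le n\le m$ and $m+(n-m)\eta$ in state $n$ for $n\ge m$. Special functions (for integer $n$): $$F_n(\theta)=\frac{1}{2\pi i}\int_{C_0}\frac{e^{\rho z}}{z^{n+1}(1-z)^\theta}\,dz,\qquad H_n(\theta;m)=\frac{1}{2\pi i}\int_{C_1}\frac{e^{\rho z/\eta}}{(z-1)^{\theta/\eta}\,z^{n+1-m}\,z^{m/\eta}}\,dz,$$ $$I_n(\theta;m)=\frac{1}{2\pi i}\int_{C_2}\frac{e^{\rho z/\eta}}{(1-z)^{\theta/\eta}\,z^{n+1-m}\,z^{m/\eta}}\,dz.$$ Contours: $C_0$ is a small counterclockwise circle about $0$ inside $|z|<1$; $C_1$ goes from $-\infty-i\varepsilon$ to $-\infty+i\varepsilon$ ($\varepsilon>0$), encircling $z=1$ counterclockwise and avoiding $\{\mathrm{Im}(z)=0,\mathrm{Re}(z)\le 1\}$; $C_2$ goes from $-\infty-i\varepsilon$ to $-\infty+i\varepsilon$, encircling $z=0$ counterclockwise and avoiding $\{\mathrm{Im}(z)=0,\mathrm{Re}(z)\le 0\}$ and $\{\mathrm{Im}(z)=0,\mathrm{Re}(z)\ge 1\}$ (so it crosses the real axis in $(0,1)$). Branches: $(1-z)^a=|1-z|^ae^{ia\arg(1-z)}$ with $|\arg(1-z)|<\pi$; $(z-1)^a=|z-1|^ae^{ia\arg(z-1)}$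 with $|\arg(z-1)|<\pi$; $z^{m/\eta}=|z|^{m/\eta}e^{i(m/\eta)\arg z}$ with $|\arg z|<\pi$. Here $\Gamma$ is the Gamma function. *)

theory Defs
  imports "HOL-Probability.Probability" "HOL-Complex_Analysis.Complex_Analysis"
begin

section \<open>Birth-death processes\<close>

definition birth_death_rate :: "(nat \<Rightarrow> real) \<Rightarrow> (nat \<Rightarrow> real) \<Rightarrow> nat \<Rightarrow> nat \<Rightarrow> real" where
  "birth_death_rate birth death i j =
     (if j = i + 1 then birth i
      else if i = j + 1 then death i
      else if i = j then - (birth i + death i)
      else 0)"

text \<open>
  A time-homogeneous continuous-time Markov chain on the natural numbers with time domain
  \<open>[0,\<infinity>)\<close> and right-continuous paths (for the discrete topology), whose transition
  probabilities satisfy \<open>P h i j = of_bool (i = j) + q i j * h + o(h)\<close> as \<open>h\<close> decreases to \<open>0\<close>,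
  where \<open>q\<close> is the tridiagonal matrix of birth and death rates. The initial distribution is
  arbitrary, and \<open>P h i\<close> being a probability mass function makes the chain conservative.
\<close>

definition birth_death_process ::
    "'a measure \<Rightarrow> (real \<Rightarrow> 'a \<Rightarrow> nat) \<Rightarrow> (nat \<Rightarrow> real) \<Rightarrow> (nat \<Rightarrow> real) \<Rightarrow> bool" where
  "birth_death_process M N birth death \<longleftrightarrow>
     prob_space M \<and>
     (\<forall>t\<ge>0. N t \<in> M \<rightarrow>\<^sub>M count_space UNIV) \<and>
     (\<forall>\<omega>\<in>space M. \<forall>t\<ge>0. continuous (at_right t) (\<lambda>s. N s \<omega>)) \<and>
     (\<exists>P :: real \<Rightarrow> nat \<Rightarrow> nat pmf.
        (\<forall>(k::nat) (t :: nat \<Rightarrow> real) (i :: nat \<Rightarrow> nat).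
           0 \<le> t 0 \<longrightarrow> (\<forall>l\<le>k. t l < t (Suc l)) \<longrightarrow>
           measure M {\<omega>\<in>space M. \<forall>l\<le>Suc k. N (t l) \<omega> = i l} =
           measure M {\<omega>\<in>space M. \<forall>l\<le>k. N (t l) \<omega> = i l}
             * pmf (P (t (Suc k) - t k) (i k)) (i (Suc k))) \<and>
        (\<forall>i j. ((\<lambda>h. (pmf (P h i) j - of_bool (i = j)) / h)
                  \<longlongrightarrow> birth_death_rate birth death i j) (at_right 0)))"

definition erlang_A_death :: "nat \<Rightarrow> real \<Rightarrow> nat \<Rightarrow> real" where
  "erlang_A_death m \<eta> n = (if n \<le> m then real n else real m + (real n - real m) * \<eta>)"

definition erlang_A_process ::
    "'a measure \<Rightarrow> (real \<Rightarrow> 'a \<Rightarrow> nat) \<Rightarrow> nat \<Rightarrow> real \<Rightarrow> real \<Rightarrow> bool" where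
  "erlang_A_process M N m \<rho> \<eta> \<longleftrightarrow>
     birth_death_process M N (\<lambda>_. \<rho>) (erlang_A_death m \<eta>)"

text \<open>By right-continuity the minimum exists whenever the state is reached at all.\<close>

definition hitting_time :: "(real \<Rightarrow> 'a \<Rightarrow> nat) \<Rightarrow> nat \<Rightarrow> 'a \<Rightarrow> ereal" where
  "hitting_time N k \<omega> =
     (if \<exists>t\<ge>0. N t \<omega> = k then ereal (LEAST t. 0 \<le> t \<and> N t \<omega> = k) else \<infinity>)"

text \<open>
  \<open>E[exp (-\<theta> \<tau>) | N 0 = n]\<close>, the integrand being \<open>0\<close> on \<open>\<tau> = \<infinity>\<close>;
  meaningful when the event \<open>N 0 = n\<close> has positive probability.
\<close>

definition hitting_laplace ::
    "'a measure \<Rightarrow> (real \<Rightarrow> 'a \<Rightarrow> nat) \<Rightarrow> nat \<Rightarrow> complex \<Rightarrow> nat \<Rightarrow> complex" where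
  "hitting_laplace M N k \<theta> n =
     (LINT \<omega> | uniform_measure M {\<omega>\<in>space M. N 0 \<omega> = n}.
        (if hitting_time N k \<omega> = \<infinity> then 0
         else exp (- \<theta> * of_real (real_of_ereal (hitting_time N k \<omega>)))))"


section \<open>Contour integrals\<close>

text \<open>
  A contour from \<open>-\<infinity> - i\<epsilon>\<close> to \<open>-\<infinity> + i\<epsilon>\<close> avoiding \<open>S\<close>, parametrised by the real line. For
  the sets \<open>S\<close> below the complement of \<open>S\<close> is simply connected and contains no real number
  near \<open>-\<infinity>\<close>, so avoiding \<open>S\<close> already forces the contour to pass counterclockwise around
  the part of \<open>S\<close> that extends to \<open>-\<infinity>\<close>.
\<close>

definition hankel_contour :: "complex set \<Rightarrow> (real \<Rightarrow> complex) \<Rightarrow> bool" where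
  "hankel_contour S \<gamma> \<longleftrightarrow>
     (\<forall>a b. \<gamma> piecewise_C1_differentiable_on {a..b}) \<and>
     range \<gamma> \<inter> S = {} \<and>
     (\<exists>\<epsilon>>0. filterlim (\<lambda>t. Re (\<gamma> t)) at_bot at_bot \<and> ((\<lambda>t. Im (\<gamma> t)) \<longlongrightarrow> - \<epsilon>) at_bot \<and>
            filterlim (\<lambda>t. Re (\<gamma> t)) at_bot at_top \<and> ((\<lambda>t. Im (\<gamma> t)) \<longlongrightarrow> \<epsilon>) at_top)"

text \<open>
  The Henstock-Kurzweil integral over the whole line is the limit of the integrals over
  \<open>[a,b]\<close> as \<open>a\<close> and \<open>b\<close> tend to \<open>-\<infinity>\<close> and \<open>\<infinity>\<close>.
\<close>

definition line_contour_integral :: "(real \<Rightarrow> complex) \<Rightarrow> (complex \<Rightarrow> complex) \<Rightarrow> complex" where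
  "line_contour_integral \<gamma> f = integral UNIV (\<lambda>t. f (\<gamma> t) * vector_derivative \<gamma> (at t))"

definition C1_cut :: "complex set" where
  "C1_cut = {z. Im z = 0 \<and> Re z \<le> 1}"

definition C2_cut :: "complex set" where
  "C2_cut = {z. Im z = 0 \<and> Re z \<le> 0} \<union> {z. Im z = 0 \<and> Re z \<ge> 1}"


section \<open>The special functions\<close>

text \<open>
  On the contours used, \<open>z powr a = exp (a * Ln z)\<close> with the principal logarithm agrees with
  the branch \<open>|z|^a exp (i a arg z)\<close>, \<open>|arg z| < \<pi>\<close>; the same holds for the bases \<open>1 - z\<close> and
  \<open>z - 1\<close>. The functions take their contour (for \<open>erlang_F\<close>: the radius) as a parameter.
\<close>

definition erlang_F :: "real \<Rightarrow> real \<Rightarrow> int \<Rightarrow> complex \<Rightarrow> complex" where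
  "erlang_F r \<rho> n \<theta> =
     1 / (2 * of_real pi * \<i>) *
     contour_integral (circlepath 0 r)
       (\<lambda>z. exp (of_real \<rho> * z) / (z powi (n + 1) * (1 - z) powr \<theta>))"

definition erlang_H ::
    "(real \<Rightarrow> complex) \<Rightarrow> real \<Rightarrow> real \<Rightarrow> int \<Rightarrow> complex \<Rightarrow> nat \<Rightarrow> complex" where
  "erlang_H \<gamma> \<rho> \<eta> n \<theta> m =
     1 / (2 * of_real pi * \<i>) *
     line_contour_integral \<gamma>
       (\<lambda>z. exp (of_real \<rho> * z / of_real \<eta>) /
            ((z - 1) powr (\<theta> / of_real \<eta>) * z powi (n + 1 - int m)
               * z powr (of_nat m / of_real \<eta>)))"

definition erlang_I ::
    "(real \<Rightarrow> complex) \<Rightarrow> real \<Rightarrow> real \<Rightarrow> int \<Rightarrow> complex \<Rightarrow> nat \<Rightarrow> complex" where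
  "erlang_I \<gamma> \<rho> \<eta> n \<theta> m =
     1 / (2 * of_real pi * \<i>) *
     line_contour_integral \<gamma>
       (\<lambda>z. exp (of_real \<rho> * z / of_real \<eta>) /
            ((1 - z) powr (\<theta> / of_real \<eta>) * z powi (n + 1 - int m)
               * z powr (of_nat m / of_real \<eta>)))"

end

theory Submission
  imports Defs "HOL-Real_Asymp.Real_Asymp"
begin

text \<open>
  Let \<open>\<phi>\<close> solve \<open>\<rho> \<phi>(i+1) + d\<^sub>i \<phi>(i-1) = (\<rho> + d\<^sub>i + \<theta>) \<phi>(i)\<close> for \<open>i < n\<^sub>*\<close>, where \<open>d\<^sub>i\<close> is the death rate.
  Observing the process on a grid of mesh \<open>h\<close> until it leaves \<open>{0,\<dots>,n\<^sub>*-1}\<close>, each step changes the mean of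
  \<open>e\<^sup>-\<^sup>\<theta>\<^sup>t \<phi>(N t)\<close> by \<open>o(h)\<close> only, so in the limit \<open>\<phi>(n\<^sub>*) E[e\<^sup>-\<^sup>\<theta>\<^sup>\<tau>] = \<phi>(n)\<close>. The same argument for the indicator of
  \<open>{j. j > n\<^sub>*}\<close> shows that the process cannot jump over \<open>n\<^sub>*\<close>, and \<open>|\<phi>|\<close> is increasing, so \<open>\<phi>(n\<^sub>*) \<noteq> 0\<close>.

  Below \<open>m\<close> the solution is \<open>n! \<rho>\<^sup>-\<^sup>n F\<^sub>n\<close>; above \<open>m\<close> it is \<open>(\<eta>/\<rho>)\<^sup>n \<Gamma>(n-m+1+m/\<eta>)\<close> times the combination of
  \<open>H\<^sub>n\<close> and \<open>I\<^sub>n\<close> that matches at \<open>m\<close> and \<open>m+1\<close>; integration by parts gives the recurrences. The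
  normalisation needs the Casoratian \<open>H\<^sub>m I\<^sub>m\<^sub>+\<^sub>1 - I\<^sub>m H\<^sub>m\<^sub>+\<^sub>1\<close>. All contours are deformed to parabolas
  \<open>(a + i t)\<^sup>2\<close>, on which everything converges absolutely. In the variable \<open>x = \<rho>/\<eta>\<close> the Casoratian
  satisfies a first-order differential equation, and its behaviour as \<open>x \<rightarrow> 0\<close> follows from Hankel's integral
  for \<open>1/\<Gamma>\<close>.
\<close>

section \<open>Entry times and the generator\<close>

text \<open>The process is given only by its finite-dimensional distributions and, for each single
  pair of states, a rate as the step tends to zero; there is no uniformity over states and no strong
  Markov property. Stopping at the exit from \<open>{..<b}\<close> leaves finitely many current
  states, and a payoff with a constant value \<open>c\<close> above \<open>b\<close> lets the total
  mass of the pmf stand for the tail, so that finitely many entries of \<open>P h\<close> matter.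
  The errors \<open>o(h)\<close> are summed against geometric weights whose total is of order
  \<open>1 / h\<close>. A contour is known only through its limits at both ends. Its speed is
  uncontrolled, so the integrals need not converge absolutely; contours are therefore compared
  through a primitive of the integrand, while estimates and differentiation take place on parabolas
  only. The limit \<open>x -> 0\<close> of the Casoratian is uneven: the loop for \<open>H\<close>
  has to surround 1 and is rescaled along with \<open>x\<close>, whereas the loop for
  \<open>I\<close> stays fixed and leads to a Beta-type integral, evaluated by a Laplace
  representation of \<open>(1 - z) powr (- \<alpha>)\<close>.\<close>

definition entry_time :: "nat set \<Rightarrow> (real \<Rightarrow> nat) \<Rightarrow> real" where
  "entry_time S w = (LEAST t. 0 \<le> t \<and> w t \<in> S)"

definition entry_payoff :: "complex \<Rightarrow> nat set \<Rightarrow> (nat \<Rightarrow> complex) \<Rightarrow> (real \<Rightarrow> nat) \<Rightarrow> complex" where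
  "entry_payoff \<theta> S f w =
     (if \<exists>t\<ge>0. w t \<in> S
      then exp (- \<theta> * of_real (entry_time S w)) * f (w (entry_time S w)) else 0)"

text \<open>In the applications \<open>z = exp (- \<theta> * h)\<close>, and \<open>x\<close> is the
  path on a grid of mesh \<open>h\<close>. The telescoped form is chosen because the mean of each
  summand is computed by one use of the Markov property; \<open>stopped_payoff_eq\<close> identifies
  it with the discounted payoff of the stopped path.\<close>

definition stopped_payoff ::
    "complex \<Rightarrow> nat set \<Rightarrow> (nat \<Rightarrow> complex) \<Rightarrow> (nat \<Rightarrow> nat) \<Rightarrow> nat \<Rightarrow> complex" where
  "stopped_payoff z S f x K =
     f (x 0) + (\<Sum>k<K. if \<forall>l\<le>k. x l \<notin> S then z ^ Suc k * f (x (Suc k)) - z ^ k * f (x k) else 0)"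

definition grid_payoff ::
    "complex \<Rightarrow> nat set \<Rightarrow> (nat \<Rightarrow> complex) \<Rightarrow> (nat \<Rightarrow> nat) \<Rightarrow> complex" where
  "grid_payoff z S f x =
     (if \<exists>k. x k \<in> S then z ^ (LEAST k. x k \<in> S) * f (x (LEAST k. x k \<in> S)) else 0)"

lemma right_continuous_nat_eventually:
  fixes w :: "real \<Rightarrow> nat"
  assumes "continuous (at_right t) w"
  obtains d where "d > 0" "\<And>s. t \<le> s \<Longrightarrow> s < t + d \<Longrightarrow> w s = w t"
proof -
  have "(w \<longlongrightarrow> w t) (at_right t)"
    using assms by (simp add: continuous_within)
  then have "eventually (\<lambda>s. w s = w t) (at_right t)"
    by (simp add: tendsto_discrete)
  then obtain b where b: "b > t" "\<And>y. y > t \<Longrightarrow> y < b \<Longrightarrow> w y = w t"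
    unfolding eventually_at_right_field by blast
  show thesis
  proof
    show "b - t > 0" using b by simp
    show "w s = w t" if "t \<le> s" "s < t + (b - t)" for s
      using b(2)[of s] that by (cases "s = t") auto
  qed
qed

text \<open>To the right of the infimum \<open>s\<close> of the entry set the path is constant on
  some \<open>[s, s + d)\<close>, and this interval contains entry points; so the infimum is
  attained and \<open>LEAST\<close> denotes a genuine minimum.\<close>

lemma entry_time_props:
  fixes w :: "real \<Rightarrow> nat"
  assumes rc: "\<And>t. 0 \<le> t \<Longrightarrow> continuous (at_right t) w" and ex: "\<exists>t\<ge>0. w t \<in> S"
  shows "0 \<le> entry_time S w" "w (entry_time S w) \<in> S"
    "\<And>t. 0 \<le> t \<Longrightarrow> w t \<in> S \<Longrightarrow> entry_time S w \<le> t"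
proof -
  define T where "T = {t. 0 \<le> t \<and> w t \<in> S}"
  have ne: "T \<noteq> {}" and bb: "bdd_below T" using ex by (auto simp: T_def intro!: bdd_belowI[of _ 0])
  define s where "s = Inf T"
  have s0: "0 \<le> s" unfolding s_def using ne by (intro cInf_greatest) (auto simp: T_def)
  have lower: "s \<le> t" if "0 \<le> t" "w t \<in> S" for t
    unfolding s_def using that bb by (intro cInf_lower) (auto simp: T_def)
  obtain d where d: "d > 0" "\<And>u. s \<le> u \<Longrightarrow> u < s + d \<Longrightarrow> w u = w s"
    using right_continuous_nat_eventually[OF rc[OF s0]] by metis
  have "\<exists>t\<in>T. t < s + d"
    using cInf_lessD[OF ne, of "s + d"] d(1) by (auto simp: s_def)
  then obtain t where t: "0 \<le> t" "w t \<in> S" "t < s + d" by (auto simp: T_def)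
  then have mem: "w s \<in> S" using d(2)[of t] lower[of t] by auto
  have "entry_time S w = s"
    unfolding entry_time_def using s0 mem lower by (intro Least_equality) auto
  then show "0 \<le> entry_time S w" "w (entry_time S w) \<in> S"
    "\<And>t. 0 \<le> t \<Longrightarrow> w t \<in> S \<Longrightarrow> entry_time S w \<le> t"
    using s0 mem lower by auto
qed

text \<open>From the entry time \<open>s\<close> on, the path is constant for a time
  \<open>d\<close>. Once \<open>h p < d\<close>, the first grid point after \<open>s\<close> still
  sees the state \<open>w s\<close>, and no earlier grid point lies in \<open>S\<close>. The state
  on the grid is then exact, and only the discount factor has to converge.\<close>

lemma grid_payoff_tendsto:
  fixes w :: "real \<Rightarrow> nat"
  assumes rc: "\<And>t. 0 \<le> t \<Longrightarrow> continuous (at_right t) w"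
  defines "h \<equiv> \<lambda>p. 1 / real (Suc p)"
  shows "(\<lambda>p. grid_payoff (exp (- \<theta> * of_real (h p))) S f (\<lambda>k. w (real k * h p)))
           \<longlonglongrightarrow> entry_payoff \<theta> S f w"
proof (cases "\<exists>t\<ge>0. w t \<in> S")
  case False
  have "\<not> (\<exists>k. w (real k * h p) \<in> S)" for p
    using False by (auto simp: h_def)
  with False show ?thesis by (simp only: grid_payoff_def entry_payoff_def if_False) simp
next
  case True
  define s where "s = entry_time S w"
  note s = entry_time_props[OF rc True, folded s_def]
  obtain d where d: "d > 0" "\<And>u. s \<le> u \<Longrightarrow> u < s + d \<Longrightarrow> w u = w s"
    using right_continuous_nat_eventually[OF rc[OF s(1)]] by metis
  have hpos: "h p > 0" for p by (simp add: h_def)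
  have hlim: "h \<longlonglongrightarrow> 0"
    unfolding h_def using LIMSEQ_inverse_real_of_nat by (simp add: inverse_eq_divide)
  define \<kappa> where "\<kappa> = (\<lambda>p. LEAST k. w (real k * h p) \<in> S)"
  have ev: "\<forall>\<^sub>F p in sequentially. h p < d"
    using order_tendstoD(2)[OF hlim d(1)] .
  have key: "w (real (\<kappa> p) * h p) = w s \<and> s \<le> real (\<kappa> p) * h p \<and> real (\<kappa> p) * h p \<le> s + h p
      \<and> (\<exists>k. w (real k * h p) \<in> S)" if "h p < d" for p
  proof -
    define k0 where "k0 = nat \<lceil>s / h p\<rceil>"
    have "s / h p \<ge> 0" using s(1) hpos[of p] by simp
    then have "real k0 \<ge> s / h p" "real k0 < s / h p + 1"
      unfolding k0_def by linarith+
    then have k0: "s \<le> real k0 * h p" "real k0 * h p < s + h p"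
      using hpos[of p] by (auto simp: field_simps)
    then have k0S: "w (real k0 * h p) \<in> S"
      using d(2)[of "real k0 * h p"] that s(2) by auto
    have mem: "w (real (\<kappa> p) * h p) \<in> S" and le: "\<kappa> p \<le> k0"
      unfolding \<kappa>_def using k0S by (auto intro: LeastI Least_le)
    have 1: "s \<le> real (\<kappa> p) * h p" using s(3)[of "real (\<kappa> p) * h p"] mem hpos[of p] by auto
    have 2: "real (\<kappa> p) * h p \<le> real k0 * h p" using le hpos[of p] by auto
    have 3: "real (\<kappa> p) * h p \<le> s + h p" using 2 k0(2) by linarith
    then have "w (real (\<kappa> p) * h p) = w s" using d(2)[OF 1] that by linarith
    then show ?thesis using 1 3 k0S by blast
  qed
  have klim: "(\<lambda>p. real (\<kappa> p) * h p) \<longlonglongrightarrow> s"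
  proof (rule tendsto_sandwich)
    show "\<forall>\<^sub>F p in sequentially. s \<le> real (\<kappa> p) * h p"
      using ev by eventually_elim (use key in auto)
    show "\<forall>\<^sub>F p in sequentially. real (\<kappa> p) * h p \<le> s + h p"
      using ev by eventually_elim (use key in auto)
    show "(\<lambda>p. s + h p) \<longlonglongrightarrow> s" using tendsto_add[OF tendsto_const hlim, of s] by simp
  qed auto
  have "(\<lambda>p. exp (- \<theta> * of_real (real (\<kappa> p) * h p)) * f (w s))
          \<longlonglongrightarrow> exp (- \<theta> * of_real s) * f (w s)"
    by (intro tendsto_intros klim)
  moreover have "\<forall>\<^sub>F p in sequentially.
      exp (- \<theta> * of_real (real (\<kappa> p) * h p)) * f (w s) =
      grid_payoff (exp (- \<theta> * of_real (h p))) S f (\<lambda>k. w (real k * h p))"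
    using ev
  proof eventually_elim
    case (elim p)
    have "exp (- \<theta> * of_real (h p)) ^ \<kappa> p = exp (- \<theta> * of_real (real (\<kappa> p) * h p))"
      by (simp add: exp_of_nat_mult[symmetric] algebra_simps)
    with key[OF elim] show ?case by (simp add: grid_payoff_def \<kappa>_def)
  qed
  ultimately show ?thesis
    using True by (auto simp: entry_payoff_def s_def intro: Lim_transform_eventually)
qed

lemma stopped_payoff_eq:
  "stopped_payoff z S f x K =
     (if \<exists>k\<le>K. x k \<in> S then grid_payoff z S f x else z ^ K * f (x K))"
proof (induction K)
  case 0
  show ?case
  proof (cases "x 0 \<in> S")
    case True
    then have "(LEAST k. x k \<in> S) = 0" by (intro Least_eq_0)
    with True show ?thesis by (auto simp: stopped_payoff_def grid_payoff_def)
  qed (auto simp: stopped_payoff_def)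
next
  case (Suc K)
  have step: "stopped_payoff z S f x (Suc K) = stopped_payoff z S f x K +
     (if \<forall>l\<le>K. x l \<notin> S then z ^ Suc K * f (x (Suc K)) - z ^ K * f (x K) else 0)"
    by (simp add: stopped_payoff_def)
  show ?case
  proof (cases "\<exists>k\<le>K. x k \<in> S")
    case True
    then have "\<exists>k\<le>Suc K. x k \<in> S" using le_Suc_eq by blast
    with True show ?thesis unfolding step Suc.IH by auto
  next
    case False
    show ?thesis
    proof (cases "x (Suc K) \<in> S")
      case True
      have "(LEAST k. x k \<in> S) = Suc K"
        using True False by (intro Least_equality) (auto simp: not_less_eq_eq)
      with False True show ?thesis unfolding step Suc.IH by (auto simp: grid_payoff_def)
    next
      case F: False
      then have "\<not> (\<exists>k\<le>Suc K. x k \<in> S)" using False le_Suc_eq by blast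
      with False show ?thesis unfolding step Suc.IH by auto
    qed
  qed
qed

lemma stopped_payoff_tendsto:
  assumes "norm z < 1" "\<And>j. norm (f j) \<le> B"
  shows "(\<lambda>K. stopped_payoff z S f x K) \<longlonglongrightarrow> grid_payoff z S f x"
proof (cases "\<exists>k. x k \<in> S")
  case True
  then obtain k where k: "x k \<in> S" by blast
  have "\<forall>\<^sub>F K in sequentially. stopped_payoff z S f x K = grid_payoff z S f x"
    using eventually_ge_at_top[of k] by eventually_elim (use k in \<open>auto simp: stopped_payoff_eq\<close>)
  then show ?thesis by (simp add: tendsto_eventually)
next
  case False
  have "(\<lambda>K. z ^ K * f (x K)) \<longlonglongrightarrow> 0"
  proof (rule Lim_null_comparison)
    show "\<forall>\<^sub>F K in sequentially. norm (z ^ K * f (x K)) \<le> norm z ^ K * B"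
      by (intro always_eventually) (auto simp: norm_mult norm_power intro!: mult_left_mono assms)
    show "(\<lambda>K. norm z ^ K * B) \<longlonglongrightarrow> 0"
      using assms(1) by (intro tendsto_mult_left_zero LIMSEQ_power_zero) auto
  qed
  with False show ?thesis by (simp add: stopped_payoff_eq grid_payoff_def)
qed

lemma norm_stopped_payoff_le:
  assumes "norm z < 1" "\<And>j. norm (f j) \<le> B"
  shows "norm (stopped_payoff z S f x K) \<le> B"
proof -
  have B: "B \<ge> 0" using norm_ge_zero assms(2) by (rule order_trans)
  have le: "norm (z ^ k * f j) \<le> B" for k j
  proof -
    have "norm (z ^ k * f j) \<le> 1 * B"
      unfolding norm_mult norm_power
      using assms B by (intro mult_mono power_le_one) auto
    then show ?thesis by simp
  qed
  show ?thesis using le B by (auto simp: stopped_payoff_eq grid_payoff_def)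
qed

lemma borel_measurable_stopped_payoff [measurable]:
  assumes [measurable]: "\<And>k. (\<lambda>\<omega>. x k \<omega>) \<in> M \<rightarrow>\<^sub>M count_space UNIV"
  shows "(\<lambda>\<omega>. stopped_payoff z S f (\<lambda>k. x k \<omega>) K) \<in> borel_measurable M"
  unfolding stopped_payoff_def by measurable

lemma borel_measurable_grid_payoff [measurable]:
  assumes [measurable]: "\<And>k. (\<lambda>\<omega>. x k \<omega>) \<in> M \<rightarrow>\<^sub>M count_space UNIV"
  shows "(\<lambda>\<omega>. grid_payoff z S f (\<lambda>k. x k \<omega>)) \<in> borel_measurable M"
  unfolding grid_payoff_def by measurable

text \<open>An entry time is an infimum over uncountably many times; measurability is inherited from
  the grid payoffs, which involve countably many.\<close>

lemma borel_measurable_entry_payoff: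
  assumes meas: "\<And>t. 0 \<le> t \<Longrightarrow> N t \<in> M \<rightarrow>\<^sub>M count_space UNIV"
    and rc: "\<And>\<omega> t. \<omega> \<in> space M \<Longrightarrow> 0 \<le> t \<Longrightarrow> continuous (at_right t) (\<lambda>s. N s \<omega>)"
  shows "(\<lambda>\<omega>. entry_payoff \<theta> S f (\<lambda>t. N t \<omega>)) \<in> borel_measurable M"
proof (rule borel_measurable_LIMSEQ_metric)
  show "(\<lambda>p. grid_payoff (exp (- \<theta> * of_real (1 / real (Suc p)))) S f (\<lambda>k. N (real k * (1 / real (Suc p))) \<omega>))
      \<longlonglongrightarrow> entry_payoff \<theta> S f (\<lambda>t. N t \<omega>)" if "\<omega> \<in> space M" for \<omega>
    using grid_payoff_tendsto[OF rc[OF that]] by simp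
  show "(\<lambda>\<omega>. grid_payoff (exp (- \<theta> * of_real (1 / real (Suc p)))) S f
      (\<lambda>k. N (real k * (1 / real (Suc p))) \<omega>)) \<in> borel_measurable M" for p
    by (intro borel_measurable_grid_payoff meas) auto
qed

section \<open>The Markov property on a grid and the discrete Dynkin estimate\<close>

definition markov_fdd :: "'a measure \<Rightarrow> (real \<Rightarrow> 'a \<Rightarrow> nat) \<Rightarrow> (real \<Rightarrow> nat \<Rightarrow> nat pmf) \<Rightarrow> bool" where
  "markov_fdd M N P \<longleftrightarrow> (\<forall>(k::nat) (t :: nat \<Rightarrow> real) (i :: nat \<Rightarrow> nat).
     0 \<le> t 0 \<longrightarrow> (\<forall>l\<le>k. t l < t (Suc l)) \<longrightarrow>
     measure M {\<omega>\<in>space M. \<forall>l\<le>Suc k. N (t l) \<omega> = i l} =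
     measure M {\<omega>\<in>space M. \<forall>l\<le>k. N (t l) \<omega> = i l} * pmf (P (t (Suc k) - t k) (i k)) (i (Suc k)))"

lemma markov_fddD:
  assumes "markov_fdd M N P" "0 \<le> t 0" "\<forall>l\<le>k. t l < t (Suc l)"
  shows "measure M {\<omega>\<in>space M. \<forall>l\<le>Suc k. N (t l) \<omega> = i l} =
     measure M {\<omega>\<in>space M. \<forall>l\<le>k. N (t l) \<omega> = i l} * pmf (P (t (Suc k) - t k) (i k)) (i (Suc k))"
  using assms unfolding markov_fdd_def by blast

text \<open>The Markov clause speaks of one trajectory at a time. As \<open>- S\<close> is finite,
  avoiding \<open>S\<close> up to step \<open>k\<close> is a finite disjoint union of trajectories,
  and the factor \<open>pmf (P h i) j\<close> depends on their last state only.\<close>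

lemma markov_grid:
  fixes N :: "real \<Rightarrow> 'a \<Rightarrow> nat" and P :: "real \<Rightarrow> nat \<Rightarrow> nat pmf"
  assumes "prob_space M"
    and meas: "\<And>t. 0 \<le> t \<Longrightarrow> N t \<in> M \<rightarrow>\<^sub>M count_space UNIV"
    and fdd: "markov_fdd M N P"
    and h: "h > 0" and fin: "finite (- S)"
  shows "measure M {\<omega>\<in>space M. N 0 \<omega> = n \<and> (\<forall>l\<le>k. N (real l * h) \<omega> \<notin> S)
             \<and> N (real k * h) \<omega> = i \<and> N (real (Suc k) * h) \<omega> = j} =
         measure M {\<omega>\<in>space M. N 0 \<omega> = n \<and> (\<forall>l\<le>k. N (real l * h) \<omega> \<notin> S)
             \<and> N (real k * h) \<omega> = i} * pmf (P h i) j"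
proof -
  interpret prob_space M by fact
  define T where "T = {p \<in> PiE {..k} (\<lambda>_. - S). p 0 = n \<and> p k = i}"
  have finT: "finite T" unfolding T_def using fin by (intro finite_subset[OF _ finite_PiE[of "{..k}" "\<lambda>_. - S"]]) auto
  have [measurable]: "N (real l * h) \<in> M \<rightarrow>\<^sub>M count_space UNIV" for l using h by (intro meas) auto
  have [measurable]: "N 0 \<in> M \<rightarrow>\<^sub>M count_space UNIV" by (intro meas) auto
  define E where "E p = {\<omega>\<in>space M. \<forall>l\<le>k. N (real l * h) \<omega> = p l}" for p
  define E' where "E' p = {\<omega>\<in>space M. \<forall>l\<le>Suc k. N (real l * h) \<omega> = (p(Suc k := j)) l}" for p
  have mE [measurable]: "E p \<in> sets M" and mE' [measurable]: "E' p \<in> sets M" for p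
    unfolding E_def E'_def by measurable
  have EE': "prob (E' p) = prob (E p) * pmf (P h i) j" if "p \<in> T" for p
  proof -
    have "real (Suc k) * h - real k * h = h" by (simp add: algebra_simps)
    moreover have "E p = {\<omega>\<in>space M. \<forall>l\<le>k. N (real l * h) \<omega> = (p(Suc k := j)) l}"
      unfolding E_def by auto
    moreover have "prob (E' p) = prob {\<omega>\<in>space M. \<forall>l\<le>k. N (real l * h) \<omega> = (p(Suc k := j)) l}
        * pmf (P (real (Suc k) * h - real k * h) ((p(Suc k := j)) k)) ((p(Suc k := j)) (Suc k))"
      unfolding E'_def using h by (intro markov_fddD[OF fdd]) (auto simp: algebra_simps)
    ultimately show ?thesis using that by (simp add: T_def)
  qed
  have disj: "disjoint_family_on E T" "disjoint_family_on E' T"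
  proof -
    have *: "p = q" if "p \<in> T" "q \<in> T" "\<omega> \<in> E p" "\<omega> \<in> E q" for p q \<omega>
      using that unfolding T_def E_def by (auto intro!: PiE_ext[of p "{..k}" _ q])
    have "E' p \<subseteq> E p" for p unfolding E_def E'_def by (auto dest: le_SucI)
    with * show "disjoint_family_on E T" "disjoint_family_on E' T"
      unfolding disjoint_family_on_def by blast+
  qed
  have UE: "{\<omega>\<in>space M. N 0 \<omega> = n \<and> (\<forall>l\<le>k. N (real l * h) \<omega> \<notin> S) \<and> N (real k * h) \<omega> = i} = (\<Union>p\<in>T. E p)"
    (is "?L = ?R")
  proof (intro equalityI subsetI)
    fix \<omega> assume w: "\<omega> \<in> ?L"
    define p where "p = restrict (\<lambda>l. N (real l * h) \<omega>) {..k}"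
    have "p \<in> T" "\<omega> \<in> E p" using w by (auto simp: p_def T_def E_def)
    then show "\<omega> \<in> ?R" by blast
  next
    fix \<omega> assume "\<omega> \<in> ?R"
    then obtain p where p: "p \<in> T" "\<omega> \<in> E p" by blast
    then show "\<omega> \<in> ?L" by (auto simp: T_def E_def PiE_def Pi_def dest: spec[of _ "0::nat"])
  qed
  have UE': "{\<omega>\<in>space M. N 0 \<omega> = n \<and> (\<forall>l\<le>k. N (real l * h) \<omega> \<notin> S) \<and> N (real k * h) \<omega> = i
       \<and> N (real (Suc k) * h) \<omega> = j} = (\<Union>p\<in>T. E' p)"
  proof -
    have E'E: "E' p = E p \<inter> {\<omega>\<in>space M. N (real (Suc k) * h) \<omega> = j}" for p
      unfolding E_def E'_def le_Suc_eq by auto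
    have "(\<Union>p\<in>T. E' p) = (\<Union>p\<in>T. E p) \<inter> {\<omega>\<in>space M. N (real (Suc k) * h) \<omega> = j}"
      unfolding E'E by auto
    then show ?thesis unfolding UE[symmetric] by auto
  qed
  show ?thesis unfolding UE UE'
    using finT disj EE' by (simp add: finite_measure_finite_Union image_subset_iff sum_distrib_right)
qed

lemma bounded_if_eventually_const:
  fixes f :: "nat \<Rightarrow> complex"
  assumes "\<And>j. j > b \<Longrightarrow> f j = c"
  obtains B where "\<And>j. norm (f j) \<le> B"
proof
  fix j
  show "norm (f j) \<le> Max ((\<lambda>j. norm (f j)) ` {..b}) + norm c"
  proof (cases "j \<le> b")
    case True
    then have "norm (f j) \<le> Max ((\<lambda>j. norm (f j)) ` {..b})" by (intro Max_ge) auto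
    then show ?thesis using norm_ge_zero[of c] by linarith
  next
    case False
    have "0 \<le> norm (f b)" by simp
    also have "\<dots> \<le> Max ((\<lambda>j. norm (f j)) ` {..b})" by (intro Max_ge) auto
    finally show ?thesis using False assms by simp
  qed
qed

text \<open>The expression in \<open>drift\<close> is the mean of \<open>z * f\<close> after one
  step, minus \<open>f i\<close>: beyond \<open>b\<close> the payoff is \<open>c\<close>, and total
  mass 1 turns this tail into the leading \<open>c\<close>. Before the exit, step \<open>k\<close>
  contributes at most \<open>norm z ^ k * e\<close>, and the geometric series gives the
  bound.\<close>

lemma grid_dynkin_step:
  fixes N :: "real \<Rightarrow> 'a \<Rightarrow> nat" and P :: "real \<Rightarrow> nat \<Rightarrow> nat pmf" and f :: "nat \<Rightarrow> complex"
    and n :: nat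
  assumes "prob_space M"
    and meas: "\<And>t. 0 \<le> t \<Longrightarrow> N t \<in> M \<rightarrow>\<^sub>M count_space UNIV"
    and fdd: "markov_fdd M N P"
    and h: "h > 0"
    and fc: "\<And>j. j > b \<Longrightarrow> f j = c"
    and z: "norm z < 1"
    and drift: "\<And>i. i < b \<Longrightarrow> norm (z * (c + (\<Sum>j\<le>b. (f j - c) * of_real (pmf (P h i) j))) - f i) \<le> e"
    and e: "e \<ge> 0"
  defines "A \<equiv> {\<omega>\<in>space M. N 0 \<omega> = n}"
  shows "norm ((LINT \<omega>|M. indicator A \<omega> *\<^sub>R grid_payoff z {b..} f (\<lambda>k. N (real k * h) \<omega>))
            - measure M A * f n) \<le> e / (1 - norm z)"
proof -
  interpret prob_space M by fact
  have mk: "measure M {\<omega>\<in>space M. N 0 \<omega> = n \<and> (\<forall>l\<le>k. N (real l * h) \<omega> \<notin> {b..})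
             \<and> N (real k * h) \<omega> = i \<and> N (real (Suc k) * h) \<omega> = j} =
         measure M {\<omega>\<in>space M. N 0 \<omega> = n \<and> (\<forall>l\<le>k. N (real l * h) \<omega> \<notin> {b..})
             \<and> N (real k * h) \<omega> = i} * pmf (P h i) j" for k i j
    by (rule markov_grid[where P = P], fact, (rule meas; assumption), rule fdd, fact, simp)
  have [measurable]: "N (real l * h) \<in> M \<rightarrow>\<^sub>M count_space UNIV" for l using h by (intro meas) auto
  have [measurable]: "N 0 \<in> M \<rightarrow>\<^sub>M count_space UNIV" by (intro meas) auto
  have mA [measurable]: "A \<in> sets M" unfolding A_def by measurable
  obtain B where B: "\<And>j. norm (f j) \<le> B"
    using bounded_if_eventually_const[of b f c] fc by blast
  define X where "X k \<omega> = N (real k * h) \<omega>" for k \<omega>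
  have [measurable]: "X k \<in> M \<rightarrow>\<^sub>M count_space UNIV" for k unfolding X_def by measurable
  have [measurable]: "Measurable.pred M (\<lambda>\<omega>. X k \<omega> \<notin> {b..})" for k
    by (rule measurable_compose[of "X k" M "count_space UNIV"]) auto
  define U where "U K = (LINT \<omega>|M. indicator A \<omega> *\<^sub>R stopped_payoff z {b..} f (\<lambda>k. X k \<omega>) K)" for K
  define a where "a k i = {\<omega>\<in>space M. N 0 \<omega> = n \<and> (\<forall>l\<le>k. X l \<omega> \<notin> {b..}) \<and> X k \<omega> = i}" for k i
  have "Measurable.pred M (\<lambda>\<omega>. \<forall>l\<le>k. X l \<omega> \<notin> {b..})" for k by measurable
  then have ma [measurable]: "a k i \<in> sets M" for k i unfolding a_def by measurable
  have mk': "measure M (a k i \<inter> {\<omega>\<in>space M. X (Suc k) \<omega> = j}) = measure M (a k i) * pmf (P h i) j" for k i j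
  proof -
    have "a k i \<inter> {\<omega>\<in>space M. X (Suc k) \<omega> = j} = {\<omega>\<in>space M. N 0 \<omega> = n \<and>
        (\<forall>l\<le>k. N (real l * h) \<omega> \<notin> {b..}) \<and> N (real k * h) \<omega> = i \<and> N (real (Suc k) * h) \<omega> = j}"
      unfolding a_def X_def by (auto simp: algebra_simps)
    then have "measure M (a k i \<inter> {\<omega>\<in>space M. X (Suc k) \<omega> = j}) = measure M {\<omega>\<in>space M. N 0 \<omega> = n \<and>
        (\<forall>l\<le>k. N (real l * h) \<omega> \<notin> {b..}) \<and> N (real k * h) \<omega> = i \<and> N (real (Suc k) * h) \<omega> = j}"
      by (rule arg_cong)
    also note mk
    finally show ?thesis unfolding a_def X_def .
  qed
  have int: "integrable M (\<lambda>\<omega>. indicator A \<omega> *\<^sub>R stopped_payoff z {b..} f (\<lambda>k. X k \<omega>) K)" for K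
  proof (rule integrable_const_bound[where B = B])
    show "AE \<omega> in M. norm (indicator A \<omega> *\<^sub>R stopped_payoff z {b..} f (\<lambda>k. X k \<omega>) K) \<le> B"
      using norm_stopped_payoff_le[OF z B] order_trans[OF norm_ge_zero B]
      by (intro AE_I2) (auto simp: indicator_def)
  qed measurable
  have step: "norm (U (Suc K) - U K) \<le> norm z ^ K * e" for K
  proof -
    \<comment> \<open>\<open>D i\<close> is the increment on the event that the current state is
      \<open>i\<close>. It is split by the next state \<open>j\<close>; as \<open>f j - c\<close>
      vanishes beyond \<open>b\<close>, finitely many \<open>j\<close> suffice.\<close>
    define D where "D i \<omega> = indicator (a K i) \<omega> *\<^sub>R (z ^ K * (z * c - f i)) +
       (\<Sum>j\<le>b. indicator (a K i \<inter> {\<omega>\<in>space M. X (Suc K) \<omega> = j}) \<omega> *\<^sub>R (z ^ Suc K * (f j - c)))" for i \<omega>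
    have "U (Suc K) - U K = (LINT \<omega>|M. indicator A \<omega> *\<^sub>R stopped_payoff z {b..} f (\<lambda>k. X k \<omega>) (Suc K)
        - indicator A \<omega> *\<^sub>R stopped_payoff z {b..} f (\<lambda>k. X k \<omega>) K)"
      unfolding U_def by (intro Bochner_Integration.integral_diff[symmetric] int)
    also have "\<dots> = (LINT \<omega>|M. (\<Sum>i<b. D i \<omega>))"
    proof (intro Bochner_Integration.integral_cong refl)
      fix \<omega> assume w: "\<omega> \<in> space M"
      show "indicator A \<omega> *\<^sub>R stopped_payoff z {b..} f (\<lambda>k. X k \<omega>) (Suc K)
        - indicator A \<omega> *\<^sub>R stopped_payoff z {b..} f (\<lambda>k. X k \<omega>) K = (\<Sum>i<b. D i \<omega>)"
      proof (cases "\<omega> \<in> A \<and> (\<forall>l\<le>K. X l \<omega> \<notin> {b..})")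
        case False
        then have "\<omega> \<notin> a K i" for i using w by (auto simp: a_def A_def)
        then have "D i \<omega> = 0" for i by (simp add: D_def)
        then show ?thesis using False by (auto simp: stopped_payoff_def)
      next
        case True
        have in_a: "\<omega> \<in> a K i \<longleftrightarrow> i = X K \<omega>" for i using True w by (auto simp: a_def A_def)
        have lt: "X K \<omega> < b" using True by force
        have "(\<Sum>i<b. D i \<omega>) = (\<Sum>i<b. if i = X K \<omega> then D i \<omega> else 0)"
          by (intro sum.cong) (auto simp: D_def in_a)
        also have "\<dots> = D (X K \<omega>) \<omega>" using lt by simp
        also have "\<dots> = z ^ K * (z * c - f (X K \<omega>)) +
            (\<Sum>j\<le>b. if j = X (Suc K) \<omega> then z ^ Suc K * (f j - c) else 0)"
        proof -
          have "(\<Sum>j\<le>b. indicator (a K (X K \<omega>) \<inter> {\<omega>\<in>space M. X (Suc K) \<omega> = j}) \<omega>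
                  *\<^sub>R (z ^ Suc K * (f j - c)))
              = (\<Sum>j\<le>b. if j = X (Suc K) \<omega> then z ^ Suc K * (f j - c) else 0)"
            using w in_a by (intro sum.cong refl) (auto simp: indicator_def)
          then show ?thesis unfolding D_def by (simp add: in_a)
        qed
        also have "\<dots> = z ^ K * (z * c - f (X K \<omega>)) + z ^ Suc K * (f (X (Suc K) \<omega>) - c)"
          using fc[of "X (Suc K) \<omega>"] by (subst sum.delta) (auto simp: not_le)
        also have "\<dots> = z ^ Suc K * f (X (Suc K) \<omega>) - z ^ K * f (X K \<omega>)"
          by (simp add: algebra_simps)
        finally show ?thesis using True by (simp add: stopped_payoff_def)
      qed
    qed
    also have "\<dots> = (\<Sum>i<b. z ^ K * of_real (prob (a K i)) *
        (z * (c + (\<Sum>j\<le>b. (f j - c) * of_real (pmf (P h i) j))) - f i))"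
    proof -
      have ind: "integrable M (\<lambda>\<omega>. indicator C \<omega> *\<^sub>R (v::complex))" if "C \<in> sets M" for C v
        using that by (intro integrable_scaleR_left integrable_real_indicator) (auto simp: less_top[symmetric])
      have ind_val: "(LINT \<omega>|M. indicator C \<omega> *\<^sub>R v) = prob C *\<^sub>R v" if "C \<in> sets M" for C and v :: complex
        using that sets.sets_into_space[OF that]
        by (subst integral_scaleR_left) (auto simp: less_top[symmetric] Int_absorb2)
      have iD: "integrable M (D i)" for i
        unfolding D_def by (intro Bochner_Integration.integrable_add Bochner_Integration.integrable_sum ind) auto
      have "(LINT \<omega>|M. (\<Sum>i<b. D i \<omega>)) = (\<Sum>i<b. LINT \<omega>|M. D i \<omega>)"
        by (intro Bochner_Integration.integral_sum iD)
      also have "\<dots> = (\<Sum>i<b. z ^ K * of_real (prob (a K i)) *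
        (z * (c + (\<Sum>j\<le>b. (f j - c) * of_real (pmf (P h i) j))) - f i))"
      proof (intro sum.cong refl)
        fix i
        show "(LINT \<omega>|M. D i \<omega>) = z ^ K * of_real (prob (a K i)) *
        (z * (c + (\<Sum>j\<le>b. (f j - c) * of_real (pmf (P h i) j))) - f i)"
        proof -
        have "(LINT \<omega>|M. D i \<omega>) = prob (a K i) *\<^sub>R (z ^ K * (z * c - f i)) +
          (\<Sum>j\<le>b. prob (a K i \<inter> {\<omega>\<in>space M. X (Suc K) \<omega> = j}) *\<^sub>R (z ^ Suc K * (f j - c)))"
          unfolding D_def
          by (subst Bochner_Integration.integral_add, (intro ind Bochner_Integration.integrable_sum; simp)+,
              subst Bochner_Integration.integral_sum, (intro ind; simp))
             (simp add: ind_val)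
        also have "\<dots> = z ^ K * of_real (prob (a K i)) *
        (z * (c + (\<Sum>j\<le>b. (f j - c) * of_real (pmf (P h i) j))) - f i)"
          unfolding mk' by (simp add: scaleR_conv_of_real algebra_simps sum_distrib_left sum_subtractf)
        finally show ?thesis .
        qed
      qed
      finally show ?thesis .
    qed
    finally have eq: "U (Suc K) - U K = (\<Sum>i<b. z ^ K * of_real (prob (a K i)) *
        (z * (c + (\<Sum>j\<le>b. (f j - c) * of_real (pmf (P h i) j))) - f i))" .
    have "norm (U (Suc K) - U K) \<le> (\<Sum>i<b. norm z ^ K * prob (a K i) * e)"
      unfolding eq using drift
      by (intro order_trans[OF norm_sum] sum_mono)
         (auto simp: norm_mult norm_power intro!: mult_left_mono)
    also have "\<dots> = norm z ^ K * e * (\<Sum>i<b. prob (a K i))" by (simp add: sum_distrib_left mult_ac)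
    also have "(\<Sum>i<b. prob (a K i)) = prob (\<Union>i<b. a K i)"
      by (intro finite_measure_finite_Union[symmetric]) (auto simp: disjoint_family_on_def a_def)
    also have "norm z ^ K * e * \<dots> \<le> norm z ^ K * e * 1" using e by (intro mult_left_mono) auto
    finally show ?thesis by simp
  qed
  have U0: "U 0 = measure M A * f n"
  proof -
    have "U 0 = (LINT \<omega>|M. indicator A \<omega> *\<^sub>R f n)"
      unfolding U_def by (intro Bochner_Integration.integral_cong) (auto simp: A_def X_def stopped_payoff_def indicator_def)
    then show ?thesis by (simp add: scaleR_conv_of_real)
  qed
  have bound: "norm (U K - U 0) \<le> e / (1 - norm z)" for K
  proof -
    have "norm (U K - U 0) = norm (\<Sum>k<K. U (Suc k) - U k)" by (simp add: sum_lessThan_telescope)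
    also have "\<dots> \<le> (\<Sum>k<K. norm z ^ k * e)" by (intro order_trans[OF norm_sum] sum_mono step)
    also have "\<dots> \<le> (\<Sum>k. norm z ^ k) * e"
      unfolding sum_distrib_right[symmetric] using z e by (intro mult_right_mono sum_le_suminf) auto
    also have "\<dots> = e / (1 - norm z)" using z by (simp add: suminf_geometric)
    finally show ?thesis .
  qed
  have lim: "U \<longlonglongrightarrow> (LINT \<omega>|M. indicator A \<omega> *\<^sub>R grid_payoff z {b..} f (\<lambda>k. X k \<omega>))"
    unfolding U_def
  proof (rule integral_dominated_convergence[where w = "\<lambda>_. B"])
    show "AE \<omega> in M. (\<lambda>K. indicator A \<omega> *\<^sub>R stopped_payoff z {b..} f (\<lambda>k. X k \<omega>) K)
       \<longlonglongrightarrow> indicator A \<omega> *\<^sub>R grid_payoff z {b..} f (\<lambda>k. X k \<omega>)"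
      by (intro AE_I2 tendsto_scaleR tendsto_const stopped_payoff_tendsto[OF z B])
    show "AE \<omega> in M. norm (indicator A \<omega> *\<^sub>R stopped_payoff z {b..} f (\<lambda>k. X k \<omega>) K) \<le> B" for K
      using norm_stopped_payoff_le[OF z B] order_trans[OF norm_ge_zero B]
      by (intro AE_I2) (auto simp: indicator_def)
    show "(\<lambda>\<omega>. indicator A \<omega> *\<^sub>R stopped_payoff z {b..} f (\<lambda>k. X k \<omega>) K) \<in> borel_measurable M" for K
      using int by (rule borel_measurable_integrable)
    have "(\<lambda>\<omega>. grid_payoff z {b..} f (\<lambda>k. X k \<omega>)) \<in> borel_measurable M"
      by (rule borel_measurable_grid_payoff) measurable
    then show "(\<lambda>\<omega>. indicator A \<omega> *\<^sub>R grid_payoff z {b..} f (\<lambda>k. X k \<omega>)) \<in> borel_measurable M"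
      by measurable
  qed auto
  have "norm ((LINT \<omega>|M. indicator A \<omega> *\<^sub>R grid_payoff z {b..} f (\<lambda>k. X k \<omega>)) - U 0) \<le> e / (1 - norm z)"
    by (rule tendsto_upperbound[OF tendsto_norm[OF tendsto_diff[OF lim tendsto_const]]])
       (auto intro!: always_eventually bound)
  then show ?thesis unfolding U0 X_def .
qed

text \<open>The mean of \<open>f\<close> after a time \<open>h\<close> is \<open>c\<close> plus the
  sum of \<open>(f j - c) * pmf (P h i) j\<close> over \<open>j \<le> b\<close>. The derivative of
  this at \<open>h = 0\<close> is the left side of \<open>gen\<close>, which therefore makes the
  discounted drift an \<open>o(h)\<close>, uniformly over the finitely many states below
  \<open>b\<close>.\<close>

lemma entry_payoff_generator:
  fixes f :: "nat \<Rightarrow> complex" and birth death :: "nat \<Rightarrow> real" and n b :: nat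
  assumes bd: "birth_death_process M N birth death"
    and \<theta>: "Re \<theta> > 0"
    and fc: "\<And>j. j > b \<Longrightarrow> f j = c"
    and gen: "\<And>i. i < b \<Longrightarrow>
       (\<Sum>j\<le>b. of_real (birth_death_rate birth death i j) * (f j - c)) = \<theta> * f i"
  defines "A \<equiv> {\<omega>\<in>space M. N 0 \<omega> = n}"
  shows "(LINT \<omega>|M. indicator A \<omega> *\<^sub>R entry_payoff \<theta> {b..} f (\<lambda>t. N t \<omega>)) = measure M A * f n"
proof -
  define q where "q = birth_death_rate birth death"
  obtain P :: "real \<Rightarrow> nat \<Rightarrow> nat pmf" where
    ps: "prob_space M" and
    meas: "\<And>t. 0 \<le> t \<Longrightarrow> N t \<in> M \<rightarrow>\<^sub>M count_space UNIV" and
    rc: "\<And>\<omega> t. \<omega> \<in> space M \<Longrightarrow> 0 \<le> t \<Longrightarrow> continuous (at_right t) (\<lambda>s. N s \<omega>)" and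
    fdd: "markov_fdd M N P" and
    rate: "\<And>i j. ((\<lambda>h. (pmf (P h i) j - of_bool (i = j)) / h) \<longlongrightarrow> q i j) (at_right 0)"
    using bd unfolding birth_death_process_def q_def markov_fdd_def by blast
  interpret prob_space M by (rule ps)
  have [measurable]: "N 0 \<in> M \<rightarrow>\<^sub>M count_space UNIV" by (intro meas) auto
  have mA [measurable]: "A \<in> sets M" unfolding A_def by measurable
  define \<delta> where "\<delta> h i = exp (- \<theta> * of_real h) * (c + (\<Sum>j\<le>b. (f j - c) * of_real (pmf (P h i) j))) - f i" for h i
  have \<delta>_lim: "((\<lambda>h. \<delta> h i / of_real h) \<longlongrightarrow> 0) (at_right 0)" if i: "i < b" for i
  proof -
    define E where "E h = (exp (- \<theta> * of_real h) - 1) / of_real h" for h :: real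
    have "((\<lambda>z. exp (- \<theta> * z)) has_field_derivative - \<theta>) (at 0)"
      by (auto intro!: derivative_eq_intros)
    then have "((\<lambda>z. (exp (- \<theta> * z) - 1) / z) \<longlongrightarrow> - \<theta>) (at 0)"
      by (simp add: has_field_derivative_iff)
    moreover have "filterlim (\<lambda>h. complex_of_real h) (at 0) (at_right 0)"
      by (auto simp: filterlim_at intro!: tendsto_eq_intros eventually_mono[OF eventually_at_right_less])
    ultimately have E: "(E \<longlongrightarrow> - \<theta>) (at_right 0)"
      unfolding E_def by (rule filterlim_compose)
    define R where "R j h = (pmf (P h i) j - of_bool (i = j)) / h" for j h
    have R: "((\<lambda>h. complex_of_real (R j h)) \<longlongrightarrow> of_real (q i j)) (at_right 0)" for j
      unfolding R_def by (intro tendsto_of_real rate)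
    have id: "((\<lambda>h::real. complex_of_real h) \<longlongrightarrow> 0) (at_right 0)"
      by (auto intro!: tendsto_eq_intros)
    define S where "S h = (\<Sum>j\<le>b. (f j - c) * of_real (R j h))" for h
    have S: "(S \<longlongrightarrow> (\<Sum>j\<le>b. (f j - c) * of_real (q i j))) (at_right 0)"
      unfolding S_def by (intro tendsto_intros R)
    \<comment> \<open>With the discount split off, one part tends to \<open>- \<theta> * f i\<close>
      and the other to the left side of \<open>gen\<close>; these limits cancel.\<close>
    have eq: "\<delta> h i / of_real h = E h * (f i + of_real h * S h) + S h" if h: "h > 0" for h
    proof -
      have pm: "complex_of_real (pmf (P h i) j) = of_bool (i = j) + of_real h * of_real (R j h)" for j
        using h by (simp add: R_def)
      have "(\<Sum>j\<le>b. (f j - c) * of_bool (i = j)) = (\<Sum>j\<le>b. if i = j then f j - c else 0)"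
        by (intro sum.cong) auto
      also have "\<dots> = f i - c" using i by simp
      finally have "c + (\<Sum>j\<le>b. (f j - c) * of_real (pmf (P h i) j)) = f i + of_real h * S h"
        unfolding pm S_def by (simp add: distrib_left sum.distrib sum_distrib_left mult_ac)
      then show ?thesis
        unfolding \<delta>_def E_def using h by (simp add: field_simps)
    qed
    have "((\<lambda>h. E h * (f i + of_real h * S h) + S h) \<longlongrightarrow>
        - \<theta> * (f i + 0 * (\<Sum>j\<le>b. (f j - c) * of_real (q i j))) + (\<Sum>j\<le>b. (f j - c) * of_real (q i j))) (at_right 0)"
      by (intro tendsto_intros E S id)
    moreover have "(\<Sum>j\<le>b. (f j - c) * of_real (q i j)) = \<theta> * f i"
      using gen[OF i] by (simp add: q_def mult.commute)
    ultimately have "((\<lambda>h. E h * (f i + of_real h * S h) + S h) \<longlongrightarrow> 0) (at_right 0)" by simp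
    then show ?thesis
      by (rule Lim_transform_eventually) (use eq in \<open>auto intro: eventually_mono[OF eventually_at_right_less]\<close>)
  qed
  define r where "r = Re \<theta>"
  define h where "h p = 1 / real (Suc p)" for p
  have hpos: "h p > 0" for p by (simp add: h_def)
  have hlim0: "h \<longlonglongrightarrow> 0"
    unfolding h_def using LIMSEQ_inverse_real_of_nat by (simp add: inverse_eq_divide)
  have hlim: "filterlim h (at_right 0) sequentially"
    using hlim0 hpos by (auto simp: filterlim_at intro!: always_eventually less_imp_neq[symmetric])
  define G where "G p \<omega> = grid_payoff (exp (- \<theta> * of_real (h p))) {b..} f (\<lambda>k. N (real k * h p) \<omega>)" for p \<omega>
  define L where "L = (LINT \<omega>|M. indicator A \<omega> *\<^sub>R entry_payoff \<theta> {b..} f (\<lambda>t. N t \<omega>))"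
  obtain B where B: "\<And>j. norm (f j) \<le> B"
    using bounded_if_eventually_const[of b f c] fc by blast
  have zlt: "norm (exp (- \<theta> * of_real (h p))) = exp (- r * h p)" for p by (simp add: r_def)
  have zlt1: "norm (exp (- \<theta> * of_real (h p))) < 1" for p
    unfolding zlt using \<theta> hpos[of p] by (simp add: r_def)
  have lim1: "(\<lambda>p. LINT \<omega>|M. indicator A \<omega> *\<^sub>R G p \<omega>) \<longlonglongrightarrow> L"
    unfolding L_def
  proof (rule integral_dominated_convergence[where w = "\<lambda>_. B"])
    show "AE \<omega> in M. (\<lambda>p. indicator A \<omega> *\<^sub>R G p \<omega>)
       \<longlonglongrightarrow> indicator A \<omega> *\<^sub>R entry_payoff \<theta> {b..} f (\<lambda>t. N t \<omega>)"
      unfolding G_def h_def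
      by (intro AE_I2 tendsto_scaleR tendsto_const grid_payoff_tendsto rc)
    have "norm (G p \<omega>) \<le> B" for p \<omega>
      unfolding G_def
    proof (rule tendsto_upperbound[OF tendsto_norm[OF stopped_payoff_tendsto[OF zlt1 B]]])
      show "\<forall>\<^sub>F K in sequentially. norm (stopped_payoff (exp (- \<theta> * of_real (h p))) {b..} f
          (\<lambda>k. N (real k * h p) \<omega>) K) \<le> B"
        by (intro always_eventually allI norm_stopped_payoff_le[OF zlt1 B])
    qed simp
    then show "AE \<omega> in M. norm (indicator A \<omega> *\<^sub>R G p \<omega>) \<le> B" for p
      using order_trans[OF norm_ge_zero B] by (intro AE_I2) (auto simp: indicator_def)
    have "G p \<in> borel_measurable M" for p
      unfolding G_def[abs_def] using hpos[of p]
      by (intro borel_measurable_grid_payoff meas) auto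
    then show "(\<lambda>\<omega>. indicator A \<omega> *\<^sub>R G p \<omega>) \<in> borel_measurable M" for p by measurable
    have "(\<lambda>\<omega>. entry_payoff \<theta> {b..} f (\<lambda>t. N t \<omega>)) \<in> borel_measurable M"
      by (intro borel_measurable_entry_payoff meas rc)
    then show "(\<lambda>\<omega>. indicator A \<omega> *\<^sub>R entry_payoff \<theta> {b..} f (\<lambda>t. N t \<omega>)) \<in> borel_measurable M"
      by measurable
  qed auto
  have lim2: "(\<lambda>p. LINT \<omega>|M. indicator A \<omega> *\<^sub>R G p \<omega>) \<longlonglongrightarrow> measure M A * f n"
  proof (rule LIMSEQ_I)
    fix e :: real assume e: "e > 0"
    \<comment> \<open>The geometric weights sum to \<open>1 / (1 - exp (- r * h p))\<close>, which
      is at most \<open>2 / (r * h p)\<close> once \<open>r * h p \<le> 1\<close>; with this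
      \<open>e'\<close> the total error is \<open>e / 2\<close>.\<close>
    define e' where "e' = e * r / 4"
    have r: "r > 0" using \<theta> by (simp add: r_def)
    have e': "e' > 0" using e r by (simp add: e'_def)
    have "\<forall>\<^sub>F h in at_right 0. \<forall>i\<in>{..<b}. norm (\<delta> h i / of_real h) < e'"
      using order_tendstoD(2)[OF tendsto_norm[OF \<delta>_lim], of _ e'] e'
      by (intro eventually_ball_finite) auto
    then have "\<forall>\<^sub>F p in sequentially. \<forall>i\<in>{..<b}. norm (\<delta> (h p) i / of_real (h p)) < e'"
      using hlim by (rule eventually_compose_filterlim)
    moreover have "\<forall>\<^sub>F p in sequentially. h p < 1 / r"
      using order_tendstoD(2)[OF hlim0, of "1/r"] r by simp
    ultimately have "\<forall>\<^sub>F p in sequentially. norm ((LINT \<omega>|M. indicator A \<omega> *\<^sub>R G p \<omega>) - measure M A * f n) < e"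
    proof eventually_elim
      case (elim p)
      have hp: "h p > 0" by (rule hpos)
      have dr: "norm (\<delta> (h p) i) \<le> e' * h p" if "i < b" for i
        using elim(1) that hp by (auto simp: norm_divide field_simps intro: less_imp_le)
      have u: "r * h p > 0" "r * h p \<le> 1" using elim(2) hp r by (auto simp: field_simps)
      have "exp (- (r * h p)) \<le> 1 / (1 + r * h p)"
        using exp_ge_add_one_self[of "r * h p"] u by (simp add: exp_minus field_simps)
      moreover have "1 / (1 + r * h p) \<le> 1 - r * h p / 2"
        using u mult_left_mono[of "r * h p" 1 "r * h p"] by (simp add: field_simps power2_eq_square)
      ultimately have "1 - exp (- r * h p) \<ge> r * h p / 2" by simp
      then have 2: "e' * h p / (1 - exp (- r * h p)) \<le> e' * h p / (r * h p / 2)"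
        using u e' hp by (intro divide_left_mono) (auto intro!: mult_pos_pos)
      have "norm ((LINT \<omega>|M. indicator A \<omega> *\<^sub>R G p \<omega>) - measure M A * f n)
          \<le> e' * h p / (1 - norm (exp (- \<theta> * of_real (h p))))"
        unfolding G_def A_def
        by (rule grid_dynkin_step[where P = P, OF ps _ _ hp fc zlt1])
           (use meas fdd dr e' hp in \<open>auto simp: \<delta>_def\<close>)
      also have "\<dots> \<le> e' * h p / (r * h p / 2)" unfolding zlt by (rule 2)
      also have "\<dots> = e / 2" using hp r by (simp add: e'_def field_simps)
      also have "\<dots> < e" using e by simp
      finally show ?case .
    qed
    then show "\<exists>no. \<forall>p\<ge>no. norm ((LINT \<omega>|M. indicator A \<omega> *\<^sub>R G p \<omega>) - measure M A * f n) < e"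
      by (simp add: eventually_sequentially)
  qed
  show ?thesis using LIMSEQ_unique[OF lim1 lim2] unfolding L_def .
qed

section \<open>First passage of a birth-death process\<close>

text \<open>At \<open>i = 0\<close> the truncated \<open>i - 1\<close> is again \<open>0\<close>;
  \<open>death 0 = 0\<close> removes the spurious term.\<close>

lemma sum_birth_death_rate:
  fixes g :: "nat \<Rightarrow> complex"
  assumes "i < b" "death 0 = 0"
  shows "(\<Sum>j\<le>b. of_real (birth_death_rate birth death i j) * g j) =
           of_real (birth i) * g (Suc i) + of_real (death i) * g (i - 1)
             - of_real (birth i + death i) * g i"
proof -
  have "(\<Sum>j\<le>b. of_real (birth_death_rate birth death i j) * g j) =
     (\<Sum>j\<le>b. (if j = Suc i then of_real (birth i) * g j else 0) +
        ((if j = i - 1 then of_real (death i) * g j else 0)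
          - (if j = i then of_real (birth i + death i) * g j else 0)))"
    using assms(2) by (intro sum.cong refl) (cases i; auto simp: birth_death_rate_def algebra_simps)
  also have "\<dots> = of_real (birth i) * g (Suc i) + of_real (death i) * g (i - 1)
             - of_real (birth i + death i) * g i"
    unfolding sum.distrib sum_subtractf using assms(1) by (simp add: sum.delta)
  finally show ?thesis .
qed

lemma integral_uniform_measure:
  fixes g :: "'a \<Rightarrow> complex"
  assumes "prob_space M" "measure M A > 0" and g: "g \<in> borel_measurable M"
  shows "(LINT \<omega>|uniform_measure M A. g \<omega>) = (LINT \<omega>|M. indicator A \<omega> *\<^sub>R g \<omega>) / of_real (measure M A)"
proof -
  interpret prob_space M by fact
  have mA [measurable]: "A \<in> sets M" using assms(2) measure_notin_sets by fastforce
  have "uniform_measure M A = density M (\<lambda>\<omega>. ennreal (indicator A \<omega> / measure M A))"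
    unfolding uniform_measure_def
    using assms(2) by (intro density_cong)
      (auto simp: emeasure_eq_measure indicator_def divide_ennreal[symmetric])
  then have "(LINT \<omega>|uniform_measure M A. g \<omega>) = (LINT \<omega>|M. (indicator A \<omega> / measure M A) *\<^sub>R g \<omega>)"
    using g by (simp add: integral_density)
  also have "\<dots> = (LINT \<omega>|M. (indicator A \<omega> *\<^sub>R g \<omega>) / of_real (measure M A))"
    by (intro Bochner_Integration.integral_cong) (auto simp: scaleR_conv_of_real)
  finally show ?thesis by simp
qed

text \<open>\<open>entry_payoff_generator\<close> controls the entry into \<open>{b..}\<close>, not
  the visit to \<open>b\<close>. Once the entry is known to occur at \<open>b\<close> almost surely,
  the two times coincide and the factor \<open>\<phi> b\<close> can be pulled out of the
  payoff.\<close>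

lemma hitting_laplace_generator:
  fixes \<phi> :: "nat \<Rightarrow> complex" and n b :: nat
  assumes bd: "birth_death_process M N birth death"
    and A: "measure M {\<omega>\<in>space M. N 0 \<omega> = n} > 0"
    and \<theta>: "Re \<theta> > 0" and nb: "n \<le> b" and d0: "death 0 = 0"
    and gen: "\<And>i. i < b \<Longrightarrow> of_real (birth i) * \<phi> (Suc i) + of_real (death i) * \<phi> (i - 1)
               = (of_real (birth i + death i) + \<theta>) * \<phi> i"
  shows "\<phi> b * hitting_laplace M N b \<theta> n = \<phi> n"
proof -
  define A' where "A' = {\<omega>\<in>space M. N 0 \<omega> = n}"
  have ps: "prob_space M" and
    meas: "\<And>t. 0 \<le> t \<Longrightarrow> N t \<in> M \<rightarrow>\<^sub>M count_space UNIV" and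
    rc: "\<And>\<omega> t. \<omega> \<in> space M \<Longrightarrow> 0 \<le> t \<Longrightarrow> continuous (at_right t) (\<lambda>s. N s \<omega>)"
    using bd unfolding birth_death_process_def by blast+
  interpret prob_space M by (rule ps)
  have mA [measurable]: "A' \<in> sets M" using A measure_notin_sets unfolding A'_def by fastforce
  have mp [measurable]: "(\<lambda>\<omega>. entry_payoff \<theta> S f (\<lambda>t. N t \<omega>)) \<in> borel_measurable M" for \<theta> S f
    by (intro borel_measurable_entry_payoff meas rc)
  define over where "over j = (of_bool (j > b) :: complex)" for j
  \<comment> \<open>On \<open>{..b}\<close> the function \<open>over - 1\<close> is constantly
    \<open>-1\<close>, and for a state below \<open>b\<close> the rates sum to zero there; so
    \<open>over\<close> solves the equation with \<open>c = 1\<close>. The discount rate 1 is an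
    arbitrary positive choice.\<close>
  have "(LINT \<omega>|M. indicator A' \<omega> *\<^sub>R entry_payoff 1 {b..} over (\<lambda>t. N t \<omega>)) = measure M A' * over n"
    unfolding A'_def
  proof (rule entry_payoff_generator[OF bd, where c = 1])
    show "(\<Sum>j\<le>b. of_real (birth_death_rate birth death i j) * (over j - 1)) = 1 * over i" if i: "i < b" for i
      using i sum_birth_death_rate[where death = death and birth = birth and g = "\<lambda>_. -1", OF i d0]
      by (simp add: over_def)
  qed (auto simp: over_def)
  then have "(LINT \<omega>|M. indicator A' \<omega> *\<^sub>R entry_payoff 1 {b..} over (\<lambda>t. N t \<omega>)) = 0"
    using nb by (simp add: over_def)
  \<comment> \<open>With a real discount the payoff is real and nonnegative, so that its zero mean
    forces it to vanish almost everywhere.\<close>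
  moreover have "indicator A' \<omega> *\<^sub>R entry_payoff 1 {b..} over (\<lambda>t. N t \<omega>) =
      of_real (norm (indicator A' \<omega> *\<^sub>R entry_payoff 1 {b..} over (\<lambda>t. N t \<omega>)))" for \<omega>
    by (auto simp: entry_payoff_def over_def indicator_def exp_of_real[symmetric] simp flip: of_real_minus)
  ultimately have "complex_of_real (LINT \<omega>|M. norm (indicator A' \<omega> *\<^sub>R entry_payoff 1 {b..} over (\<lambda>t. N t \<omega>))) = 0"
    by (metis (no_types, lifting) Bochner_Integration.integral_cong integral_complex_of_real)
  then have "(LINT \<omega>|M. norm (indicator A' \<omega> *\<^sub>R entry_payoff 1 {b..} over (\<lambda>t. N t \<omega>))) = 0"
    by simp
  moreover have "integrable M (\<lambda>\<omega>. norm (indicator A' \<omega> *\<^sub>R entry_payoff 1 {b..} over (\<lambda>t. N t \<omega>)))"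
  proof (rule integrable_const_bound[where B = 1])
    show "AE \<omega> in M. norm (norm (indicator A' \<omega> *\<^sub>R entry_payoff 1 {b..} over (\<lambda>t. N t \<omega>))) \<le> 1"
    proof (rule AE_I2)
      fix \<omega> assume w: "\<omega> \<in> space M"
      show "norm (norm (indicator A' \<omega> *\<^sub>R entry_payoff 1 {b..} over (\<lambda>t. N t \<omega>))) \<le> 1"
        using entry_time_props(1)[of "\<lambda>t. N t \<omega>" "{b..}", OF rc[OF w]]
        by (auto simp: entry_payoff_def over_def indicator_def)
    qed
  qed measurable
  ultimately have "AE \<omega> in M. norm (indicator A' \<omega> *\<^sub>R entry_payoff 1 {b..} over (\<lambda>t. N t \<omega>)) = 0"
    by (subst (asm) integral_nonneg_eq_0_iff_AE) auto
  then have ae: "AE \<omega> in M. indicator A' \<omega> *\<^sub>R entry_payoff \<theta> {b..} (\<lambda>j. if j \<le> b then \<phi> j else 0) (\<lambda>t. N t \<omega>) =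
      \<phi> b * (indicator A' \<omega> *\<^sub>R entry_payoff \<theta> {b} (\<lambda>_. 1) (\<lambda>t. N t \<omega>))"
  proof (eventually_elim, goal_cases)
    case (1 \<omega>)
    show ?case
    proof (cases "\<omega> \<in> A' \<and> (\<exists>t\<ge>0. N t \<omega> \<in> {b..})")
      case False
      then show ?thesis by (auto simp: entry_payoff_def)
    next
      case True
      then have w: "\<omega> \<in> space M" and ex: "\<exists>t\<ge>0. N t \<omega> \<in> {b..}" by (auto simp: A'_def)
      define s where "s = entry_time {b..} (\<lambda>t. N t \<omega>)"
      note s = entry_time_props[of "\<lambda>t. N t \<omega>" "{b..}", OF rc[OF w] ex, folded s_def]
      have Ns: "N s \<omega> = b"
        using 1 True ex s(2) by (auto simp: entry_payoff_def over_def s_def[symmetric] split: if_splits)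
      have "entry_time {b} (\<lambda>t. N t \<omega>) = s"
        unfolding entry_time_def using s Ns by (intro Least_equality) auto
      then show ?thesis using True Ns s(1) by (auto simp: entry_payoff_def s_def[symmetric])
    qed
  qed
  \<comment> \<open>Cutting \<open>\<phi>\<close> off above \<open>b\<close> is harmless, since a
    state below \<open>b\<close> has no rate to a state above \<open>b\<close>; it produces the form
    required with \<open>c = 0\<close>.\<close>
  have "(LINT \<omega>|M. indicator A' \<omega> *\<^sub>R entry_payoff \<theta> {b..} (\<lambda>j. if j \<le> b then \<phi> j else 0) (\<lambda>t. N t \<omega>))
       = measure M A' * (if n \<le> b then \<phi> n else 0)"
    unfolding A'_def
  proof (rule entry_payoff_generator[OF bd \<theta>, where c = 0])
    show "(\<Sum>j\<le>b. of_real (birth_death_rate birth death i j) * ((if j \<le> b then \<phi> j else 0) - 0)) =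
        \<theta> * (if i \<le> b then \<phi> i else 0)" if i: "i < b" for i
    proof -
      have "(\<Sum>j\<le>b. of_real (birth_death_rate birth death i j) * ((if j \<le> b then \<phi> j else 0) - 0))
          = (\<Sum>j\<le>b. of_real (birth_death_rate birth death i j) * \<phi> j)"
        by (intro sum.cong) auto
      also have "\<dots> = \<theta> * \<phi> i"
        unfolding sum_birth_death_rate[where death = death, OF i d0] using gen[OF i]
        by (simp add: algebra_simps)
      finally show ?thesis using i by simp
    qed
  qed auto
  also have "(LINT \<omega>|M. indicator A' \<omega> *\<^sub>R entry_payoff \<theta> {b..} (\<lambda>j. if j \<le> b then \<phi> j else 0) (\<lambda>t. N t \<omega>))
      = (LINT \<omega>|M. \<phi> b * (indicator A' \<omega> *\<^sub>R entry_payoff \<theta> {b} (\<lambda>_. 1) (\<lambda>t. N t \<omega>)))"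
    by (intro integral_cong_AE ae) measurable
  also have "\<dots> = \<phi> b * (LINT \<omega>|M. indicator A' \<omega> *\<^sub>R entry_payoff \<theta> {b} (\<lambda>_. 1) (\<lambda>t. N t \<omega>))"
    by (rule integral_mult_right_zero)
  finally have *: "\<phi> b * (LINT \<omega>|M. indicator A' \<omega> *\<^sub>R entry_payoff \<theta> {b} (\<lambda>_. 1) (\<lambda>t. N t \<omega>))
      = measure M A' * \<phi> n" using nb by simp
  have "hitting_laplace M N b \<theta> n = (LINT \<omega>|uniform_measure M A'. entry_payoff \<theta> {b} (\<lambda>_. 1) (\<lambda>t. N t \<omega>))"
    unfolding hitting_laplace_def A'_def
    by (intro Bochner_Integration.integral_cong)
       (auto simp: entry_payoff_def hitting_time_def entry_time_def)
  also have "\<dots> = (LINT \<omega>|M. indicator A' \<omega> *\<^sub>R entry_payoff \<theta> {b} (\<lambda>_. 1) (\<lambda>t. N t \<omega>)) / of_real (measure M A')"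
    using A by (intro integral_uniform_measure ps) (auto simp: A'_def)
  finally show ?thesis using * A by (simp add: A'_def)
qed

section \<open>Hankel contour integrals\<close>

text \<open>A weakening of \<open>hankel_contour\<close> that parabolas satisfy as well: the
  imaginary part need not converge, it keeps its sign and grows at most linearly in the real part.
  One uniqueness result then covers both the given contours and the parabolas.\<close>

definition hankel_path :: "complex set \<Rightarrow> (real \<Rightarrow> complex) \<Rightarrow> bool" where
  "hankel_path D \<gamma> \<longleftrightarrow>
     (\<forall>a b. \<gamma> piecewise_C1_differentiable_on {a..b}) \<and> range \<gamma> \<subseteq> D \<and>
     filterlim (\<lambda>t. Re (\<gamma> t)) at_bot at_bot \<and> filterlim (\<lambda>t. Re (\<gamma> t)) at_bot at_top \<and>
     (\<forall>\<^sub>F t in at_bot. 0 < - Im (\<gamma> t) \<and> - Im (\<gamma> t) \<le> 1 + \<bar>Re (\<gamma> t)\<bar>) \<and>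
     (\<forall>\<^sub>F t in at_top. 0 < Im (\<gamma> t) \<and> Im (\<gamma> t) \<le> 1 + \<bar>Re (\<gamma> t)\<bar>)"

lemma hankel_contour_imp_hankel_path:
  assumes "hankel_contour S \<gamma>"
  shows "hankel_path (- S) \<gamma>"
proof -
  obtain e where e: "e > 0" and
    l: "filterlim (\<lambda>t. Re (\<gamma> t)) at_bot at_bot" "((\<lambda>t. Im (\<gamma> t)) \<longlongrightarrow> - e) at_bot"
       "filterlim (\<lambda>t. Re (\<gamma> t)) at_bot at_top" "((\<lambda>t. Im (\<gamma> t)) \<longlongrightarrow> e) at_top"
    using assms unfolding hankel_contour_def by blast
  have 1: "\<forall>\<^sub>F t in at_bot. Re (\<gamma> t) \<le> - 2 * e" "\<forall>\<^sub>F t in at_top. Re (\<gamma> t) \<le> - 2 * e"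
    using l(1,3) by (auto simp: filterlim_at_bot)
  have 2: "\<forall>\<^sub>F t in at_bot. Im (\<gamma> t) < 0" "\<forall>\<^sub>F t in at_bot. Im (\<gamma> t) > - 2 * e"
    using order_tendstoD[OF l(2)] e by auto
  have 3: "\<forall>\<^sub>F t in at_top. Im (\<gamma> t) > 0" "\<forall>\<^sub>F t in at_top. Im (\<gamma> t) < 2 * e"
    using order_tendstoD[OF l(4)] e by auto
  have "\<forall>\<^sub>F t in at_bot. 0 < - Im (\<gamma> t) \<and> - Im (\<gamma> t) \<le> 1 + \<bar>Re (\<gamma> t)\<bar>"
    using 1(1) 2 by eventually_elim auto
  moreover have "\<forall>\<^sub>F t in at_top. 0 < Im (\<gamma> t) \<and> Im (\<gamma> t) \<le> 1 + \<bar>Re (\<gamma> t)\<bar>"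
    using 1(2) 3 by eventually_elim auto
  ultimately show ?thesis
    using assms l unfolding hankel_path_def hankel_contour_def by auto
qed

section \<open>Independence of the contour\<close>

text \<open>\<open>\<sigma>\<close> selects the upper or the lower end. On the horizontal line at
  height \<open>\<sigma>\<close> the exponential decay of \<open>f\<close> makes \<open>F\<close>
  Cauchy. Any other point is joined to that line by a vertical segment of length at most
  \<open>1 + |Re z|\<close>, along which \<open>F\<close> changes by an exponentially small amount.
  Nothing about the speed of the path enters.\<close>

lemma primitive_tendsto_at_left_infinity:
  fixes f F :: "complex \<Rightarrow> complex" and \<sigma> c C :: real
  assumes \<sigma>: "\<sigma> = 1 \<or> \<sigma> = -1" and c: "c > 0"
    and dF: "\<And>z. Re z \<le> -1 \<Longrightarrow> 0 < \<sigma> * Im z \<Longrightarrow> (F has_field_derivative f z) (at z)"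
    and bnd: "\<And>z. Re z \<le> -1 \<Longrightarrow> 0 < \<sigma> * Im z \<Longrightarrow> \<sigma> * Im z \<le> 1 + \<bar>Re z\<bar> \<Longrightarrow>
                norm (f z) \<le> C * exp (c * Re z)"
  obtains L where "\<And>(\<gamma> :: real \<Rightarrow> complex) A. filterlim (\<lambda>t. Re (\<gamma> t)) at_bot A \<Longrightarrow>
      \<forall>\<^sub>F t in A. 0 < \<sigma> * Im (\<gamma> t) \<and> \<sigma> * Im (\<gamma> t) \<le> 1 + \<bar>Re (\<gamma> t)\<bar> \<Longrightarrow> ((\<lambda>t. F (\<gamma> t)) \<longlongrightarrow> L) A"
proof -
  have \<sigma>2: "\<sigma> * \<sigma> = 1" using \<sigma> by auto
  have C: "C \<ge> 0"
  proof -
    have "0 \<le> norm (f (Complex (-1) \<sigma>))" by simp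
    also have "\<dots> \<le> C * exp (c * Re (Complex (-1) \<sigma>))" using \<sigma>2 by (intro bnd) auto
    finally show ?thesis by (simp add: zero_le_mult_iff)
  qed
  define g where "g x = F (Complex x \<sigma>)" for x
  have dg: "(g has_vector_derivative f (Complex x \<sigma>)) (at x)" if "x \<le> -1" for x
  proof -
    have "((\<lambda>x. Complex x \<sigma>) has_vector_derivative 1) (at x)"
      unfolding Complex_eq has_vector_derivative_def
      by (auto intro!: derivative_eq_intros simp: scaleR_conv_of_real)
    moreover have "(F has_field_derivative f (Complex x \<sigma>)) (at (Complex x \<sigma>))"
      using that \<sigma>2 by (intro dF) auto
    ultimately show ?thesis
      unfolding g_def using field_vector_diff_chain_at[of "\<lambda>x. Complex x \<sigma>" 1 x F "f (Complex x \<sigma>)"]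
      by (simp add: o_def)
  qed
  have hor: "norm (g x' - g x) \<le> C / c * exp (c * x')" if "x \<le> x'" "x' \<le> -1" for x x'
  proof (cases "x = x'")
    case False
    have "norm (g x' - g x) \<le> C / c * exp (c * x') - C / c * exp (c * x)"
    proof (rule differentiable_bound_general[where f' = "\<lambda>x. f (Complex x \<sigma>)" and \<phi>' = "\<lambda>x. C * exp (c * x)"])
      show "continuous_on {x..x'} g"
        using that by (intro continuous_at_imp_continuous_on ballI has_vector_derivative_continuous[OF dg]) auto
      show "(g has_vector_derivative f (Complex y \<sigma>)) (at y)" if "x < y" "y < x'" for y
        using that \<open>x' \<le> -1\<close> by (intro dg) auto
      show "((\<lambda>x. C / c * exp (c * x)) has_vector_derivative C * exp (c * y)) (at y)" for y
        unfolding has_real_derivative_iff_has_vector_derivative[symmetric]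
        using c by (auto intro!: derivative_eq_intros)
      show "norm (f (Complex y \<sigma>)) \<le> C * exp (c * y)" if "x < y" "y < x'" for y
        using that \<open>x' \<le> -1\<close> \<sigma>2 bnd[of "Complex y \<sigma>"] by auto
    qed (use that False c in \<open>auto intro!: continuous_intros\<close>)
    also have "\<dots> \<le> C / c * exp (c * x')" using C c by simp
    finally show ?thesis .
  qed (use C c in auto)
  define u where "u n = g (- real n - 1)" for n :: nat
  have elim: "((\<lambda>x. C / c * exp (c * x)) \<longlongrightarrow> 0) at_bot" using c by real_asymp
  have "Cauchy u"
  proof (rule metric_CauchyI)
    fix e :: real assume "e > 0"
    have "\<forall>\<^sub>F x in at_bot. C / c * exp (c * x) < e"
      using order_tendstoD(2)[OF elim \<open>e > 0\<close>] .
    then obtain X where X: "\<And>x. x \<le> X \<Longrightarrow> C / c * exp (c * x) < e"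
      by (auto simp: eventually_at_bot_linorder)
    obtain n0 :: nat where n0: "real n0 \<ge> - X" using real_arch_simple by blast
    have *: "dist (u m) (u n) < e" if "m \<ge> n0" "m \<le> n" for m n
    proof -
      have "norm (u m - u n) \<le> C / c * exp (c * (- real m - 1))"
        unfolding u_def using that by (intro hor) auto
      also have "\<dots> < e" using that n0 by (intro X) auto
      finally show ?thesis by (simp add: dist_norm)
    qed
    show "\<exists>M. \<forall>m\<ge>M. \<forall>n\<ge>M. dist (u m) (u n) < e"
      by (intro exI[of _ n0] allI impI) (metis * dist_commute nle_le)
  qed
  then obtain L where L: "u \<longlonglongrightarrow> L" using Cauchy_convergent_iff convergent_def by blast
  have gL: "norm (g x - L) \<le> C / c * exp (c * x)" if "x \<le> -1" for x
  proof (rule tendsto_upperbound[OF tendsto_norm[OF tendsto_diff[OF tendsto_const L]]])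
    obtain n0 :: nat where n0: "real n0 \<ge> - x" using real_arch_simple by blast
    show "\<forall>\<^sub>F n in sequentially. norm (g x - u n) \<le> C / c * exp (c * x)"
      using eventually_ge_at_top[of n0]
    proof eventually_elim
      case (elim n)
      then show ?case using hor[of "- real n - 1" x] n0 that by (simp add: u_def)
    qed
  qed simp
  have est: "norm (F z - L) \<le> C * exp (c * Re z) * (1 + \<bar>Re z\<bar>) + C / c * exp (c * Re z)"
    if z: "Re z \<le> -1" "0 < \<sigma> * Im z" "\<sigma> * Im z \<le> 1 + \<bar>Re z\<bar>" for z
  proof -
    \<comment> \<open>The set is a vertical segment because the bound on \<open>f\<close> depends on
      \<open>Re z\<close> only and is thus constant on it.\<close>
    define S where "S = {w. Re w = Re z \<and> 0 < \<sigma> * Im w \<and> \<sigma> * Im w \<le> 1 + \<bar>Re z\<bar>}"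
    have "S = {w. 1 \<bullet> w = Re z} \<inter> {w. (of_real \<sigma> * \<i>) \<bullet> w > 0} \<inter> {w. (of_real \<sigma> * \<i>) \<bullet> w \<le> 1 + \<bar>Re z\<bar>}"
      by (auto simp: S_def inner_complex_def)
    then have "convex S"
      by (simp only:) (intro convex_Int convex_halfspace_le convex_halfspace_gt convex_hyperplane)
    then have "norm (F z - F (Complex (Re z) \<sigma>)) \<le> C * exp (c * Re z) * norm (z - Complex (Re z) \<sigma>)"
    proof (rule field_differentiable_bound)
      show "(F has_field_derivative f w) (at w within S)" if "w \<in> S" for w
        using that z by (intro DERIV_subset[OF dF]) (auto simp: S_def)
      show "norm (f w) \<le> C * exp (c * Re z)" if "w \<in> S" for w
        using that z bnd[of w] by (auto simp: S_def)
    qed (use z \<sigma>2 in \<open>auto simp: S_def\<close>)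
    also have "norm (z - Complex (Re z) \<sigma>) = \<bar>Im z - \<sigma>\<bar>"
      by (simp add: cmod_def)
    also have "\<dots> \<le> 1 + \<bar>Re z\<bar>" using z \<sigma> by auto
    finally have "norm (F z - g (Re z)) \<le> C * exp (c * Re z) * (1 + \<bar>Re z\<bar>)"
      using C by (simp add: g_def mult_left_mono)
    with gL[OF z(1)] show ?thesis
      using norm_triangle_ineq[of "F z - g (Re z)" "g (Re z) - L"] by simp
  qed
  show thesis
  proof (rule that)
    fix \<gamma> :: "real \<Rightarrow> complex" and A
    assume re: "filterlim (\<lambda>t. Re (\<gamma> t)) at_bot A"
      and ev: "\<forall>\<^sub>F t in A. 0 < \<sigma> * Im (\<gamma> t) \<and> \<sigma> * Im (\<gamma> t) \<le> 1 + \<bar>Re (\<gamma> t)\<bar>"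
    have "((\<lambda>t. F (\<gamma> t) - L) \<longlongrightarrow> 0) A"
    proof (rule Lim_null_comparison)
      have "\<forall>\<^sub>F t in A. Re (\<gamma> t) \<le> -1" using re by (auto simp: filterlim_at_bot)
      with ev show "\<forall>\<^sub>F t in A. norm (F (\<gamma> t) - L) \<le> C * exp (c * Re (\<gamma> t)) * (1 + \<bar>Re (\<gamma> t)\<bar>) + C / c * exp (c * Re (\<gamma> t))"
      proof eventually_elim
        case (elim t)
        then show ?case by (intro est) auto
      qed
      have "((\<lambda>x. C * exp (c * x) * (1 + \<bar>x\<bar>) + C / c * exp (c * x)) \<longlongrightarrow> 0) at_bot"
        using c by real_asymp
      then show "((\<lambda>t. C * exp (c * Re (\<gamma> t)) * (1 + \<bar>Re (\<gamma> t)\<bar>) + C / c * exp (c * Re (\<gamma> t))) \<longlongrightarrow> 0) A"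
        using re by (rule filterlim_compose)
    qed
    then show "((\<lambda>t. F (\<gamma> t)) \<longlongrightarrow> L) A" by (simp add: LIM_zero_iff)
  qed
qed

text \<open>Only the limits of the primitive at both ends enter, and no absolute convergence: the
  gauge integral over the whole line exists as soon as the integrals over large intervals
  converge.\<close>

lemma has_integral_line_primitive:
  fixes \<gamma> :: "real \<Rightarrow> complex"
  assumes pc: "\<And>a b. \<gamma> piecewise_C1_differentiable_on {a..b}"
    and dF: "\<And>t. (F has_field_derivative f (\<gamma> t)) (at (\<gamma> t))"
    and L: "((\<lambda>t. F (\<gamma> t)) \<longlongrightarrow> L1) at_bot" "((\<lambda>t. F (\<gamma> t)) \<longlongrightarrow> L2) at_top"
  shows "((\<lambda>t. f (\<gamma> t) * vector_derivative \<gamma> (at t)) has_integral (L2 - L1)) UNIV"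
proof -
  let ?g = "\<lambda>t. f (\<gamma> t) * vector_derivative \<gamma> (at t)"
  have seg: "(?g has_integral (F (\<gamma> b) - F (\<gamma> a))) {a..b}" if "a \<le> b" for a b
  proof -
    obtain S where S: "finite S" "\<gamma> C1_differentiable_on ({a..b} - S)" and cont: "continuous_on {a..b} \<gamma>"
      using pc[of a b] unfolding piecewise_C1_differentiable_on_def by blast
    show ?thesis
    proof (rule fundamental_theorem_of_calculus_interior_strong[OF S(1) that, of "\<lambda>t. F (\<gamma> t)"])
      fix t assume "t \<in> {a<..<b} - S"
      then have "\<gamma> differentiable at t"
        using S(2) unfolding C1_differentiable_on_eq by auto
      then have "(\<gamma> has_vector_derivative vector_derivative \<gamma> (at t)) (at t)"
        using vector_derivative_works by blast
      from field_vector_diff_chain_at[OF this dF]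
      show "((\<lambda>t. F (\<gamma> t)) has_vector_derivative ?g t) (at t)"
        by (simp add: o_def mult.commute)
    next
      show "continuous_on {a..b} (\<lambda>t. F (\<gamma> t))"
        by (intro continuous_on_compose2[OF _ cont, of "range \<gamma>"] continuous_at_imp_continuous_on ballI)
           (use dF DERIV_isCont in auto)
    qed
  qed
  have nb: "\<not> (\<exists>a b. UNIV = cbox a (b::real))"
    using not_interval_UNIV by metis
  show ?thesis
  proof (subst has_integral_alt, subst if_not_P[OF nb], intro allI impI)
    fix e :: real assume e: "e > 0"
    have "\<forall>\<^sub>F t in at_bot. dist (F (\<gamma> t)) L1 < e / 2" using tendstoD[OF L(1), of "e / 2"] e by simp
    then obtain A where A: "\<And>t. t \<le> A \<Longrightarrow> dist (F (\<gamma> t)) L1 < e / 2"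
      by (auto simp: eventually_at_bot_linorder)
    have "\<forall>\<^sub>F t in at_top. dist (F (\<gamma> t)) L2 < e / 2" using tendstoD[OF L(2), of "e / 2"] e by simp
    then obtain B where B: "\<And>t. t \<ge> B \<Longrightarrow> dist (F (\<gamma> t)) L2 < e / 2"
      by (auto simp: eventually_at_top_linorder)
    define R where "R = \<bar>A\<bar> + \<bar>B\<bar> + 1"
    show "\<exists>R>0. \<forall>a b. ball 0 R \<subseteq> cbox a b \<longrightarrow>
      (\<exists>z. ((\<lambda>x. if x \<in> UNIV then ?g x else 0) has_integral z) (cbox a b) \<and> norm (z - (L2 - L1)) < e)"
    proof (intro exI[of _ R] conjI allI impI)
      show "R > 0" by (simp add: R_def)
      fix a b :: real assume sub: "ball 0 R \<subseteq> cbox a b"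
      have "A \<in> ball 0 R" "B \<in> ball 0 R" by (auto simp: R_def)
      then have AB: "a \<le> A" "B \<le> b" "a \<le> b" using sub by (auto simp: cbox_interval)
      show "\<exists>z. ((\<lambda>x. if x \<in> UNIV then ?g x else 0) has_integral z) (cbox a b) \<and> norm (z - (L2 - L1)) < e"
      proof (intro exI conjI)
        show "((\<lambda>x. if x \<in> UNIV then ?g x else 0) has_integral (F (\<gamma> b) - F (\<gamma> a))) (cbox a b)"
          using seg[OF AB(3)] by (simp add: cbox_interval)
        have "norm (F (\<gamma> b) - F (\<gamma> a) - (L2 - L1)) = norm ((F (\<gamma> b) - L2) - (F (\<gamma> a) - L1))"
          by (simp add: algebra_simps)
        also have "\<dots> \<le> norm (F (\<gamma> b) - L2) + norm (F (\<gamma> a) - L1)" by (rule norm_triangle_ineq4)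
        also have "\<dots> < e" using A[OF AB(1)] B[OF AB(2)] by (simp add: dist_norm)
        finally show "norm (F (\<gamma> b) - F (\<gamma> a) - (L2 - L1)) < e" .
      qed
    qed
  qed
qed

text \<open>On a starlike domain the integrand has a global primitive. The integral is the
  difference of its limits at the upper and the lower left end, and these are the same for all
  paths.\<close>

lemma hankel_path_integral_unique:
  assumes D: "open D" "starlike D" and sub: "\<And>z. Re z \<le> -1 \<Longrightarrow> Im z \<noteq> 0 \<Longrightarrow> z \<in> D"
    and f: "f holomorphic_on D" and c: "c > 0"
    and bnd: "\<And>z. Re z \<le> -1 \<Longrightarrow> Im z \<noteq> 0 \<Longrightarrow> \<bar>Im z\<bar> \<le> 1 + \<bar>Re z\<bar> \<Longrightarrow> norm (f z) \<le> C * exp (c * Re z)"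
  obtains I where "\<And>\<gamma>. hankel_path D \<gamma> \<Longrightarrow>
     ((\<lambda>t. f (\<gamma> t) * vector_derivative \<gamma> (at t)) has_integral I) UNIV"
proof -
  obtain F where F: "\<And>z. z \<in> D \<Longrightarrow> (F has_field_derivative f z) (at z)"
    using holomorphic_starlike_primitive[OF holomorphic_on_imp_continuous_on[OF f] D(2,1) finite.emptyI]
      holomorphic_on_imp_differentiable_at[OF f D(1)] by auto
  obtain L1 where L1: "\<And>(\<gamma> :: real \<Rightarrow> complex) A. filterlim (\<lambda>t. Re (\<gamma> t)) at_bot A \<Longrightarrow>
      \<forall>\<^sub>F t in A. 0 < -1 * Im (\<gamma> t) \<and> -1 * Im (\<gamma> t) \<le> 1 + \<bar>Re (\<gamma> t)\<bar> \<Longrightarrow> ((\<lambda>t. F (\<gamma> t)) \<longlongrightarrow> L1) A"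
    by (rule primitive_tendsto_at_left_infinity[of "-1" c F f C])
       (use c sub F bnd in \<open>auto simp del: minus_mult_left simp: abs_if\<close>)
  obtain L2 where L2: "\<And>(\<gamma> :: real \<Rightarrow> complex) A. filterlim (\<lambda>t. Re (\<gamma> t)) at_bot A \<Longrightarrow>
      \<forall>\<^sub>F t in A. 0 < 1 * Im (\<gamma> t) \<and> 1 * Im (\<gamma> t) \<le> 1 + \<bar>Re (\<gamma> t)\<bar> \<Longrightarrow> ((\<lambda>t. F (\<gamma> t)) \<longlongrightarrow> L2) A"
    by (rule primitive_tendsto_at_left_infinity[of 1 c F f C])
       (use c sub F bnd in \<open>auto simp: abs_if\<close>)
  show thesis
  proof (rule that)
    fix \<gamma> assume \<gamma>: "hankel_path D \<gamma>"
    show "((\<lambda>t. f (\<gamma> t) * vector_derivative \<gamma> (at t)) has_integral (L2 - L1)) UNIV"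
    proof (rule has_integral_line_primitive)
      show "(F has_field_derivative f (\<gamma> t)) (at (\<gamma> t))" for t
        using \<gamma> by (intro F) (auto simp: hankel_path_def)
      show "((\<lambda>t. F (\<gamma> t)) \<longlongrightarrow> L1) at_bot"
        using \<gamma> by (intro L1) (auto simp: hankel_path_def)
      show "((\<lambda>t. F (\<gamma> t)) \<longlongrightarrow> L2) at_top"
        using \<gamma> by (intro L2) (auto simp: hankel_path_def)
    qed (use \<gamma> in \<open>auto simp: hankel_path_def\<close>)
  qed
qed

text \<open>
  Squaring maps the vertical line \<open>Re w = a\<close> to a Hankel path on which \<open>e\<^sup>z\<close> has Gaussian decay.
\<close>

definition parabola :: "real \<Rightarrow> real \<Rightarrow> complex" where
  "parabola a t = (of_real a + \<i> * of_real t)\<^sup>2"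

definition parabola' :: "real \<Rightarrow> real \<Rightarrow> complex" where
  "parabola' a t = 2 * \<i> * (of_real a + \<i> * of_real t)"

lemma Re_parabola [simp]: "Re (parabola a t) = a\<^sup>2 - t\<^sup>2"
  and Im_parabola [simp]: "Im (parabola a t) = 2 * a * t"
  by (simp_all add: parabola_def power2_eq_square)

lemma norm_of_real_plus_i: "norm (of_real a + \<i> * of_real t :: complex) = sqrt (a\<^sup>2 + t\<^sup>2)"
  by (simp add: cmod_def)

lemma norm_parabola [simp]: "norm (parabola a t) = a\<^sup>2 + t\<^sup>2"
  by (simp add: parabola_def norm_power norm_of_real_plus_i)

lemma norm_parabola' [simp]: "norm (parabola' a t) = 2 * sqrt (a\<^sup>2 + t\<^sup>2)"
  by (simp add: parabola'_def norm_mult norm_of_real_plus_i)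

lemma has_vector_derivative_parabola:
  "(parabola a has_vector_derivative parabola' a t) (at t)"
proof -
  have "((\<lambda>z. (of_real a + \<i> * z)\<^sup>2) has_field_derivative parabola' a t) (at (of_real t))"
    by (auto intro!: derivative_eq_intros simp: parabola'_def)
  from has_vector_derivative_real_field[OF this] show ?thesis
    by (simp add: parabola_def[abs_def])
qed

lemma vector_derivative_parabola [simp]: "vector_derivative (parabola a) (at t) = parabola' a t"
  using has_vector_derivative_parabola by (rule vector_derivative_at)

lemma continuous_on_parabola [continuous_intros]: "continuous_on S (parabola a)"
  unfolding parabola_def[abs_def] by (intro continuous_intros)

lemma continuous_on_parabola' [continuous_intros]: "continuous_on S (parabola' a)"
  unfolding parabola'_def[abs_def] by (intro continuous_intros)

lemma hankel_path_parabola: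
  assumes a: "a > 0" and D: "range (parabola a) \<subseteq> D"
  shows "hankel_path D (parabola a)"
  unfolding hankel_path_def
proof (intro conjI allI)
  show "parabola a piecewise_C1_differentiable_on {b..c}" for b c
    by (intro C1_differentiable_imp_piecewise)
       (auto simp: C1_differentiable_on_def intro!: exI[of _ "parabola' a"] has_vector_derivative_parabola continuous_intros)
  show "filterlim (\<lambda>t. Re (parabola a t)) at_bot at_bot" "filterlim (\<lambda>t. Re (parabola a t)) at_bot at_top"
    unfolding Re_parabola by real_asymp+
  have "\<forall>\<^sub>F t in at_bot. t < 0 \<and> - (2 * a * t) \<le> 1 + (t\<^sup>2 - a\<^sup>2)" by (intro eventually_conj; real_asymp)
  then show "\<forall>\<^sub>F t in at_bot. 0 < - Im (parabola a t) \<and> - Im (parabola a t) \<le> 1 + \<bar>Re (parabola a t)\<bar>"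
    by eventually_elim (use a in \<open>auto simp: mult_less_0_iff\<close>)
  have "\<forall>\<^sub>F t in at_top. t > 0 \<and> 2 * a * t \<le> 1 + (t\<^sup>2 - a\<^sup>2)" by (intro eventually_conj; real_asymp)
  then show "\<forall>\<^sub>F t in at_top. 0 < Im (parabola a t) \<and> Im (parabola a t) \<le> 1 + \<bar>Re (parabola a t)\<bar>"
    by eventually_elim (use a in auto)
qed (rule D)

section \<open>Dominated integrals and differentiation under the integral sign\<close>

lemma integrable_inverse_1_plus_square': "integrable lborel (\<lambda>t::real. C / (1 + t\<^sup>2))"
proof -
  have "integrable lborel (\<lambda>t::real. inverse (1 + t\<^sup>2))"
    using integrable_inverse_1_plus_square by (simp add: set_integrable_def)
  then have "integrable lborel (\<lambda>t::real. C * inverse (1 + t\<^sup>2))" by (rule integrable_mult_right)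
  then show ?thesis by (simp add: field_simps)
qed

lemma integrable_if_le_inverse_square:
  fixes f :: "real \<Rightarrow> 'b::{banach, second_countable_topology}"
  assumes "f \<in> borel_measurable lborel" "\<And>t. norm (f t) \<le> C / (1 + t\<^sup>2)"
  shows "integrable lborel f"
proof (rule Bochner_Integration.integrable_bound[OF integrable_inverse_1_plus_square'[of C] assms(1)])
  show "AE t in lborel. norm (f t) \<le> norm (C / (1 + t\<^sup>2))"
    unfolding real_norm_def by (intro AE_I2 order_trans[OF assms(2) abs_ge_self])
qed

lemma integral_tendsto_if_le_inverse_square:
  fixes f :: "nat \<Rightarrow> real \<Rightarrow> complex"
  assumes "\<And>n. f n \<in> borel_measurable lborel" "g \<in> borel_measurable lborel"
    and "\<And>t. (\<lambda>n. f n t) \<longlonglongrightarrow> g t" "\<And>n t. norm (f n t) \<le> C / (1 + t\<^sup>2)"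
  shows "(\<lambda>n. LINT t|lborel. f n t) \<longlonglongrightarrow> (LINT t|lborel. g t)"
  by (rule integral_dominated_convergence[OF assms(2,1) integrable_inverse_1_plus_square'[of C]])
     (use assms(3,4) in auto)

text \<open>In the variable \<open>u = t\<^sup>2\<close> the product with \<open>1 + u\<close> is
  continuous and tends to 0, hence is bounded. \<open>C / (1 + t\<^sup>2)\<close> is the standard
  majorant for the integrals along parabolas.\<close>

lemma power_mult_exp_le:
  fixes a x r :: real
  assumes a: "a > 0" and x: "x > 0"
  obtains C where "C \<ge> 0" "\<And>t. (a\<^sup>2 + t\<^sup>2) powr r * exp (x * (a\<^sup>2 - t\<^sup>2)) \<le> C / (1 + t\<^sup>2)"
proof -
  define f where "f u = (a\<^sup>2 + u) powr r * exp (x * (a\<^sup>2 - u)) * (1 + u)" for u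
  have "(f \<longlongrightarrow> 0) at_top" unfolding f_def using x by real_asymp
  then have "\<forall>\<^sub>F u in at_top. f u < 1" by (rule order_tendstoD) simp
  then obtain U where U: "\<And>u. u \<ge> U \<Longrightarrow> f u < 1" by (auto simp: eventually_at_top_linorder)
  have "continuous_on {0..\<bar>U\<bar>} f"
    unfolding f_def using a by (intro continuous_intros) (auto simp: add_pos_nonneg intro!: less_imp_neq[symmetric] add_pos_nonneg)
  then have "bounded (f ` {0..\<bar>U\<bar>})" by (intro compact_imp_bounded compact_continuous_image) auto
  then obtain B where "B > 0" "\<And>u. u \<in> {0..\<bar>U\<bar>} \<Longrightarrow> norm (f u) \<le> B"
    unfolding bounded_pos by blast
  then have B: "B > 0" "\<And>u. u \<in> {0..\<bar>U\<bar>} \<Longrightarrow> f u \<le> B"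
    by (auto intro: order_trans[OF abs_ge_self])
  show thesis
  proof
    show "B + 1 \<ge> 0" using B by simp
    fix t :: real
    have "f (t\<^sup>2) \<le> B + 1"
    proof (cases "t\<^sup>2 \<le> \<bar>U\<bar>")
      case True
      then show ?thesis using B(2)[of "t\<^sup>2"] by auto
    next
      case False
      then have "f (t\<^sup>2) < 1" using U[of "t\<^sup>2"] abs_ge_self[of U] by linarith
      then show ?thesis using B(1) by linarith
    qed
    then show "(a\<^sup>2 + t\<^sup>2) powr r * exp (x * (a\<^sup>2 - t\<^sup>2)) \<le> (B + 1) / (1 + t\<^sup>2)"
      by (simp add: f_def pos_le_divide_eq add_pos_nonneg)
  qed
qed

lemma norm_powr_le:
  fixes z w :: complex
  assumes "z \<noteq> 0"
  shows "norm (z powr w) \<le> norm z powr Re w * exp (pi * \<bar>Im w\<bar>)"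
proof -
  have "norm (z powr w) = exp (Re w * ln (norm z) - Im w * Im (Ln z))"
    using assms by (simp add: powr_def)
  also have "- (Im w * Im (Ln z)) \<le> \<bar>Im w\<bar> * \<bar>Im (Ln z)\<bar>"
    by (metis abs_ge_minus_self abs_mult)
  then have "exp (Re w * ln (norm z) - Im w * Im (Ln z)) \<le> exp (Re w * ln (norm z) + \<bar>Im w\<bar> * \<bar>Im (Ln z)\<bar>)"
    by simp
  also have "\<bar>Im w\<bar> * \<bar>Im (Ln z)\<bar> \<le> \<bar>Im w\<bar> * pi"
    using mpi_less_Im_Ln[OF assms] Im_Ln_le_pi[OF assms] by (intro mult_left_mono) auto
  then have "exp (Re w * ln (norm z) + \<bar>Im w\<bar> * \<bar>Im (Ln z)\<bar>) \<le> exp (Re w * ln (norm z) + \<bar>Im w\<bar> * pi)"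
    by simp
  also have "\<dots> = norm z powr Re w * exp (pi * \<bar>Im w\<bar>)"
    using assms by (simp add: powr_def exp_add mult_ac)
  finally show ?thesis .
qed

lemma norm_exp_minus_one_le:
  fixes z :: complex
  shows "norm (exp z - 1) \<le> norm z * exp (norm z)"
proof -
  have "norm (exp z - exp 0) \<le> exp (norm z) * norm (z - 0)"
  proof (rule field_differentiable_bound[of "cball 0 (norm z)" _ exp])
    show "norm (exp w) \<le> exp (norm z)" if "w \<in> cball 0 (norm z)" for w :: complex
      using that complex_Re_le_cmod[of w] by simp
  qed (auto intro!: derivative_eq_intros)
  then show ?thesis by (simp add: mult.commute)
qed

text \<open>Dominated convergence for the difference quotient; \<open>norm_exp_minus_one_le\<close>
  is the source of the term \<open>\<delta> * norm (p t)\<close> in \<open>dom\<close>. It serves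
  twice, for the contour integrals as functions of \<open>x\<close> and for the Laplace integrals as
  functions of \<open>w\<close>.\<close>

lemma exp_integral_has_field_derivative:
  fixes p g :: "'a \<Rightarrow> complex" and w0 :: complex
  assumes [measurable]: "p \<in> borel_measurable M" "g \<in> borel_measurable M" and \<delta>: "\<delta> > 0"
    and int: "\<And>w. w \<in> ball w0 \<delta> \<Longrightarrow> integrable M (\<lambda>t. exp (w * p t) * g t)"
    and dom: "integrable M (\<lambda>t. norm (p t) * norm (g t) * exp (Re (w0 * p t) + \<delta> * norm (p t)))"
  shows "((\<lambda>w. LINT t|M. exp (w * p t) * g t) has_field_derivative (LINT t|M. p t * (exp (w0 * p t) * g t))) (at w0)"
proof -
  define V where "V w = (LINT t|M. exp (w * p t) * g t)" for w
  have "((\<lambda>w. (V w - V w0) / (w - w0)) \<longlongrightarrow> (LINT t|M. p t * (exp (w0 * p t) * g t))) (at w0 within ball w0 \<delta>)"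
    unfolding tendsto_at_iff_sequentially
  proof (intro allI impI)
    fix X assume X: "\<forall>i. X i \<in> ball w0 \<delta> - {w0}" and Xl: "X \<longlonglongrightarrow> w0"
    define h where "h i = X i - w0" for i
    have h: "h i \<noteq> 0" "norm (h i) < \<delta>" for i using X by (auto simp: h_def dist_norm norm_minus_commute)
    have hl: "h \<longlonglongrightarrow> 0" unfolding h_def using Xl by (simp add: LIM_zero)
    have "(\<lambda>i. LINT t|M. (exp (h i * p t) - 1) / h i * (exp (w0 * p t) * g t))
        \<longlonglongrightarrow> (LINT t|M. p t * (exp (w0 * p t) * g t))"
    proof (rule integral_dominated_convergence[OF _ _ dom])
      show "AE t in M. (\<lambda>i. (exp (h i * p t) - 1) / h i * (exp (w0 * p t) * g t)) \<longlonglongrightarrow> p t * (exp (w0 * p t) * g t)"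
      proof (intro AE_I2 tendsto_mult tendsto_const)
        fix t
        have "((\<lambda>z. exp (z * p t)) has_field_derivative p t) (at 0)"
          by (auto intro!: derivative_eq_intros)
        then have "((\<lambda>z. (exp (z * p t) - 1) / z) \<longlongrightarrow> p t) (at 0)" by (simp add: has_field_derivative_iff)
        moreover have "filterlim h (at 0) sequentially"
          using hl h by (auto simp: filterlim_at intro: always_eventually)
        ultimately show "(\<lambda>i. (exp (h i * p t) - 1) / h i) \<longlonglongrightarrow> p t"
          by (rule filterlim_compose)
      qed
      show "AE t in M. norm ((exp (h i * p t) - 1) / h i * (exp (w0 * p t) * g t))
          \<le> norm (p t) * norm (g t) * exp (Re (w0 * p t) + \<delta> * norm (p t))" for i
      proof (rule AE_I2)
        fix t
        have "norm ((exp (h i * p t) - 1) / h i) \<le> norm (h i * p t) * exp (norm (h i * p t)) / norm (h i)"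
          unfolding norm_divide by (intro divide_right_mono norm_exp_minus_one_le) auto
        also have "\<dots> = norm (p t) * exp (norm (h i) * norm (p t))"
          using h(1)[of i] by (simp add: norm_mult)
        also have "\<dots> \<le> norm (p t) * exp (\<delta> * norm (p t))"
          using h(2)[of i] by (intro mult_left_mono iffD2[OF exp_le_cancel_iff] mult_right_mono) auto
        finally have "norm ((exp (h i * p t) - 1) / h i) * (exp (Re (w0 * p t)) * norm (g t))
            \<le> norm (p t) * exp (\<delta> * norm (p t)) * (exp (Re (w0 * p t)) * norm (g t))"
          by (intro mult_right_mono) auto
        then show "norm ((exp (h i * p t) - 1) / h i * (exp (w0 * p t) * g t))
          \<le> norm (p t) * norm (g t) * exp (Re (w0 * p t) + \<delta> * norm (p t))"
          unfolding norm_mult[of "_ / _"] norm_mult[of "exp _"] by (simp add: exp_add mult_ac)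
      qed
    qed measurable
    moreover have "(V (X i) - V w0) / (X i - w0) = (LINT t|M. (exp (h i * p t) - 1) / h i * (exp (w0 * p t) * g t))" for i
    proof -
      have "V (X i) - V w0 = (LINT t|M. exp (X i * p t) * g t - exp (w0 * p t) * g t)"
        unfolding V_def using X \<delta> by (intro Bochner_Integration.integral_diff[symmetric] int) auto
      then have "(V (X i) - V w0) / h i = (LINT t|M. (exp (X i * p t) * g t - exp (w0 * p t) * g t) / h i)"
        by (simp only: integral_divide_zero)
      also have "\<dots> = (LINT t|M. (exp (h i * p t) - 1) / h i * (exp (w0 * p t) * g t))"
      proof (intro Bochner_Integration.integral_cong refl)
        fix t
        have "exp (X i * p t) = exp (h i * p t) * exp (w0 * p t)"
          by (simp add: h_def exp_add[symmetric] algebra_simps)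
        then show "(exp (X i * p t) * g t - exp (w0 * p t) * g t) / h i =
            (exp (h i * p t) - 1) / h i * (exp (w0 * p t) * g t)"
          by (simp add: algebra_simps diff_divide_distrib)
      qed
      finally show ?thesis by (simp only: h_def)
    qed
    ultimately show "((\<lambda>w. (V w - V w0) / (w - w0)) \<circ> X) \<longlonglongrightarrow> (LINT t|M. p t * (exp (w0 * p t) * g t))"
      by (simp add: o_def)
  qed
  moreover have "at w0 within ball w0 \<delta> = at w0" using \<delta> by (intro at_within_open) auto
  ultimately have "((\<lambda>w. (V w - V w0) / (w - w0)) \<longlongrightarrow> (LINT t|M. p t * (exp (w0 * p t) * g t))) (at w0)"
    by (simp only:)
  then show ?thesis unfolding has_field_derivative_iff V_def .
qed

section \<open>Kernels with a branch point at 1: recurrence in the exponent, derivative in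
  \<open>x\<close>\<close>

lemma parabola_nonzero:
  assumes "a > 0"
  shows "parabola a t \<noteq> 0"
proof
  assume "parabola a t = 0"
  then have "norm (parabola a t) = 0" by (simp only: norm_zero)
  then show False using assms by (simp add: sum_power2_eq_zero_iff)
qed

text \<open>
  Instances are \<open>A z = (z - 1)\<^sup>-\<^sup>\<alpha>\<close> for \<open>H\<close>, \<open>A z = (1 - z)\<^sup>-\<^sup>\<alpha>\<close> for \<open>I\<close>, and
  \<open>A z = 1\<close> for Hankel's integral of \<open>1 / \<Gamma>\<close>.
\<close>

locale hankel_kernel =
  fixes A :: "complex \<Rightarrow> complex" and D :: "complex set" and \<alpha> :: complex
  assumes open_D: "open D" and starlike_D: "starlike D"
    and slit: "D \<inter> \<real>\<^sub>\<le>\<^sub>0 = {}"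
    and left: "\<And>z. Re z \<le> -1 \<Longrightarrow> Im z \<noteq> 0 \<Longrightarrow> z \<in> D"
    and A_deriv: "\<And>z. z \<in> D \<Longrightarrow> \<exists>A'. (A has_field_derivative A') (at z) \<and> (z - 1) * A' = - \<alpha> * A z"
    and A_left: "\<exists>K. \<forall>z. Re z \<le> -1 \<longrightarrow> norm (A z) \<le> K"
begin

text \<open>With \<open>x = \<rho> / \<eta>\<close> and \<open>s = n + 1 - m + m / \<eta>\<close>
  this is the integrand of \<open>H\<close> or \<open>I\<close> at index \<open>n\<close>. The
  integral and the fractional power of \<open>z\<close> are merged into one exponent, so that
  neighbouring indices are neighbouring \<open>s\<close>.\<close>

definition kern :: "real \<Rightarrow> complex \<Rightarrow> complex \<Rightarrow> complex" where
  "kern x s z = A z * exp (of_real x * z) * z powr (- s)"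

text \<open>The last clause keeps the parabola away from the singularity of \<open>A\<close>; the
  point \<open>a\<^sup>2\<close> where it crosses the real axis decides on which side of 1 it
  passes.\<close>

definition admissible :: "real \<Rightarrow> bool" where
  "admissible a \<longleftrightarrow> a > 0 \<and> range (parabola a) \<subseteq> D \<and> (\<exists>K. \<forall>t. norm (A (parabola a t)) \<le> K)"

abbreviation pkern :: "real \<Rightarrow> real \<Rightarrow> complex \<Rightarrow> real \<Rightarrow> complex" where
  "pkern a x s t \<equiv> kern x s (parabola a t) * parabola' a t"

definition V :: "real \<Rightarrow> real \<Rightarrow> complex \<Rightarrow> complex" where
  "V a x s = (LINT t|lborel. pkern a x s t)"

lemma D_nonzero: "z \<in> D \<Longrightarrow> z \<noteq> 0"
  using slit by auto

lemma A_holomorphic: "A holomorphic_on D"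
  unfolding holomorphic_on_def
  using A_deriv field_differentiable_at_within field_differentiable_def by blast

lemma kern_holomorphic: "kern x s holomorphic_on D"
  unfolding kern_def[abs_def] using A_holomorphic slit
  by (intro holomorphic_intros) auto

lemma continuous_kern_parabola:
  assumes "admissible a"
  shows "continuous_on UNIV (\<lambda>t. pkern a x s t)"
  by (intro continuous_intros continuous_on_compose2[OF holomorphic_on_imp_continuous_on[OF kern_holomorphic]])
     (use assms in \<open>auto simp: admissible_def\<close>)

lemma measurable_kern_parabola:
  assumes "admissible a"
  shows "(\<lambda>t. pkern a x s t) \<in> borel_measurable borel"
  using continuous_kern_parabola[OF assms] by (intro borel_measurable_continuous_onI)

text \<open>The summand \<open>1/2\<close> in the exponent comes from the speed of the parabola.
  \<open>K\<close> is chosen before \<open>x\<close>, so the bound remains usable at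
  \<open>x = 0\<close> and in the limit \<open>x -> 0\<close>.\<close>

lemma norm_kern_parabola_le:
  assumes "admissible a"
  obtains K where "K \<ge> 0" "\<And>x t. norm (pkern a x s t)
     \<le> K * ((a\<^sup>2 + t\<^sup>2) powr (1/2 - Re s) * exp (x * (a\<^sup>2 - t\<^sup>2)))"
proof -
  obtain K where K: "\<And>t. norm (A (parabola a t)) \<le> K" and a: "a > 0"
    using assms unfolding admissible_def by blast
  have K0: "K \<ge> 0" using K[of 0] norm_ge_zero by (rule order_trans[rotated])
  show thesis
  proof
    show "2 * K * exp (pi * \<bar>Im s\<bar>) \<ge> 0" using K0 by simp
    fix x t
    define u where "u = a\<^sup>2 + t\<^sup>2"
    have u: "u > 0" using a by (simp add: u_def add_pos_nonneg)
    have nz: "parabola a t \<noteq> 0" using a by (rule parabola_nonzero)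
    have "norm (parabola a t powr (- s)) \<le> u powr (- Re s) * exp (pi * \<bar>Im s\<bar>)"
      using norm_powr_le[OF nz, of "- s"] by (simp add: u_def)
    then have "norm (pkern a x s t)
        \<le> (K * exp (x * (a\<^sup>2 - t\<^sup>2)) * (u powr (- Re s) * exp (pi * \<bar>Im s\<bar>))) * (2 * sqrt u)"
      unfolding kern_def norm_mult using K[of t] K0
      by (intro mult_mono) (auto simp: u_def)
    also have "\<dots> = 2 * K * exp (pi * \<bar>Im s\<bar>) * ((u powr (- Re s) * u powr (1/2)) * exp (x * (a\<^sup>2 - t\<^sup>2)))"
      using u by (simp add: powr_half_sqrt mult_ac)
    also have "u powr (- Re s) * u powr (1/2) = u powr (1/2 - Re s)"
      by (simp add: powr_add[symmetric])
    finally show "norm (pkern a x s t)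
      \<le> 2 * K * exp (pi * \<bar>Im s\<bar>) * ((a\<^sup>2 + t\<^sup>2) powr (1/2 - Re s) * exp (x * (a\<^sup>2 - t\<^sup>2)))"
      by (simp add: u_def)
  qed
qed

lemma integrable_kern_parabola:
  assumes "admissible a" "x > 0"
  shows "integrable lborel (\<lambda>t. pkern a x s t)"
proof -
  obtain K where K: "K \<ge> 0" "\<And>x t. norm (pkern a x s t)
     \<le> K * ((a\<^sup>2 + t\<^sup>2) powr (1/2 - Re s) * exp (x * (a\<^sup>2 - t\<^sup>2)))"
    using norm_kern_parabola_le[OF assms(1)] by blast
  have "a > 0" using assms by (simp add: admissible_def)
  then obtain C where C: "C \<ge> 0" "\<And>t. (a\<^sup>2 + t\<^sup>2) powr (1/2 - Re s) * exp (x * (a\<^sup>2 - t\<^sup>2)) \<le> C / (1 + t\<^sup>2)"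
    using power_mult_exp_le[OF _ assms(2)] by blast
  show ?thesis
  proof (rule integrable_if_le_inverse_square[where C = "K * C"])
    fix t
    have "norm (pkern a x s t) \<le> K * (C / (1 + t\<^sup>2))"
      by (rule order_trans[OF K(2)]) (intro mult_left_mono C K)
    then show "norm (pkern a x s t) \<le> K * C / (1 + t\<^sup>2)" by simp
  qed (use measurable_kern_parabola[OF assms(1)] in simp)
qed

lemma has_integral_V:
  assumes "admissible a" "x > 0"
  shows "((\<lambda>t. pkern a x s t) has_integral V a x s) UNIV"
  unfolding V_def by (intro has_integral_integral_lborel integrable_kern_parabola assms)

text \<open>For \<open>Re s \<ge> -1\<close> the power of \<open>z\<close> is at most of size
  \<open>norm z\<close>, hence linear in \<open>- Re z\<close>; half of the decay
  \<open>exp (x * Re z)\<close> pays for it.\<close>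

lemma norm_kern_left_le:
  assumes x: "x > 0" and s: "Re s \<ge> -1"
  obtains C where "\<And>z. Re z \<le> -1 \<Longrightarrow> \<bar>Im z\<bar> \<le> 1 + \<bar>Re z\<bar> \<Longrightarrow> norm (kern x s z) \<le> C * exp (x / 2 * Re z)"
proof -
  obtain K where K: "\<And>z. Re z \<le> -1 \<Longrightarrow> norm (A z) \<le> K" using A_left by blast
  have K0: "K \<ge> 0" by (rule order_trans[OF norm_ge_zero K[of "-1"]]) simp
  show thesis
  proof (rule that)
    fix z :: complex assume z: "Re z \<le> -1" "\<bar>Im z\<bar> \<le> 1 + \<bar>Re z\<bar>"
    define u where "u = - Re z"
    have u: "u \<ge> 1" using z by (simp add: u_def)
    have nz: "z \<noteq> 0" and n1: "norm z \<ge> 1" using z abs_Re_le_cmod[of z] by auto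
    have "norm z \<le> 1 + 2 * u" using cmod_le[of z] z by (simp add: u_def)
    then have n2: "norm z powr (- Re s) \<le> 1 + 2 * u"
      using n1 powr_mono[of "- Re s" 1 "norm z"] s by simp
    have "1 + 2 * u \<le> (1 + 4 / x) * (1 + x / 2 * u)" using x u by (simp add: field_simps)
    also have "\<dots> \<le> (1 + 4 / x) * exp (x / 2 * u)"
      using x exp_ge_add_one_self[of "x / 2 * u"] by (intro mult_left_mono) auto
    finally have n3: "norm z powr (- Re s) \<le> (1 + 4 / x) * exp (x / 2 * u)" using n2 by simp
    have "norm (kern x s z) \<le> (K * exp (x * Re z)) * (norm z powr (- Re s) * exp (pi * \<bar>Im s\<bar>))"
      unfolding kern_def norm_mult using K[OF z(1)] norm_powr_le[OF nz, of "- s"] K0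
      by (intro mult_mono) auto
    also have "\<dots> \<le> (K * exp (x * Re z)) * (((1 + 4 / x) * exp (x / 2 * u)) * exp (pi * \<bar>Im s\<bar>))"
      using K0 n3 by (intro mult_left_mono mult_right_mono) auto
    also have "\<dots> = K * (1 + 4 / x) * exp (pi * \<bar>Im s\<bar>) * exp (x / 2 * Re z)"
    proof -
      have "exp (x * Re z) * exp (x / 2 * u) = exp (x / 2 * Re z)"
        by (simp add: u_def exp_add[symmetric] field_simps)
      then show ?thesis by (simp add: mult_ac)
    qed
    finally show "norm (kern x s z) \<le> K * (1 + 4 / x) * exp (pi * \<bar>Im s\<bar>) * exp (x / 2 * Re z)" .
  qed
qed

lemma has_integral_hankel_path:
  assumes "hankel_path D \<gamma>" "admissible a" and x: "x > 0" and s: "Re s \<ge> -1"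
  shows "((\<lambda>t. kern x s (\<gamma> t) * vector_derivative \<gamma> (at t)) has_integral V a x s) UNIV"
proof -
  obtain C where C: "\<And>z. Re z \<le> -1 \<Longrightarrow> \<bar>Im z\<bar> \<le> 1 + \<bar>Re z\<bar> \<Longrightarrow> norm (kern x s z) \<le> C * exp (x / 2 * Re z)"
    using norm_kern_left_le[OF x s] by blast
  obtain I where I: "\<And>\<gamma>. hankel_path D \<gamma> \<Longrightarrow>
     ((\<lambda>t. kern x s (\<gamma> t) * vector_derivative \<gamma> (at t)) has_integral I) UNIV"
    by (rule hankel_path_integral_unique[OF open_D starlike_D left kern_holomorphic, of "x / 2" x s C])
       (use C x in auto)
  have "hankel_path D (parabola a)" using assms(2) by (intro hankel_path_parabola) (auto simp: admissible_def)
  from I[OF this] have "((\<lambda>t. pkern a x s t) has_integral I) UNIV" by simp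
  then have "I = V a x s" using has_integral_V[OF assms(2) x] has_integral_unique by blast
  with I[OF assms(1)] show ?thesis by simp
qed

lemma V_unique:
  assumes "admissible a" "admissible b" "x > 0" "Re s \<ge> -1"
  shows "V a x s = V b x s"
proof -
  have "hankel_path D (parabola b)" using assms(2) by (intro hankel_path_parabola) (auto simp: admissible_def)
  from has_integral_hankel_path[OF this assms(1,3,4)] has_integral_V[OF assms(2,3)]
  show ?thesis by (auto dest: has_integral_unique)
qed

lemma kern_shift:
  assumes "z \<noteq> 0"
  shows "z * kern x s z = kern x (s - 1) z"
proof -
  have "z powr (- (s - 1)) = z powr 1 * z powr (- s)"
    unfolding powr_add[symmetric] by simp
  then show ?thesis using assms by (simp add: kern_def)
qed

text \<open>Integration by parts in the form of an explicit primitive: in \<open>P\<close> the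
  factor \<open>z - 1\<close> cancels the pole of \<open>A' / A = - \<alpha> / (z - 1)\<close>, so
  that the derivative of \<open>P\<close> is a combination of the kernels at \<open>s - 1\<close>,
  \<open>s\<close> and \<open>s + 1\<close>. Along the parabola \<open>P\<close> vanishes at both
  ends.\<close>

lemma V_recurrence:
  assumes "admissible a" and x: "x > 0"
  shows "s * V a x (s + 1) + of_real x * V a x (s - 1) = (of_real x + \<alpha> - 1 + s) * V a x s"
proof -
  have a: "a > 0" and rng: "parabola a t \<in> D" for t using assms by (auto simp: admissible_def)
  define P where "P z = (z - 1) * kern x s z" for z
  define Q where "Q z = (1 - \<alpha> - of_real x - s) * kern x s z + of_real x * kern x (s - 1) z + s * kern x (s + 1) z" for z
  have dP: "(P has_field_derivative Q z) (at z)" if z: "z \<in> D" for z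
  proof -
    obtain A' where A': "(A has_field_derivative A') (at z)" "(z - 1) * A' = - \<alpha> * A z"
      using A_deriv[OF z] by blast
    have z0: "z \<notin> \<real>\<^sub>\<le>\<^sub>0" "z \<noteq> 0" using z slit by auto
    define E where "E = exp (of_real x * z)"
    have e1: "- (s + 1) = - s - 1" by simp
    have "(P has_field_derivative
       (A z * E * z powr (- s) + (z - 1) * (A' * E * z powr (- s) + A z * (of_real x * E) * z powr (- s)
          + A z * E * (- s * z powr (- s - 1))))) (at z)"
      unfolding P_def[abs_def] kern_def E_def
      by (rule derivative_eq_intros A'(1) refl | use z0 in \<open>simp; fail\<close>)+ (simp add: algebra_simps)
    also have "(A z * E * z powr (- s) + (z - 1) * (A' * E * z powr (- s) + A z * (of_real x * E) * z powr (- s)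
          + A z * E * (- s * z powr (- s - 1)))) =
        A z * E * z powr (- s) + ((z - 1) * A') * E * z powr (- s)
          + of_real x * (z * kern x s z - kern x s z) - s * (z * kern x (s + 1) z - kern x (s + 1) z)"
      unfolding kern_def E_def[symmetric] e1
      by (simp add: algebra_simps)
    also have "\<dots> = Q z"
      unfolding A'(2) kern_shift[OF z0(2)] Q_def by (simp add: kern_def E_def algebra_simps)
    finally show ?thesis .
  qed
  \<comment> \<open>\<open>F\<close> is any filter along which \<open>t\<^sup>2\<close> grows, so
    that one estimate serves both ends of the parabola.\<close>
  have lim: "((\<lambda>t. P (parabola a t)) \<longlongrightarrow> 0) F" if F: "filterlim (\<lambda>t::real. t\<^sup>2) at_top F" for F
  proof -
    obtain K where K: "K \<ge> 0" "\<And>x t. norm (pkern a x s t)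
       \<le> K * ((a\<^sup>2 + t\<^sup>2) powr (1/2 - Re s) * exp (x * (a\<^sup>2 - t\<^sup>2)))"
      using norm_kern_parabola_le[OF assms(1)] by blast
    obtain C where C: "C \<ge> 0" "\<And>t. (a\<^sup>2 + t\<^sup>2) powr (1 - Re s) * exp (x * (a\<^sup>2 - t\<^sup>2)) \<le> C / (1 + t\<^sup>2)"
      using power_mult_exp_le[OF a x] by blast
    have bound: "norm (P (parabola a t)) \<le> (1 + 1 / a\<^sup>2) * K * C / (1 + t\<^sup>2)" for t
    proof -
      define u where "u = a\<^sup>2 + t\<^sup>2"
      have u: "u > 0" using a by (simp add: u_def add_pos_nonneg)
      define k where "k = norm (kern x s (parabola a t))"
      have "k * (2 * sqrt u) \<le> K * (u powr (1/2 - Re s) * exp (x * (a\<^sup>2 - t\<^sup>2)))"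
        using K(2)[of x t] by (simp add: norm_mult k_def u_def)
      then have "k * (2 * sqrt u) * sqrt u \<le> K * (u powr (1/2 - Re s) * exp (x * (a\<^sup>2 - t\<^sup>2))) * sqrt u"
        using u by (intro mult_right_mono) auto
      also have "\<dots> = K * ((u powr (1/2 - Re s) * u powr (1/2)) * exp (x * (a\<^sup>2 - t\<^sup>2)))"
        using u by (simp add: powr_half_sqrt mult_ac)
      also have "u powr (1/2 - Re s) * u powr (1/2) = u powr (1 - Re s)"
        by (simp add: powr_add[symmetric])
      also have "K * (u powr (1 - Re s) * exp (x * (a\<^sup>2 - t\<^sup>2))) \<le> K * (C / (1 + t\<^sup>2))"
        unfolding u_def by (intro mult_left_mono C K)
      finally have "k * (2 * sqrt u) * sqrt u \<le> K * (C / (1 + t\<^sup>2))" .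
      moreover have "k * (2 * sqrt u) * sqrt u = 2 * ((sqrt u * sqrt u) * k)" by (simp only: mult_ac)
      moreover have "sqrt u * sqrt u = u" using u by simp
      ultimately have ku: "2 * (u * k) \<le> K * C / (1 + t\<^sup>2)" by simp
      have "0 \<le> u * k" using u by (simp add: k_def)
      with ku have ku': "u * k \<le> K * C / (1 + t\<^sup>2)" by linarith
      have "norm (parabola a t - 1) \<le> u + 1"
        using norm_triangle_ineq4[of "parabola a t" 1] by (simp add: u_def)
      also have "\<dots> \<le> (1 + 1 / a\<^sup>2) * u" using a by (simp add: u_def field_simps)
      finally have "norm (P (parabola a t)) \<le> ((1 + 1 / a\<^sup>2) * u) * k"
        unfolding P_def norm_mult k_def by (intro mult_right_mono) auto
      also have "\<dots> \<le> (1 + 1 / a\<^sup>2) * (K * C / (1 + t\<^sup>2))"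
        using ku' a by (simp only: mult.assoc) (intro mult_left_mono, auto)
      finally show ?thesis by simp
    qed
    have "((\<lambda>v::real. (1 + 1 / a\<^sup>2) * K * C / (1 + v)) \<longlongrightarrow> 0) at_top" by real_asymp
    then have "((\<lambda>t. (1 + 1 / a\<^sup>2) * K * C / (1 + t\<^sup>2)) \<longlongrightarrow> 0) F" using F by (rule filterlim_compose)
    moreover have "\<forall>\<^sub>F t in F. norm (P (parabola a t)) \<le> (1 + 1 / a\<^sup>2) * K * C / (1 + t\<^sup>2)"
      by (intro always_eventually allI bound)
    ultimately show ?thesis by (intro Lim_null_comparison[where f = "\<lambda>t. P (parabola a t)"])
  qed
  have "((\<lambda>t. Q (parabola a t) * vector_derivative (parabola a) (at t)) has_integral (0 - 0)) UNIV"
  proof (rule has_integral_line_primitive[of "parabola a" P Q])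
    show "parabola a piecewise_C1_differentiable_on {b..c}" for b c
      using hankel_path_parabola[OF a, of D] rng by (auto simp: hankel_path_def)
    show "(P has_field_derivative Q (parabola a t)) (at (parabola a t))" for t by (intro dP rng)
    show "((\<lambda>t. P (parabola a t)) \<longlongrightarrow> 0) at_bot" by (rule lim) real_asymp
    show "((\<lambda>t. P (parabola a t)) \<longlongrightarrow> 0) at_top" by (rule lim) real_asymp
  qed
  moreover have "((\<lambda>t. Q (parabola a t) * vector_derivative (parabola a) (at t)) has_integral
      ((1 - \<alpha> - of_real x - s) * V a x s + of_real x * V a x (s - 1) + s * V a x (s + 1))) UNIV"
  proof -
    have "((\<lambda>t. (1 - \<alpha> - of_real x - s) * (pkern a x s t)
         + of_real x * (pkern a x (s - 1) t)
         + s * (pkern a x (s + 1) t)) has_integral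
        ((1 - \<alpha> - of_real x - s) * V a x s + of_real x * V a x (s - 1) + s * V a x (s + 1))) UNIV"
      by (intro has_integral_add has_integral_mult_right has_integral_V assms)
    then show ?thesis by (simp add: Q_def algebra_simps)
  qed
  ultimately have "(1 - \<alpha> - of_real x - s) * V a x s + of_real x * V a x (s - 1) + s * V a x (s + 1) = 0 - 0"
    by (rule has_integral_unique[rotated])
  then show ?thesis by (simp add: algebra_simps add_eq_0_iff)
qed

text \<open>Differentiating \<open>exp (x * z)\<close> produces a factor \<open>z\<close>, which
  lowers \<open>s\<close> by one. This is what turns the three-term recurrence in \<open>s\<close>
  into a differential equation in \<open>x\<close>.\<close>

lemma V_has_vector_derivative:
  assumes adm: "admissible a" and x: "x > 0"
  shows "((\<lambda>x. V a x s) has_vector_derivative V a x (s - 1)) (at x)"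
proof -
  have a: "a > 0" and rng: "parabola a t \<in> D" for t using assms by (auto simp: admissible_def)
  define g where "g t = A (parabola a t) * parabola a t powr (- s) * parabola' a t" for t
  have k: "pkern a y s t = exp (of_real y * parabola a t) * g t" for y t
    by (simp add: kern_def g_def mult_ac)
  have contg: "continuous_on UNIV g"
    using continuous_kern_parabola[OF adm, of 0 s] unfolding k by simp
  have mg: "g \<in> borel_measurable lborel"
    using contg by (simp add: borel_measurable_continuous_onI)
  have mp: "parabola a \<in> borel_measurable lborel"
    using continuous_on_parabola[of UNIV a] by (simp add: borel_measurable_continuous_onI)
  obtain K where K: "K \<ge> 0" "\<And>y t. norm (pkern a y s t)
     \<le> K * ((a\<^sup>2 + t\<^sup>2) powr (1/2 - Re s) * exp (y * (a\<^sup>2 - t\<^sup>2)))"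
    using norm_kern_parabola_le[OF adm] by blast
  \<comment> \<open>The uniform bound at \<open>y = 0\<close>, where the exponential factors are 1,
    isolates \<open>g\<close>.\<close>
  have Kg: "norm (g t) \<le> K * (a\<^sup>2 + t\<^sup>2) powr (1/2 - Re s)" for t
    using K(2)[of 0 t] unfolding k by simp
  \<comment> \<open>A quarter of \<open>x\<close>: after perturbing the exponent by
    \<open>\<delta> * (a\<^sup>2 + t\<^sup>2)\<close> at least half of the Gaussian decay remains,
    at the price of the constant \<open>exp (x * a\<^sup>2)\<close>.\<close>
  define \<delta> where "\<delta> = x / 4"
  have \<delta>: "\<delta> > 0" using x by (simp add: \<delta>_def)
  have gauss: "integrable lborel h" if h: "h \<in> borel_measurable lborel"
    "\<And>t. norm (h t) \<le> K * B * ((a\<^sup>2 + t\<^sup>2) powr r * exp (x / 2 * (a\<^sup>2 - t\<^sup>2)))" "B \<ge> 0"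
    for h :: "real \<Rightarrow> 'b::{banach, second_countable_topology}" and r B
  proof -
    obtain C where C: "C \<ge> 0" "\<And>t. (a\<^sup>2 + t\<^sup>2) powr r * exp (x / 2 * (a\<^sup>2 - t\<^sup>2)) \<le> C / (1 + t\<^sup>2)"
      using power_mult_exp_le[OF a, of "x / 2"] x by (metis half_gt_zero)
    show ?thesis
    proof (rule integrable_if_le_inverse_square[OF h(1)])
      fix t
      have "norm (h t) \<le> K * B * (C / (1 + t\<^sup>2))"
        by (rule order_trans[OF h(2)]) (intro mult_left_mono C mult_nonneg_nonneg K h)
      then show "norm (h t) \<le> K * B * C / (1 + t\<^sup>2)" by simp
    qed
  qed
  have expo: "exp (x * (a\<^sup>2 - t\<^sup>2) + \<delta> * (a\<^sup>2 + t\<^sup>2)) \<le> exp (x * a\<^sup>2) * exp (x / 2 * (a\<^sup>2 - t\<^sup>2))" for t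
  proof -
    have "x * (a\<^sup>2 - t\<^sup>2) + \<delta> * (a\<^sup>2 + t\<^sup>2) \<le> x * a\<^sup>2 + x / 2 * (a\<^sup>2 - t\<^sup>2)"
      using x by (simp add: \<delta>_def field_simps)
    then show ?thesis unfolding exp_add[symmetric] by simp
  qed
  have "((\<lambda>w. LINT t|lborel. exp (w * parabola a t) * g t) has_field_derivative
      (LINT t|lborel. parabola a t * (exp (of_real x * parabola a t) * g t))) (at (of_real x))"
  proof (rule exp_integral_has_field_derivative[OF mp mg \<delta>])
    fix w assume w: "w \<in> ball (complex_of_real x) \<delta>"
    show "integrable lborel (\<lambda>t. exp (w * parabola a t) * g t)"
    proof (rule gauss[of _ "exp (x * a\<^sup>2)" "1/2 - Re s"])
      show "(\<lambda>t. exp (w * parabola a t) * g t) \<in> borel_measurable lborel"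
        using mg mp by measurable
      fix t
      have "Re (w * parabola a t) = x * (a\<^sup>2 - t\<^sup>2) + Re ((w - of_real x) * parabola a t)"
        by (simp add: algebra_simps)
      also have "\<dots> \<le> x * (a\<^sup>2 - t\<^sup>2) + norm ((w - of_real x) * parabola a t)"
        by (rule add_left_mono[OF complex_Re_le_cmod])
      also have "\<dots> \<le> x * (a\<^sup>2 - t\<^sup>2) + \<delta> * (a\<^sup>2 + t\<^sup>2)"
        using w unfolding norm_mult norm_parabola
        by (intro add_left_mono mult_right_mono) (auto simp: dist_norm norm_minus_commute)
      finally have "exp (Re (w * parabola a t)) \<le> exp (x * (a\<^sup>2 - t\<^sup>2) + \<delta> * (a\<^sup>2 + t\<^sup>2))"
        by simp
      then have "exp (Re (w * parabola a t)) \<le> exp (x * a\<^sup>2) * exp (x / 2 * (a\<^sup>2 - t\<^sup>2))"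
        using expo[of t] by (rule order_trans)
      then have "norm (exp (w * parabola a t) * g t) \<le>
          (exp (x * a\<^sup>2) * exp (x / 2 * (a\<^sup>2 - t\<^sup>2))) * (K * (a\<^sup>2 + t\<^sup>2) powr (1/2 - Re s))"
        unfolding norm_mult norm_exp_eq_Re using Kg[of t] by (intro mult_mono) auto
      then show "norm (exp (w * parabola a t) * g t) \<le>
          K * exp (x * a\<^sup>2) * ((a\<^sup>2 + t\<^sup>2) powr (1/2 - Re s) * exp (x / 2 * (a\<^sup>2 - t\<^sup>2)))"
        by (simp add: mult_ac)
    qed simp
  next
    show "integrable lborel (\<lambda>t. norm (parabola a t) * norm (g t) *
        exp (Re (of_real x * parabola a t) + \<delta> * norm (parabola a t)))"
    proof (rule gauss[of _ "exp (x * a\<^sup>2)" "1 + (1/2 - Re s)"])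
      show "(\<lambda>t. norm (parabola a t) * norm (g t) *
        exp (Re (of_real x * parabola a t) + \<delta> * norm (parabola a t))) \<in> borel_measurable lborel"
        using mg mp by measurable
      fix t
      have u: "a\<^sup>2 + t\<^sup>2 > 0" using a by (simp add: add_pos_nonneg)
      have "norm (norm (parabola a t) * norm (g t) * exp (Re (of_real x * parabola a t) + \<delta> * norm (parabola a t)))
          = (a\<^sup>2 + t\<^sup>2) * norm (g t) * exp (x * (a\<^sup>2 - t\<^sup>2) + \<delta> * (a\<^sup>2 + t\<^sup>2))"
        using u by simp
      also have "\<dots> \<le> (a\<^sup>2 + t\<^sup>2) * (K * (a\<^sup>2 + t\<^sup>2) powr (1/2 - Re s)) * (exp (x * a\<^sup>2) * exp (x / 2 * (a\<^sup>2 - t\<^sup>2)))"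
        using Kg[of t] expo[of t] u K(1) by (intro mult_mono) auto
      also have "\<dots> = K * exp (x * a\<^sup>2) * ((a\<^sup>2 + t\<^sup>2) powr (1 + (1/2 - Re s)) * exp (x / 2 * (a\<^sup>2 - t\<^sup>2)))"
        using u unfolding powr_add by (simp add: mult_ac)
      finally show "norm (norm (parabola a t) * norm (g t) * exp (Re (of_real x * parabola a t) + \<delta> * norm (parabola a t)))
        \<le> K * exp (x * a\<^sup>2) * ((a\<^sup>2 + t\<^sup>2) powr (1 + (1/2 - Re s)) * exp (x / 2 * (a\<^sup>2 - t\<^sup>2)))" .
    qed simp
  qed
  then have "((\<lambda>y. LINT t|lborel. exp (of_real y * parabola a t) * g t) has_vector_derivative
      (LINT t|lborel. parabola a t * (exp (of_real x * parabola a t) * g t))) (at x)"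
    by (rule has_vector_derivative_real_field)
  moreover have "parabola a t * (exp (of_real x * parabola a t) * g t) = pkern a x (s - 1) t" for t
    unfolding k[symmetric] kern_shift[OF D_nonzero[OF rng], symmetric] by simp
  ultimately show ?thesis unfolding V_def k by simp
qed

end

section \<open>The kernels of \<open>H\<close>, of \<open>I\<close> and of Hankel's integral\<close>

lemma norm_powr_neg_le:
  assumes "Re \<alpha> \<ge> 0" "norm (z :: complex) \<ge> 1"
  shows "norm (z powr (- \<alpha>)) \<le> exp (pi * \<bar>Im \<alpha>\<bar>)"
proof -
  have "norm (z powr (- \<alpha>)) \<le> norm z powr (- Re \<alpha>) * exp (pi * \<bar>Im \<alpha>\<bar>)"
    using norm_powr_le[of z "- \<alpha>"] assms(2) by force
  also have "\<dots> \<le> 1 * exp (pi * \<bar>Im \<alpha>\<bar>)"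
    using powr_mono[of "- Re \<alpha>" 0 "norm z"] assms by (intro mult_right_mono) (auto split: if_splits)
  finally show ?thesis by simp
qed

lemma hankel_kernel_H:
  assumes "Re \<alpha> \<ge> 0"
  shows "hankel_kernel (\<lambda>z. (z - 1) powr (- \<alpha>)) (- C1_cut) \<alpha>"
proof
  show "open (- C1_cut)"
    unfolding C1_cut_def by (intro open_Compl closed_Collect_conj closed_Collect_eq closed_Collect_le continuous_intros)
  have eq: "C1_cut = complex_of_real ` {..1}"
    by (auto simp: C1_cut_def complex_eq_iff image_iff)
  show "starlike (- C1_cut)" unfolding eq by (rule starlike_slotted_complex_plane_left)
  show "- C1_cut \<inter> \<real>\<^sub>\<le>\<^sub>0 = {}" by (auto simp: C1_cut_def complex_nonpos_Reals_iff)
  show "z \<in> - C1_cut" if "Im z \<noteq> 0" for z using that by (auto simp: C1_cut_def)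
  show "\<exists>A'. ((\<lambda>z. (z - 1) powr (- \<alpha>)) has_field_derivative A') (at z) \<and> (z - 1) * A' = - \<alpha> * (z - 1) powr (- \<alpha>)"
    if "z \<in> - C1_cut" for z
  proof (intro exI conjI)
    have z: "z - 1 \<notin> \<real>\<^sub>\<le>\<^sub>0" "z \<noteq> 1" using that by (auto simp: C1_cut_def complex_nonpos_Reals_iff)
    show "((\<lambda>z. (z - 1) powr (- \<alpha>)) has_field_derivative - \<alpha> * (z - 1) powr (- \<alpha> - 1)) (at z)"
      using z by (auto intro!: derivative_eq_intros)
    show "(z - 1) * (- \<alpha> * (z - 1) powr (- \<alpha> - 1)) = - \<alpha> * (z - 1) powr (- \<alpha>)"
      using z by (simp add: powr_diff)
  qed
  show "\<exists>K. \<forall>z. Re z \<le> -1 \<longrightarrow> norm ((z - 1) powr (- \<alpha>)) \<le> K"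
  proof (intro exI allI impI)
    fix z :: complex assume z: "Re z \<le> -1"
    then have "norm (z - 1) \<ge> 1" using abs_Re_le_cmod[of "z - 1"] by simp
    with assms show "norm ((z - 1) powr (- \<alpha>)) \<le> exp (pi * \<bar>Im \<alpha>\<bar>)" by (rule norm_powr_neg_le)
  qed
qed

lemma hankel_kernel_I:
  assumes "Re \<alpha> \<ge> 0"
  shows "hankel_kernel (\<lambda>z. (1 - z) powr (- \<alpha>)) (- C2_cut) \<alpha>"
proof
  show "open (- C2_cut)"
    unfolding C2_cut_def
    by (intro open_Compl closed_Un closed_Collect_conj closed_Collect_eq closed_Collect_le continuous_intros)
  have eq: "C2_cut = complex_of_real ` ({..0} \<union> {1..})"
    by (auto simp: C2_cut_def complex_eq_iff image_iff image_Un)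
  show "starlike (- C2_cut)" unfolding eq by (rule starlike_doubly_slotted_complex_plane) simp
  show "- C2_cut \<inter> \<real>\<^sub>\<le>\<^sub>0 = {}" by (auto simp: C2_cut_def complex_nonpos_Reals_iff)
  show "z \<in> - C2_cut" if "Im z \<noteq> 0" for z using that by (auto simp: C2_cut_def)
  show "\<exists>A'. ((\<lambda>z. (1 - z) powr (- \<alpha>)) has_field_derivative A') (at z) \<and> (z - 1) * A' = - \<alpha> * (1 - z) powr (- \<alpha>)"
    if "z \<in> - C2_cut" for z
  proof (intro exI conjI)
    have z: "1 - z \<notin> \<real>\<^sub>\<le>\<^sub>0" "z \<noteq> 1" using that by (auto simp: C2_cut_def complex_nonpos_Reals_iff)
    show "((\<lambda>z. (1 - z) powr (- \<alpha>)) has_field_derivative \<alpha> * (1 - z) powr (- \<alpha> - 1)) (at z)"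
      using z by (auto intro!: derivative_eq_intros)
    show "(z - 1) * (\<alpha> * (1 - z) powr (- \<alpha> - 1)) = - \<alpha> * (1 - z) powr (- \<alpha>)"
      using z by (simp add: powr_diff field_simps)
  qed
  show "\<exists>K. \<forall>z. Re z \<le> -1 \<longrightarrow> norm ((1 - z) powr (- \<alpha>)) \<le> K"
  proof (intro exI allI impI)
    fix z :: complex assume z: "Re z \<le> -1"
    then have "norm (1 - z) \<ge> 1" using abs_Re_le_cmod[of "1 - z"] by simp
    with assms show "norm ((1 - z) powr (- \<alpha>)) \<le> exp (pi * \<bar>Im \<alpha>\<bar>)" by (rule norm_powr_neg_le)
  qed
qed

lemma bounded_powr_away_from_0:
  fixes z :: "'a \<Rightarrow> complex"
  assumes "Re \<alpha> \<ge> 0" "d > 0" "\<And>t. norm (z t) \<ge> d"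
  shows "\<exists>K. \<forall>t. norm (z t powr (- \<alpha>)) \<le> K"
proof (intro exI allI)
  fix t
  have "norm (z t powr (- \<alpha>)) \<le> norm (z t) powr (- Re \<alpha>) * exp (pi * \<bar>Im \<alpha>\<bar>)"
    using norm_powr_le[of "z t" "- \<alpha>"] assms(2) assms(3)[of t] by force
  also have "\<dots> \<le> d powr (- Re \<alpha>) * exp (pi * \<bar>Im \<alpha>\<bar>)"
    using assms by (intro mult_right_mono powr_mono2') auto
  finally show "norm (z t powr (- \<alpha>)) \<le> d powr (- Re \<alpha>) * exp (pi * \<bar>Im \<alpha>\<bar>)" .
qed

text \<open>The parabola crosses the real axis only at \<open>a\<^sup>2\<close>. It must do so
  beyond 1 to avoid \<open>C1_cut\<close>, and in the gap between 0 and 1 to avoid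
  \<open>C2_cut\<close>; hence \<open>a > 1\<close> here and \<open>a < 1\<close> in
  \<open>admissible_I\<close>.\<close>

lemma admissible_H:
  assumes "Re \<alpha> \<ge> 0" "a > 1"
  shows "hankel_kernel.admissible (\<lambda>z. (z - 1) powr (- \<alpha>)) (- C1_cut) a"
proof -
  interpret hankel_kernel "\<lambda>z. (z - 1) powr (- \<alpha>)" "- C1_cut" \<alpha> by (rule hankel_kernel_H[OF assms(1)])
  have a2: "a\<^sup>2 > 1" using assms(2) one_less_power[of a 2] by simp
  have "norm (parabola a t - 1) \<ge> a\<^sup>2 - 1" for t
    using norm_triangle_ineq2[of "parabola a t" 1] zero_le_power2[of t]
    unfolding norm_parabola norm_one by linarith
  then have "\<exists>K. \<forall>t. norm ((parabola a t - 1) powr (- \<alpha>)) \<le> K"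
    using a2 by (intro bounded_powr_away_from_0[OF assms(1), of "a\<^sup>2 - 1"]) auto
  then show ?thesis
    using assms(2) a2 unfolding admissible_def by (auto simp: C1_cut_def simp del: one_less_power)
qed

lemma admissible_I:
  assumes "Re \<alpha> \<ge> 0" "0 < a" "a < 1"
  shows "hankel_kernel.admissible (\<lambda>z. (1 - z) powr (- \<alpha>)) (- C2_cut) a"
proof -
  interpret hankel_kernel "\<lambda>z. (1 - z) powr (- \<alpha>)" "- C2_cut" \<alpha> by (rule hankel_kernel_I[OF assms(1)])
  have a2: "a\<^sup>2 < 1" using assms by (simp add: abs_square_less_1)
  have "norm (1 - parabola a t) \<ge> 1 - a\<^sup>2" for t
  proof -
    have "1 - a\<^sup>2 \<le> Re (1 - parabola a t)" by simp
    then show ?thesis using complex_Re_le_cmod by (rule order_trans)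
  qed
  then have "\<exists>K. \<forall>t. norm ((1 - parabola a t) powr (- \<alpha>)) \<le> K"
    using a2 by (intro bounded_powr_away_from_0[OF assms(1), of "1 - a\<^sup>2"]) auto
  then show ?thesis
    using assms(2) a2 unfolding admissible_def by (auto simp: C2_cut_def)
qed

interpretation hk1: hankel_kernel "\<lambda>_. 1" "- \<real>\<^sub>\<le>\<^sub>0" 0
proof
  show "open (- \<real>\<^sub>\<le>\<^sub>0 :: complex set)" by (simp add: open_Compl)
  have eq: "\<real>\<^sub>\<le>\<^sub>0 = complex_of_real ` {..0}"
    by (auto simp: complex_nonpos_Reals_iff complex_eq_iff image_iff)
  show "starlike (- \<real>\<^sub>\<le>\<^sub>0 :: complex set)" unfolding eq by (rule starlike_slotted_complex_plane_left)
  show "\<exists>A'. ((\<lambda>_. 1) has_field_derivative A') (at z) \<and> (z - 1) * A' = - 0 * 1" for z :: complex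
    by (intro exI[of _ 0]) auto
qed (auto simp: complex_nonpos_Reals_iff intro!: exI[of _ 1])

lemma admissible_1: "a > 0 \<Longrightarrow> hk1.admissible a"
  by (auto simp: hk1.admissible_def complex_nonpos_Reals_iff intro!: exI[of _ 1])

section \<open>Scaling of Hankel's integral\<close>

lemma parabola_scale:
  assumes "x > 0"
  shows "of_real x * parabola a t = parabola (a * sqrt x) (t * sqrt x)"
    and "of_real (sqrt x) * parabola' a t = parabola' (a * sqrt x) (t * sqrt x)"
proof -
  have sq: "(complex_of_real (sqrt x))\<^sup>2 = of_real x" using assms by (simp flip: of_real_power)
  have "parabola (a * sqrt x) (t * sqrt x) = (of_real (sqrt x) * (of_real a + \<i> * of_real t))\<^sup>2"
    by (simp add: parabola_def algebra_simps)
  then show "of_real x * parabola a t = parabola (a * sqrt x) (t * sqrt x)"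
    unfolding power_mult_distrib sq parabola_def by (rule sym)
  show "of_real (sqrt x) * parabola' a t = parabola' (a * sqrt x) (t * sqrt x)"
    by (simp add: parabola'_def algebra_simps)
qed

text \<open>Multiplication by \<open>x\<close> maps one parabola onto another with the parameter
  stretched by \<open>sqrt x\<close>. The Jacobian and the factor in \<open>parabola'\<close>
  contribute one \<open>sqrt x\<close> each, which gives the denominator.\<close>

lemma integral_parabola_scale:
  fixes G :: "complex \<Rightarrow> complex"
  assumes x: "x > 0"
  shows "(LINT t|lborel. G (of_real x * parabola a t) * parabola' a t) =
     (LINT t|lborel. G (parabola (a * sqrt x) t) * parabola' (a * sqrt x) t) / of_real x"
proof -
  have "(LINT t|lborel. G (parabola (a * sqrt x) t) * parabola' (a * sqrt x) t) =
      \<bar>sqrt x\<bar> *\<^sub>R (LINT t|lborel. G (parabola (a * sqrt x) (0 + sqrt x * t)) * parabola' (a * sqrt x) (0 + sqrt x * t))"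
    using x by (intro lborel_integral_real_affine) simp
  also have "\<dots> = \<bar>sqrt x\<bar> *\<^sub>R (LINT t|lborel. of_real (sqrt x) * (G (of_real x * parabola a t) * parabola' a t))"
  proof -
    have "parabola (a * sqrt x) (0 + sqrt x * t) = of_real x * parabola a t"
      "parabola' (a * sqrt x) (0 + sqrt x * t) = of_real (sqrt x) * parabola' a t" for t
      by (simp_all only: parabola_scale[OF x] mult.commute[of "sqrt x" t] add_0)
    then show ?thesis by (simp only: mult.left_commute)
  qed
  also have "\<dots> = (of_real (sqrt x) * of_real (sqrt x)) * (LINT t|lborel. G (of_real x * parabola a t) * parabola' a t)"
    using x by (simp add: scaleR_conv_of_real)
  also have "complex_of_real (sqrt x) * of_real (sqrt x) = of_real x"
    using x by (simp flip: of_real_mult)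
  finally show ?thesis using x by (simp add: field_simps)
qed

lemma powr_of_real_mult:
  assumes "x > 0" "z \<noteq> 0"
  shows "(of_real x * z) powr s = of_real x powr s * (z::complex) powr s"
proof -
  have "Ln (of_real x * z) = of_real (ln x) + Ln z"
    using assms by (simp add: Ln_times_of_real Ln_of_real)
  moreover have "Ln (complex_of_real x) = of_real (ln x)" using assms(1) by (rule Ln_of_real)
  ultimately show ?thesis using assms by (simp add: powr_def exp_add[symmetric] distrib_left)
qed

text \<open>The substitution \<open>w = x * z\<close> moves the contour to
  \<open>parabola (a * sqrt x)\<close>; \<open>hk1.V_unique\<close> brings it back to
  \<open>parabola 1\<close>, and this is where \<open>Re s \<ge> -1\<close> is used.\<close>

lemma V1_scale:
  assumes a: "a > 0" and x: "x > 0" and s: "Re s \<ge> -1"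
  shows "hk1.V a x s = of_real x powr (s - 1) * hk1.V 1 1 s"
proof -
  have pt: "hk1.kern x s p = of_real x powr s * hk1.kern 1 s (of_real x * p)" if "p \<noteq> 0" for p
  proof -
    have "complex_of_real x powr s * of_real x powr (- s) = 1"
      using x by (simp add: powr_minus)
    then show ?thesis
      unfolding hk1.kern_def powr_of_real_mult[OF x that] by (simp add: mult.assoc[symmetric])
  qed
  have "hk1.V a x s = (LINT t|lborel. of_real x powr s * (hk1.kern 1 s (of_real x * parabola a t) * parabola' a t))"
    unfolding hk1.V_def pt[OF parabola_nonzero[OF a]] by (simp only: mult.assoc)
  also have "\<dots> = of_real x powr s * (hk1.V (a * sqrt x) 1 s / of_real x)"
    unfolding integral_mult_right_zero integral_parabola_scale[OF x, of "hk1.kern 1 s" a] hk1.V_def ..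
  also have "hk1.V (a * sqrt x) 1 s = hk1.V 1 1 s"
    using a x s by (intro hk1.V_unique admissible_1) auto
  finally show ?thesis using x by (simp add: powr_diff)
qed

text \<open>The functional equation of \<open>1 / \<Gamma>\<close>, obtained by differentiating at
  \<open>x = 1\<close> in two ways: under the integral, which lowers \<open>s\<close>, and through
  the scaling law, which yields the factor \<open>s - 1\<close>.\<close>

lemma V1_Suc:
  assumes s: "Re s \<ge> -1"
  shows "(s - 1) * hk1.V 1 1 s = hk1.V 1 1 (s - 1)"
proof -
  have "((\<lambda>x. hk1.V 1 x s) has_vector_derivative hk1.V 1 1 (s - 1)) (at 1)"
    by (intro hk1.V_has_vector_derivative admissible_1) auto
  moreover have "((\<lambda>x. of_real x powr (s - 1) * hk1.V 1 1 s) has_vector_derivative (s - 1) * hk1.V 1 1 s) (at 1)"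
  proof -
    have "((\<lambda>z. z powr (s - 1) * hk1.V 1 1 s) has_field_derivative (s - 1) * 1 powr (s - 1 - 1) * hk1.V 1 1 s) (at (of_real 1))"
      by (auto intro!: derivative_eq_intros simp: complex_nonpos_Reals_iff)
    from has_vector_derivative_real_field[OF this] show ?thesis by simp
  qed
  then have "((\<lambda>x. hk1.V 1 x s) has_vector_derivative (s - 1) * hk1.V 1 1 s) (at 1)"
  proof (rule has_vector_derivative_transform_within_open[of _ _ _ "{0<..}"])
    show "of_real y powr (s - 1) * hk1.V 1 1 s = hk1.V 1 y s" if "y \<in> {0<..}" for y :: real
      using that s by (intro V1_scale[symmetric]) auto
  qed auto
  ultimately show ?thesis using vector_derivative_unique_at by blast
qed

section \<open>The integrals of Laplace and Hankel\<close>

text \<open>The weight of the Gamma integral, extended by 0 so that Laplace integrals run over all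
  of \<open>lborel\<close> and \<open>exp_integral_has_field_derivative\<close> applies to them with
  \<open>p t = - t\<close>.\<close>

definition half_power :: "complex \<Rightarrow> real \<Rightarrow> complex" where
  "half_power \<alpha> t = indicator {0<..} t *\<^sub>R (of_real t powr (\<alpha> - 1))"

lemma half_power_measurable [measurable]: "half_power \<alpha> \<in> borel_measurable borel"
  unfolding half_power_def[abs_def]
  by (intro borel_measurable_continuous_on_indicator continuous_intros) auto

lemma integrable_half_power_exp:
  assumes \<alpha>: "Re \<alpha> > 0" and w: "Re w > 0"
  shows "integrable lborel (\<lambda>t. exp (w * (- of_real t)) * half_power \<alpha> t)"
proof -
  have [measurable]: "(\<lambda>t. indicator {0<..} t *\<^sub>R (complex_of_real t powr (\<alpha> - 1) / of_real (exp (Re w * t)))) \<in> borel_measurable borel"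
    by (intro borel_measurable_continuous_on_indicator continuous_intros) auto
  have "integrable lborel (\<lambda>t. indicator {0<..} t *\<^sub>R (complex_of_real t powr (\<alpha> - 1) / of_real (exp (Re w * t))))"
    using absolutely_integrable_Gamma_integral[OF \<alpha> w]
    unfolding set_integrable_def by (subst (asm) integrable_completion) auto
  then show ?thesis
  proof (rule Bochner_Integration.integrable_bound)
    show "AE t in lborel. norm (exp (w * (- of_real t)) * half_power \<alpha> t) \<le>
        norm (indicator {0<..} t *\<^sub>R (complex_of_real t powr (\<alpha> - 1) / of_real (exp (Re w * t))))"
      by (intro AE_I2) (auto simp: half_power_def norm_mult norm_divide exp_minus field_simps)
  qed measurable
qed

lemma Gamma_integral_lborel:
  assumes \<alpha>: "Re \<alpha> > 0"
  shows "(LINT t|lborel. exp (- of_real t) * half_power \<alpha> t) = Gamma \<alpha>"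
proof -
  have int: "set_integrable lborel {0<..} (\<lambda>t. complex_of_real t powr (\<alpha> - 1) / of_real (exp t))"
    using integrable_half_power_exp[OF \<alpha>, of 1] unfolding set_integrable_def half_power_def
    by (simp add: exp_minus field_simps exp_of_real)
  have "(LINT t|lborel. exp (- of_real t) * half_power \<alpha> t) = (LINT t:{0<..}|lborel. complex_of_real t powr (\<alpha> - 1) / of_real (exp t))"
    unfolding set_lebesgue_integral_def half_power_def
    by (intro Bochner_Integration.integral_cong) (auto simp: exp_minus field_simps exp_of_real)
  also have "\<dots> = integral {0<..} (\<lambda>t. complex_of_real t powr (\<alpha> - 1) / of_real (exp t))"
    using int by (rule set_borel_integral_eq_integral(2))
  also have "\<dots> = Gamma \<alpha>"
    using Gamma_integral_complex'[OF \<alpha>] by (rule integral_unique)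
  finally show ?thesis .
qed

lemma half_power_shift:
  "of_real t * half_power \<alpha> t = half_power (\<alpha> + 1) t"
  by (cases "t > 0") (auto simp: half_power_def powr_diff)

text \<open>Integrate the derivative of \<open>exp (- w * t) * t powr \<alpha>\<close> over the
  half-line; the boundary terms vanish at 0 because \<open>Re \<alpha> > 0\<close> and at infinity
  because \<open>Re w > 0\<close>.\<close>

lemma Laplace_half_power_shift:
  assumes \<alpha>: "Re \<alpha> > 0" and w: "Re w > 0"
  shows "w * (LINT t|lborel. exp (w * (- of_real t)) * half_power (\<alpha> + 1) t)
       = \<alpha> * (LINT t|lborel. exp (w * (- of_real t)) * half_power \<alpha> t)"
proof -
  define F where "F t = exp (w * (- of_real t)) * of_real t powr \<alpha>" for t :: real
  define f where "f t = \<alpha> * (exp (w * (- of_real t)) * of_real t powr (\<alpha> - 1))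
      - w * (exp (w * (- of_real t)) * of_real t powr \<alpha>)" for t :: real
  have dF: "(F has_vector_derivative f t) (at t)" if t: "t > 0" for t
  proof -
    have "((\<lambda>z. exp (w * (- z)) * z powr \<alpha>) has_field_derivative f t) (at (of_real t))"
      unfolding f_def using t
      by (auto intro!: derivative_eq_intros simp: complex_nonpos_Reals_iff)
    from has_vector_derivative_real_field[OF this] show ?thesis by (simp add: F_def[abs_def])
  qed
  have "(\<lambda>t. indicator {0<..} t *\<^sub>R f t) = (\<lambda>t. \<alpha> * (exp (w * (- of_real t)) * half_power \<alpha> t)
       - w * (exp (w * (- of_real t)) * half_power (\<alpha> + 1) t))"
    by (auto simp: fun_eq_iff f_def half_power_def indicator_def)
  moreover have "integrable lborel (\<lambda>t. \<alpha> * (exp (w * (- of_real t)) * half_power \<alpha> t)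
       - w * (exp (w * (- of_real t)) * half_power (\<alpha> + 1) t))"
    using \<alpha> by (intro Bochner_Integration.integrable_diff integrable_mult_right integrable_half_power_exp w) auto
  ultimately have int: "set_integrable lborel {0<..} f"
    and val: "(LINT t:{0<..}|lborel. f t) = (LINT t|lborel. \<alpha> * (exp (w * (- of_real t)) * half_power \<alpha> t)
       - w * (exp (w * (- of_real t)) * half_power (\<alpha> + 1) t))"
    unfolding set_integrable_def set_lebesgue_integral_def by simp_all
  have normF: "norm (F t) = exp (- (Re w * t)) * t powr (Re \<alpha>)" if "t > 0" for t
    using that by (simp add: F_def norm_mult norm_powr_real_powr)
  have "(LBINT t=0..\<infinity>. f t) = 0 - 0"
  proof (rule interval_integral_FTC_integrable)
    show "(F has_vector_derivative f t) (at t)" if "0 < ereal t" for t using that by (intro dF) auto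
    show "isCont f t" if "0 < ereal t" for t
      unfolding f_def using that by (intro continuous_intros) (auto simp: complex_nonpos_Reals_iff)
    show "set_integrable lborel (einterval 0 \<infinity>) f"
      using int by (simp add: zero_ereal_def)
    have "((\<lambda>t. exp (- (Re w * t)) * t powr (Re \<alpha>)) \<longlongrightarrow> 0) (at_right 0)" using \<alpha> by real_asymp
    then have "(F \<longlongrightarrow> 0) (at_right 0)"
      by (rule Lim_null_comparison[rotated]) (auto simp: normF intro!: eventually_mono[OF eventually_at_right_less])
    then show "((F \<circ> real_of_ereal) \<longlongrightarrow> 0) (at_right 0)" by (simp add: zero_ereal_def ereal_tendsto_simps)
    have "((\<lambda>t. exp (- (Re w * t)) * t powr (Re \<alpha>)) \<longlongrightarrow> 0) at_top" using w by real_asymp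
    then have "(F \<longlongrightarrow> 0) at_top"
      by (rule Lim_null_comparison[rotated]) (auto simp: normF intro!: eventually_mono[OF eventually_gt_at_top[of 0]])
    then show "((F \<circ> real_of_ereal) \<longlongrightarrow> 0) (at_left \<infinity>)" by (simp add: ereal_tendsto_simps)
  qed auto
  then have "(LINT t:{0<..}|lborel. f t) = 0" by (simp add: interval_lebesgue_integral_0_infty)
  moreover have "Re (\<alpha> + 1) > 0" using \<alpha> by simp
  ultimately have "\<alpha> * (LINT t|lborel. exp (w * (- of_real t)) * half_power \<alpha> t)
       - w * (LINT t|lborel. exp (w * (- of_real t)) * half_power (\<alpha> + 1) t) = 0"
    unfolding val integral_mult_right_zero[symmetric]
    by (subst (asm) Bochner_Integration.integral_diff)
       (intro integrable_mult_right integrable_half_power_exp w \<alpha>; assumption)+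
  then show ?thesis by simp
qed

text \<open>By the shift relation \<open>w powr \<alpha>\<close> times the integral has derivative 0
  on the half-plane \<open>Re w > 0\<close>, and at \<open>w = 1\<close> it is the Gamma integral.
  This takes the place of a rotation of the half-line.\<close>

lemma Laplace_half_power:
  assumes \<alpha>: "Re \<alpha> > 0" and w: "Re w > 0"
  shows "(LINT t|lborel. exp (w * (- of_real t)) * half_power \<alpha> t) = Gamma \<alpha> * w powr (- \<alpha>)"
proof -
  define L where "L \<alpha> w = (LINT t|lborel. exp (w * (- of_real t)) * half_power \<alpha> t)" for \<alpha> w
  have dL: "(L \<alpha> has_field_derivative - L (\<alpha> + 1) w) (at w)" if w: "Re w > 0" for w
  proof -
    \<comment> \<open>Half of the decay rate is kept in reserve for the difference quotient.\<close>
    define \<delta> where "\<delta> = Re w / 2"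
    have \<delta>: "\<delta> > 0" using w by (simp add: \<delta>_def)
    have "(L \<alpha> has_field_derivative (LINT t|lborel. - of_real t * (exp (w * (- of_real t)) * half_power \<alpha> t))) (at w)"
      unfolding L_def
    proof (rule exp_integral_has_field_derivative[OF _ _ \<delta>])
      fix v assume "v \<in> ball w \<delta>"
      then have "\<bar>Re (w - v)\<bar> < \<delta>" using abs_Re_le_cmod[of "w - v"] by (simp add: dist_norm)
      then have "Re v > 0" using w unfolding \<delta>_def minus_complex.sel by arith
      then show "integrable lborel (\<lambda>t. exp (v * (- of_real t)) * half_power \<alpha> t)"
        by (intro integrable_half_power_exp \<alpha>)
    next
      have "integrable lborel (\<lambda>t. norm (exp (of_real \<delta> * (- of_real t)) * half_power (\<alpha> + 1) t))"
        using \<alpha> \<delta> by (intro integrable_norm integrable_half_power_exp) auto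
      also have "(\<lambda>t. norm (exp (of_real \<delta> * (- of_real t)) * half_power (\<alpha> + 1) t)) =
        (\<lambda>t. norm (- complex_of_real t) * norm (half_power \<alpha> t) * exp (Re (w * (- of_real t)) + \<delta> * norm (- complex_of_real t)))"
      proof
        fix t :: real
        show "norm (exp (of_real \<delta> * (- of_real t)) * half_power (\<alpha> + 1) t) =
          norm (- complex_of_real t) * norm (half_power \<alpha> t) * exp (Re (w * (- of_real t)) + \<delta> * norm (- complex_of_real t))"
        proof (cases "t > 0")
          case True
          then have "Re (w * (- of_real t)) + \<delta> * norm (- complex_of_real t) = - (\<delta> * t)"
            by (simp add: \<delta>_def field_simps)
          then show ?thesis
            unfolding half_power_shift[symmetric] using True by (simp add: norm_mult)
        qed (simp add: half_power_def)
      qed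
      finally show "integrable lborel (\<lambda>t. norm (- complex_of_real t) * norm (half_power \<alpha> t) *
          exp (Re (w * (- of_real t)) + \<delta> * norm (- complex_of_real t)))" .
    qed auto
    also have "(LINT t|lborel. - of_real t * (exp (w * (- of_real t)) * half_power \<alpha> t)) = - L (\<alpha> + 1) w"
      unfolding L_def half_power_shift[symmetric]
      by (subst integral_minus[symmetric]) (simp add: mult_ac)
    finally show ?thesis .
  qed
  define h where "h w = w powr \<alpha> * L \<alpha> w" for w
  have "(h has_field_derivative 0) (at w)" if w: "Re w > 0" for w
  proof -
    have w0: "w \<notin> \<real>\<^sub>\<le>\<^sub>0" "w \<noteq> 0" using w by (auto simp: complex_nonpos_Reals_iff)
    have "(h has_field_derivative \<alpha> * w powr (\<alpha> - 1) * L \<alpha> w + w powr \<alpha> * (- L (\<alpha> + 1) w)) (at w)"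
      unfolding h_def[abs_def] using w0 by (auto intro!: derivative_eq_intros dL[OF w])
    also have "\<alpha> * w powr (\<alpha> - 1) * L \<alpha> w = w powr (\<alpha> - 1) * (w * L (\<alpha> + 1) w)"
      using Laplace_half_power_shift[OF \<alpha> w] unfolding L_def by (simp only: mult_ac)
    also have "w powr (\<alpha> - 1) * (w * L (\<alpha> + 1) w) = w powr \<alpha> * L (\<alpha> + 1) w"
      using w0 by (simp add: powr_diff)
    finally show ?thesis by simp
  qed
  then have "\<exists>c. \<forall>x\<in>{w. Re w > 0}. h x = c"
    by (intro has_field_derivative_zero_constant convex_halfspace_Re_gt)
       (auto intro: has_field_derivative_at_within)
  then have "h w = h 1" using w by auto
  also have "h 1 = Gamma \<alpha>" using Gamma_integral_lborel[OF \<alpha>] by (simp add: h_def L_def)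
  finally have "w powr \<alpha> * L \<alpha> w = Gamma \<alpha>" by (simp add: h_def)
  moreover have "w \<noteq> 0" using w by auto
  ultimately show ?thesis unfolding L_def by (simp add: powr_minus field_simps)
qed

text \<open>The base \<open>a + \<i> * t\<close> lies in the right half-plane, so doubling its
  argument stays within the principal branch.\<close>

lemma parabola_powr:
  assumes "a > 0"
  shows "parabola a t powr s = (of_real a + \<i> * of_real t) powr (2 * s)"
proof -
  define w where "w = complex_of_real a + \<i> * of_real t"
  have w: "Re w > 0" "w \<noteq> 0" using assms by (auto simp: w_def complex_eq_iff)
  have "w\<^sup>2 = exp (2 * Ln w)" using w by (simp add: exp_double)
  moreover have "Ln (exp (2 * Ln w)) = 2 * Ln w"
    using Re_Ln_pos_lt_imp[OF w(1)] by (intro Ln_exp) auto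
  ultimately have "Ln (w\<^sup>2) = 2 * Ln w" by simp
  then show ?thesis unfolding parabola_def w_def[symmetric] using w by (simp add: powr_def mult_ac)
qed

text \<open>For \<open>Re s \<le> 1/2\<close> the exponent \<open>1/2 - Re s\<close> is nonnegative,
  so the bound increases with \<open>a\<close>, and its value at \<open>a = 1\<close> dominates all
  parabolas collapsing to the cut.\<close>

lemma hk1_kern_parabola_bound:
  assumes a: "0 < a" "a \<le> 1" and s: "Re s \<le> 1/2"
  shows "norm (hk1.pkern a 1 s t)
    \<le> 2 * exp (pi * \<bar>Im s\<bar>) * ((1\<^sup>2 + t\<^sup>2) powr (1/2 - Re s) * exp (1 * (1\<^sup>2 - t\<^sup>2)))"
proof -
  define u where "u = a\<^sup>2 + t\<^sup>2"
  have u: "u > 0" using a by (simp add: u_def add_pos_nonneg)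
  have a2: "a\<^sup>2 \<le> 1" using a by (simp add: power_le_one)
  have "norm (parabola a t powr (- s)) \<le> u powr (- Re s) * exp (pi * \<bar>Im s\<bar>)"
    using norm_powr_le[OF parabola_nonzero[OF a(1)], of t "- s"] by (simp add: u_def)
  then have "norm (hk1.pkern a 1 s t)
      \<le> (exp (a\<^sup>2 - t\<^sup>2) * (u powr (- Re s) * exp (pi * \<bar>Im s\<bar>))) * (2 * sqrt u)"
    unfolding hk1.kern_def norm_mult by (intro mult_mono) (auto simp: u_def)
  also have "\<dots> = 2 * exp (pi * \<bar>Im s\<bar>) * ((u powr (- Re s) * u powr (1/2)) * exp (a\<^sup>2 - t\<^sup>2))"
    using u by (simp add: powr_half_sqrt mult_ac)
  also have "u powr (- Re s) * u powr (1/2) = u powr (1/2 - Re s)"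
    by (simp add: powr_add[symmetric])
  also have "2 * exp (pi * \<bar>Im s\<bar>) * (u powr (1/2 - Re s) * exp (a\<^sup>2 - t\<^sup>2))
      \<le> 2 * exp (pi * \<bar>Im s\<bar>) * ((1\<^sup>2 + t\<^sup>2) powr (1/2 - Re s) * exp (1 * (1\<^sup>2 - t\<^sup>2)))"
    using u a2 s by (intro mult_left_mono mult_mono powr_mono2) (auto simp: u_def)
  finally show ?thesis .
qed

text \<open>
  For \<open>Re s \<le> 1/2\<close> the parabola can be collapsed onto the negative half-line, which yields
  the reflected Gamma integral.
\<close>

lemma hankel_collapsed:
  assumes s: "-1 < Re s" "Re s \<le> 1/2"
  shows "hk1.V 1 1 s = 2 * of_real pi * \<i> * rGamma s"
proof -
  \<comment> \<open>The integrand on the degenerate parabola \<open>a = 0\<close>, which is the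
    negative half-line run through twice. At \<open>t = 0\<close> it meets the branch point, so the
    convergence to \<open>g\<close> is claimed almost everywhere only.\<close>
  define g where "g t = exp (- (of_real t)\<^sup>2) * (\<i> * of_real t) powr (- 2 * s) * (2 * \<i> * (\<i> * of_real t))" for t :: real
  define h where "h n = 1 / real (Suc n)" for n
  have h: "h n > 0" "h n \<le> 1" for n by (auto simp: h_def)
  have hlim: "h \<longlonglongrightarrow> 0"
    unfolding h_def using LIMSEQ_inverse_real_of_nat by (simp add: inverse_eq_divide)
  obtain C where C: "C \<ge> 0" "\<And>t. (1\<^sup>2 + t\<^sup>2) powr (1/2 - Re s) * exp (1 * (1\<^sup>2 - t\<^sup>2)) \<le> C / (1 + t\<^sup>2)"
    using power_mult_exp_le[of 1 1 "1/2 - Re s"] by auto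
  have [measurable]: "(\<lambda>t. hk1.pkern (h n) 1 s t) \<in> borel_measurable lborel" for n
    using hk1.measurable_kern_parabola[OF admissible_1[OF h(1)]] by simp
  have gm [measurable]: "g \<in> borel_measurable lborel"
    unfolding g_def[abs_def] powr_def by measurable
  have ptw: "AE t in lborel. (\<lambda>n. hk1.pkern (h n) 1 s t) \<longlonglongrightarrow> g t"
  proof (rule AE_mp[OF AE_lborel_singleton[of 0]], rule AE_I2, rule impI)
    fix t :: real assume t: "t \<noteq> 0"
    have "(\<lambda>n. exp (parabola (h n) t) * (of_real (h n) + \<i> * of_real t) powr (- 2 * s)
        * (2 * \<i> * (of_real (h n) + \<i> * of_real t))) \<longlonglongrightarrow>
        exp ((of_real 0 + \<i> * of_real t)\<^sup>2) * (of_real 0 + \<i> * of_real t) powr (- 2 * s)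
        * (2 * \<i> * (of_real 0 + \<i> * of_real t))"
      unfolding parabola_def using t
      by (intro tendsto_intros hlim) (auto simp: complex_nonpos_Reals_iff)
    then show "(\<lambda>n. hk1.pkern (h n) 1 s t) \<longlonglongrightarrow> g t"
      unfolding hk1.kern_def parabola_powr[OF h(1)] parabola'_def g_def
      by (simp add: power_mult_distrib)
  qed
  have bnd: "AE t in lborel. norm (hk1.pkern (h n) 1 s t)
      \<le> 2 * exp (pi * \<bar>Im s\<bar>) * C / (1 + t\<^sup>2)" for n
  proof (rule AE_I2)
    fix t
    have "norm (hk1.pkern (h n) 1 s t) \<le> 2 * exp (pi * \<bar>Im s\<bar>) * (C / (1 + t\<^sup>2))"
      by (rule order_trans[OF hk1_kern_parabola_bound[OF h s(2)]]) (intro mult_left_mono C, auto)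
    then show "norm (hk1.pkern (h n) 1 s t) \<le> 2 * exp (pi * \<bar>Im s\<bar>) * C / (1 + t\<^sup>2)"
      by simp
  qed
  have gint: "integrable lborel g"
    by (rule integrable_dominated_convergence[OF gm _ integrable_inverse_1_plus_square' ptw bnd]) measurable
  have "(\<lambda>n. hk1.V (h n) 1 s) \<longlonglongrightarrow> (LINT t|lborel. g t)"
    unfolding hk1.V_def
    by (rule integral_dominated_convergence[OF gm _ integrable_inverse_1_plus_square' ptw bnd]) measurable
  moreover have "hk1.V (h n) 1 s = hk1.V 1 1 s" for n
    using h s by (intro hk1.V_unique admissible_1) auto
  ultimately have Vg: "hk1.V 1 1 s = (LINT t|lborel. g t)"
    by (simp add: LIMSEQ_const_iff)
  define f where "f u = of_real u powr (- s) * exp (- of_real u)" for u :: real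
  have Gf: "set_integrable lborel {0<..} f" "(LINT u:{0<..}|lborel. f u) = Gamma (1 - s)"
  proof -
    have eq: "(\<lambda>u. indicator {0<..} u *\<^sub>R f u) = (\<lambda>u. exp (1 * (- of_real u)) * half_power (1 - s) u)"
      by (auto simp: fun_eq_iff f_def half_power_def indicator_def)
    show "set_integrable lborel {0<..} f"
      unfolding set_integrable_def eq using s by (intro integrable_half_power_exp) auto
    show "(LINT u:{0<..}|lborel. f u) = Gamma (1 - s)"
      unfolding set_lebesgue_integral_def eq using Gamma_integral_lborel[of "1 - s"] s by simp
  qed
  \<comment> \<open>The parameters \<open>t\<close> and \<open>- t\<close> belong to the same point
    \<open>- t\<^sup>2\<close>, seen from above and from below the cut and passed in opposite
    directions. The two branches of the power combine to the sine, and \<open>u = t\<^sup>2\<close>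
    leaves the Gamma integrand \<open>f\<close>.\<close>
  have fold: "g t + g (- t) = 2 * \<i> * sin (of_real pi * s) * ((2 * t) *\<^sub>R f (t\<^sup>2))" if t: "t > 0" for t
  proof -
    have L: "Ln (\<i> * of_real t) = of_real (ln t) + \<i> * of_real pi / 2"
      using t Ln_times_ii[of "of_real t"] by (simp add: Ln_of_real)
    have L': "Ln (- (\<i> * of_real t)) = of_real (ln t) - \<i> * of_real pi / 2"
      using t Ln_times_of_real[of t "- \<i>"] by (simp add: mult.commute Ln_of_real)
    define T where "T = exp (- 2 * s * of_real (ln t))"
    have P: "(\<i> * of_real t) powr (- 2 * s) = T * exp (- (\<i> * (of_real pi * s)))"
      using t unfolding powr_def L T_def by (simp add: exp_add[symmetric] algebra_simps)
    have P': "(- (\<i> * of_real t)) powr (- 2 * s) = T * exp (\<i> * (of_real pi * s))"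
      using t unfolding powr_def L' T_def by (simp add: exp_add[symmetric] algebra_simps)
    have "complex_of_real (t\<^sup>2) powr (- s) = T"
    proof -
      have "Ln (complex_of_real (t\<^sup>2)) = of_real (2 * ln t)"
        using t by (subst Ln_of_real) (auto simp: ln_realpow)
      then show ?thesis using t unfolding powr_def T_def by (simp add: mult_ac)
    qed
    then have f: "f (t\<^sup>2) = T * exp (- (of_real t)\<^sup>2)" by (simp add: f_def)
    have "g t + g (- t) = exp (- (of_real t)\<^sup>2) * T * 2 * of_real t *
        (exp (\<i> * (of_real pi * s)) - exp (- (\<i> * (of_real pi * s))))"
      unfolding g_def using P P' by (simp add: algebra_simps)
    also have "exp (\<i> * (of_real pi * s)) - exp (- (\<i> * (of_real pi * s))) = 2 * \<i> * sin (of_real pi * s)"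
      by (simp add: sin_exp_eq)
    finally show ?thesis by (simp add: f scaleR_conv_of_real mult_ac)
  qed
  have half: "(LINT t|lborel. g t) = (LINT t:{0<..}|lborel. g t + g (- t))"
    and half_int: "set_integrable lborel {0<..} (\<lambda>t. g t + g (- t))"
  proof -
    have i1: "integrable lborel (\<lambda>t. indicator {0<..} t *\<^sub>R g t)" and i2: "integrable lborel (\<lambda>t. indicator {..<0} t *\<^sub>R g t)"
      using integrable_mult_indicator[OF _ gint] by auto
    have i3: "integrable lborel (\<lambda>t. indicator {0<..} t *\<^sub>R g (- t))"
      using lborel_integrable_real_affine[OF i2, of "-1" 0] by (simp add: indicator_def)
    have refl: "(LINT t|lborel. indicator {..<0} t *\<^sub>R g t) = (LINT t|lborel. indicator {0<..} t *\<^sub>R g (- t))"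
      using lborel_integral_real_affine[of "-1" "\<lambda>t. indicator {..<0} t *\<^sub>R g t" 0] by (simp add: indicator_def)
    have "(LINT t|lborel. g t) = (LINT t|lborel. indicator {0<..} t *\<^sub>R g t + indicator {..<0} t *\<^sub>R g t)"
    proof (rule integral_cong_AE)
      show "AE t in lborel. g t = indicator {0<..} t *\<^sub>R g t + indicator {..<0} t *\<^sub>R g t"
        by (rule AE_mp[OF AE_lborel_singleton[of 0]], rule AE_I2) (auto simp: indicator_def)
    qed measurable
    also have "\<dots> = (LINT t|lborel. indicator {0<..} t *\<^sub>R g t + indicator {0<..} t *\<^sub>R g (- t))"
      using i1 i2 i3 by (simp add: refl)
    finally show "(LINT t|lborel. g t) = (LINT t:{0<..}|lborel. g t + g (- t))"
      unfolding set_lebesgue_integral_def by (simp add: scaleR_add_right)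
    show "set_integrable lborel {0<..} (\<lambda>t. g t + g (- t))"
      unfolding set_integrable_def scaleR_add_right using i1 i3 by (rule Bochner_Integration.integrable_add)
  qed
  define S where "S = 2 * \<i> * sin (of_real pi * s)"
  show ?thesis
  proof (cases "S = 0")
    \<comment> \<open>In the given range the sine vanishes only at \<open>s = 0\<close>, where both
      sides are 0. The case is separate because the integrability of the substituted integrand is
      obtained below by dividing by \<open>S\<close>.\<close>
    case True
    have "g t + g (- t) = 0" if "t > 0" for t
      using True fold[OF that] by (simp add: S_def)
    then have z: "indicator {0<..} t *\<^sub>R (g t + g (- t)) = 0" for t
      by (simp add: indicator_def)
    have "hk1.V 1 1 s = 0"
      unfolding Vg half set_lebesgue_integral_def z by (rule Bochner_Integration.integral_zero)
    moreover have "rGamma s = 0"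
    proof -
      have "rGamma s * rGamma (1 - s) = 0" using True rGamma_reflection_complex[of s] by (simp add: S_def)
      moreover have "1 - s \<notin> \<int>\<^sub>\<le>\<^sub>0" using s by (auto elim!: nonpos_Ints_cases simp: complex_eq_iff)
      then have "rGamma (1 - s) \<noteq> 0" by (simp add: rGamma_eq_zero_iff)
      ultimately show ?thesis by simp
    qed
    ultimately show ?thesis by simp
  next
    case False
    have "(LBINT u=0..\<infinity>. f u) = (LBINT t=0..\<infinity>. (2 * t) *\<^sub>R f (t\<^sup>2))"
    proof (rule interval_integral_substitution_integrable[of 0 \<infinity> "\<lambda>t. t\<^sup>2" "\<lambda>t. 2 * t" f])
      show "isCont f (x\<^sup>2)" if "0 < ereal x" for x
        unfolding f_def using that by (intro continuous_intros) (auto simp: complex_nonpos_Reals_iff)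
      have "set_integrable lborel {0<..} (\<lambda>t. (1 / S) * (g t + g (- t)))"
        using half_int by (intro set_integrable_mult_right)
      then show "set_integrable lborel (einterval 0 \<infinity>) (\<lambda>t. (2 * t) *\<^sub>R f (t\<^sup>2))"
        using False by (subst set_integrable_cong[of lborel lborel _ "{0<..}" _ "\<lambda>t. (1 / S) * (g t + g (- t))"])
          (auto simp: zero_ereal_def fold S_def)
      show "set_integrable lborel (einterval 0 \<infinity>) f" using Gf(1) by (simp add: zero_ereal_def)
      show "((ereal \<circ> (\<lambda>t. t\<^sup>2) \<circ> real_of_ereal) \<longlongrightarrow> 0) (at_right 0)"
        unfolding zero_ereal_def ereal_tendsto_simps o_assoc
        by (auto intro!: tendsto_eq_intros simp: ereal_tendsto_simps)
      have "filterlim (\<lambda>t::real. t\<^sup>2) at_top at_top" by real_asymp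
      then show "((ereal \<circ> (\<lambda>t. t\<^sup>2) \<circ> real_of_ereal) \<longlongrightarrow> \<infinity>) (at_left \<infinity>)"
        by (simp add: at_left_PInf filterlim_filtermap o_def tendsto_PInfty_eq_at_top)
    qed (auto intro!: derivative_eq_intros)
    then have "(LINT t:{0<..}|lborel. (2 * t) *\<^sub>R f (t\<^sup>2)) = Gamma (1 - s)"
      unfolding interval_lebesgue_integral_0_infty Gf(2) by (rule sym)
    moreover have "(LINT t:{0<..}|lborel. g t + g (- t)) = (LINT t:{0<..}|lborel. S * ((2 * t) *\<^sub>R f (t\<^sup>2)))"
      unfolding set_lebesgue_integral_def
      by (intro Bochner_Integration.integral_cong) (auto simp: fold S_def indicator_def)
    moreover have "(LINT t:{0<..}|lborel. S * ((2 * t) *\<^sub>R f (t\<^sup>2))) = S * (LINT t:{0<..}|lborel. (2 * t) *\<^sub>R f (t\<^sup>2))"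
      by (rule set_integral_mult_right)
    ultimately have "hk1.V 1 1 s = S * Gamma (1 - s)" unfolding Vg half by (simp only:)
    also have "\<dots> = 2 * of_real pi * \<i> * rGamma s"
    proof -
      have "1 - s \<notin> \<int>\<^sub>\<le>\<^sub>0" using s by (auto elim!: nonpos_Ints_cases simp: complex_eq_iff)
      then have "rGamma (1 - s) \<noteq> 0" by (simp add: rGamma_eq_zero_iff)
      then show ?thesis
        using rGamma_reflection_complex[of s] by (simp add: Gamma_def S_def field_simps)
    qed
    finally show ?thesis .
  qed
qed

text \<open>At \<open>s = 1\<close> the relation \<open>V1_Suc\<close> has the factor
  \<open>s - 1 = 0\<close> and says nothing about the value, which is therefore reached by
  continuity along \<open>\<sigma> n = 1 + h n\<close>.\<close>

lemma hankel_at_1: "hk1.V 1 1 1 = 2 * of_real pi * \<i>"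
proof -
  define h where "h n = 1 / (2 * real (Suc n))" for n
  \<comment> \<open>The bound \<open>1/2\<close> keeps \<open>\<sigma> n - 1\<close> within the
    range of \<open>hankel_collapsed\<close>.\<close>
  have h: "h n > 0" "h n \<le> 1/2" for n by (auto simp: h_def field_simps)
  have hlim: "h \<longlonglongrightarrow> 0"
  proof -
    have "(\<lambda>n. 1/2 * inverse (real (Suc n))) \<longlonglongrightarrow> 1/2 * 0"
      by (intro tendsto_intros LIMSEQ_inverse_real_of_nat)
    then show ?thesis by (simp add: h_def[abs_def] field_simps)
  qed
  define \<sigma> where "\<sigma> n = 1 + complex_of_real (h n)" for n
  have \<sigma>: "\<sigma> \<longlonglongrightarrow> 1"
    unfolding \<sigma>_def using tendsto_add[OF tendsto_const tendsto_of_real[OF hlim], of 1] by simp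
  obtain C where C: "C \<ge> 0" "\<And>t::real. (1\<^sup>2 + t\<^sup>2) powr (1/2) * exp (1 * (1\<^sup>2 - t\<^sup>2)) \<le> C / (1 + t\<^sup>2)"
    by (rule power_mult_exp_le[of 1 1 "1/2"]) auto
  have [measurable]: "(\<lambda>t. hk1.pkern 1 1 s t) \<in> borel_measurable lborel" for s
    using hk1.measurable_kern_parabola[OF admissible_1[of 1]] by simp
  have "(\<lambda>n. hk1.V 1 1 (\<sigma> n)) \<longlonglongrightarrow> hk1.V 1 1 1"
    unfolding hk1.V_def
  proof (rule integral_tendsto_if_le_inverse_square[where C = "2 * C"])
    show "(\<lambda>n. hk1.pkern 1 1 (\<sigma> n) t) \<longlonglongrightarrow> hk1.pkern 1 1 1 t" for t
    proof -
      have nz: "parabola 1 t \<noteq> 0" by (rule parabola_nonzero) simp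
      have "(\<lambda>n. exp (- \<sigma> n * Ln (parabola 1 t))) \<longlonglongrightarrow> exp (- 1 * Ln (parabola 1 t))"
        by (intro tendsto_intros \<sigma>)
      then have "(\<lambda>n. parabola 1 t powr (- \<sigma> n)) \<longlonglongrightarrow> parabola 1 t powr (- 1)"
        unfolding powr_def if_not_P[OF nz] .
      then show "(\<lambda>n. hk1.pkern 1 1 (\<sigma> n) t) \<longlonglongrightarrow> hk1.pkern 1 1 1 t"
        unfolding hk1.kern_def by (intro tendsto_mult tendsto_const)
    qed
    show "norm (hk1.pkern 1 1 (\<sigma> n) t) \<le> 2 * C / (1 + t\<^sup>2)" for n t
    proof -
      have "norm (parabola 1 t powr (- \<sigma> n)) \<le> (1 + t\<^sup>2) powr (- (1 + h n))"
        using norm_powr_le[OF parabola_nonzero[of 1 t], of "- \<sigma> n"] by (simp add: \<sigma>_def)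
      also have "\<dots> \<le> (1 + t\<^sup>2) powr 0" using h[of n] by (intro powr_mono) auto
      also have "\<dots> = 1" by (simp add: add_nonneg_eq_0_iff)
      finally have "norm (hk1.pkern 1 1 (\<sigma> n) t) \<le> (exp (1 - t\<^sup>2) * 1) * (2 * sqrt (1 + t\<^sup>2))"
        unfolding hk1.kern_def norm_mult by (intro mult_mono) auto
      also have "\<dots> = 2 * ((1\<^sup>2 + t\<^sup>2) powr (1/2) * exp (1 * (1\<^sup>2 - t\<^sup>2)))"
        by (simp add: powr_half_sqrt)
      also have "\<dots> \<le> 2 * (C / (1 + t\<^sup>2))" by (intro mult_left_mono C) auto
      finally show "norm (hk1.pkern 1 1 (\<sigma> n) t) \<le> 2 * C / (1 + t\<^sup>2)" by simp
    qed
  qed measurable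
  moreover have "(\<lambda>n. 2 * of_real pi * \<i> * rGamma (\<sigma> n)) \<longlonglongrightarrow> 2 * of_real pi * \<i> * rGamma 1"
    by (intro tendsto_mult tendsto_const isCont_tendsto_compose[OF isCont_rGamma[OF continuous_ident] \<sigma>])
  moreover have "hk1.V 1 1 (\<sigma> n) = 2 * of_real pi * \<i> * rGamma (\<sigma> n)" for n
  proof -
    have "(\<sigma> n - 1) * hk1.V 1 1 (\<sigma> n) = hk1.V 1 1 (\<sigma> n - 1)"
      using h[of n] by (intro V1_Suc) (auto simp: \<sigma>_def)
    also have "\<dots> = 2 * of_real pi * \<i> * rGamma (\<sigma> n - 1)"
      using h[of n] by (intro hankel_collapsed) (auto simp: \<sigma>_def)
    also have "rGamma (\<sigma> n - 1) = (\<sigma> n - 1) * rGamma (\<sigma> n)"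
      using rGamma_plus1[of "\<sigma> n - 1"] by simp
    finally have "(\<sigma> n - 1) * hk1.V 1 1 (\<sigma> n) = (\<sigma> n - 1) * (2 * of_real pi * \<i> * rGamma (\<sigma> n))"
      by (simp only: mult_ac)
    moreover have "\<sigma> n - 1 \<noteq> 0" using h[of n] by (simp add: \<sigma>_def)
    ultimately show ?thesis using mult_left_cancel[of "\<sigma> n - 1"] by blast
  qed
  ultimately show ?thesis using LIMSEQ_unique by fastforce
qed

text \<open>Each use of \<open>V1_Suc\<close> widens the known strip by one; the division by
  \<open>s - 1\<close> fails only at the point settled by \<open>hankel_at_1\<close>.\<close>

lemma hankel_formula:
  assumes "-1 < Re s"
  shows "hk1.V 1 1 s = 2 * of_real pi * \<i> * rGamma s"
proof -
  have "\<forall>s. -1 < Re s \<and> Re s \<le> real n + 1/2 \<longrightarrow> hk1.V 1 1 s = 2 * of_real pi * \<i> * rGamma s" for n :: nat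
  proof (induction n)
    case 0
    then show ?case using hankel_collapsed by auto
  next
    case (Suc n)
    show ?case
    proof (intro allI impI)
      fix s assume s: "-1 < Re s \<and> Re s \<le> real (Suc n) + 1/2"
      consider "Re s \<le> 1/2" | "s = 1" | "Re s > 1/2" "s \<noteq> 1" by linarith
      then show "hk1.V 1 1 s = 2 * of_real pi * \<i> * rGamma s"
      proof cases
        case 1
        then show ?thesis using hankel_collapsed s by auto
      next
        case 2
        then show ?thesis using hankel_at_1 by simp
      next
        case 3
        have "(s - 1) * hk1.V 1 1 s = hk1.V 1 1 (s - 1)" using 3 by (intro V1_Suc) auto
        also have "\<dots> = 2 * of_real pi * \<i> * rGamma (s - 1)" using 3 s Suc.IH by auto
        also have "rGamma (s - 1) = (s - 1) * rGamma s" using rGamma_plus1[of "s - 1"] by simp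
        finally show ?thesis using 3 by simp
      qed
    qed
  qed
  moreover obtain n :: nat where "Re s \<le> real n" using real_arch_simple by blast
  then have "Re s \<le> real n + 1/2" by simp
  ultimately show ?thesis using assms by auto
qed

lemma hankel_formula_scaled:
  assumes "a > 0" "x > 0" "-1 < Re s"
  shows "hk1.V a x s = of_real x powr (s - 1) * (2 * of_real pi * \<i> * rGamma s)"
  using V1_scale[OF assms(1,2), of s] hankel_formula[OF assms(3)] assms(3) by simp

text \<open>A majorant without the Gaussian factor, for use at \<open>x = 0\<close>. With
  \<open>u = a\<^sup>2 + t\<^sup>2\<close> one power of \<open>u\<close> is split off and compared
  with \<open>a\<^sup>2 * (1 + t\<^sup>2)\<close>; the remaining power is largest at
  \<open>t = 0\<close>.\<close>

lemma parabola_powr_le: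
  fixes a r t :: real
  assumes a: "0 < a" "a \<le> 1" and r: "r \<le> -1"
  shows "(a\<^sup>2 + t\<^sup>2) powr r \<le> ((a\<^sup>2) powr (r + 1) / a\<^sup>2) / (1 + t\<^sup>2)"
proof -
  define u where "u = a\<^sup>2 + t\<^sup>2"
  have a2: "0 < a\<^sup>2" using a by simp
  have a2': "a\<^sup>2 \<le> 1" using a by (simp add: power_le_one)
  have u: "u > 0" "a\<^sup>2 \<le> u" using a2 by (auto simp: u_def add_pos_nonneg)
  have "u powr r = u powr (r + 1) / u" using u by (simp add: powr_add)
  also have "\<dots> \<le> (a\<^sup>2) powr (r + 1) / u"
    using u a2 r by (intro divide_right_mono powr_mono2' less_imp_le[OF u(1)]) auto
  also have "\<dots> \<le> (a\<^sup>2) powr (r + 1) / (a\<^sup>2 * (1 + t\<^sup>2))"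
    using a2 u mult_right_mono[OF a2', of "t\<^sup>2"]
    by (intro divide_left_mono) (auto simp: u_def algebra_simps intro!: mult_pos_pos add_pos_nonneg)
  finally show ?thesis by (simp add: u_def)
qed

text \<open>
  Insert the Laplace representation of \<open>(1 - z)\<^sup>-\<^sup>\<alpha>\<close>, which is valid because \<open>Re z < 1\<close> on the
  parabola, and integrate over \<open>z\<close> first.
\<close>

lemma integral_parabola_beta:
  assumes \<alpha>: "Re \<alpha> > 0" and a: "0 < a" "a < 1" and s: "Re s \<ge> 3/2"
  shows "(LINT t|lborel. (1 - parabola a t) powr (- \<alpha>) * parabola a t powr (- s) * parabola' a t)
     = 2 * of_real pi * \<i> * rGamma s * Gamma (\<alpha> + s - 1) / Gamma \<alpha>"
proof -
  define p where "p = parabola a"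
  define q where "q t = parabola a t powr (- s) * parabola' a t" for t
  define f where "f t \<tau> = exp ((1 - p t) * (- of_real \<tau>)) * half_power \<alpha> \<tau> * q t" for t \<tau> :: real
  have a2: "a\<^sup>2 < 1" using a by (simp add: abs_square_less_1)
  have Re1p: "Re (1 - p t) > 0" and Re1p': "Re (1 - p t) \<ge> 1 - a\<^sup>2" for t
    using a2 zero_le_power2[of t] unfolding p_def minus_complex.sel Re_parabola one_complex.sel by linarith+
  have qk: "q t = hk1.pkern a 0 s t" for t
    by (simp add: q_def hk1.kern_def)
  have [measurable]: "q \<in> borel_measurable borel"
    using hk1.measurable_kern_parabola[OF admissible_1[OF a(1)], of 0 s] unfolding qk[abs_def] .
  have [measurable]: "p \<in> borel_measurable borel"
    unfolding p_def by (intro borel_measurable_continuous_onI continuous_intros)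
  obtain K where K: "K \<ge> 0" "\<And>x t. norm (hk1.pkern a x s t)
     \<le> K * ((a\<^sup>2 + t\<^sup>2) powr (1/2 - Re s) * exp (x * (a\<^sup>2 - t\<^sup>2)))"
    using hk1.norm_kern_parabola_le[OF admissible_1[OF a(1)]] by blast
  define B where "B = K * ((a\<^sup>2) powr (1/2 - Re s + 1) / a\<^sup>2)"
  have B: "norm (q t) \<le> B / (1 + t\<^sup>2)" for t
  proof -
    have "norm (q t) \<le> K * (a\<^sup>2 + t\<^sup>2) powr (1/2 - Re s)" using K(2)[of 0 t] by (simp add: qk)
    also have "\<dots> \<le> K * (((a\<^sup>2) powr (1/2 - Re s + 1) / a\<^sup>2) / (1 + t\<^sup>2))"
      using a s by (intro mult_left_mono parabola_powr_le K(1)) auto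
    finally show ?thesis by (simp add: B_def)
  qed
  \<comment> \<open>As \<open>Re (1 - p t) \<ge> 1 - a\<^sup>2\<close> for every \<open>t\<close>,
    the double integrand is dominated by a function of \<open>\<tau>\<close> times
    \<open>norm (q t)\<close>, and the latter is integrable by \<open>Re s \<ge> 3/2\<close>. This
    is the integrability required for Fubini.\<close>
  define I0 where "I0 = (LINT \<tau>|lborel. norm (exp (of_real (1 - a\<^sup>2) * (- of_real \<tau>)) * half_power \<alpha> \<tau>))"
  have I0int: "integrable lborel (\<lambda>\<tau>. norm (exp (of_real (1 - a\<^sup>2) * (- of_real \<tau>)) * half_power \<alpha> \<tau>))"
    using a2 by (intro integrable_norm integrable_half_power_exp \<alpha>) auto
  have fle: "norm (f t \<tau>) \<le> norm (exp (of_real (1 - a\<^sup>2) * (- of_real \<tau>)) * half_power \<alpha> \<tau>) * norm (q t)" for t \<tau>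
  proof (cases "\<tau> > 0")
    case True
    have "Re (1 - p t) * (- \<tau>) \<le> (1 - a\<^sup>2) * (- \<tau>)"
      using Re1p'[of t] True by (intro mult_right_mono_neg) auto
    then have "norm (exp ((1 - p t) * (- of_real \<tau>))) \<le> norm (exp (complex_of_real (1 - a\<^sup>2) * (- of_real \<tau>)))"
      unfolding norm_exp_eq_Re by simp
    then show ?thesis unfolding f_def norm_mult by (intro mult_right_mono) auto
  qed (simp add: f_def half_power_def)
  have fint: "integrable lborel (f t)" for t
    unfolding f_def[abs_def] by (intro integrable_mult_left integrable_half_power_exp \<alpha> Re1p)
  have pair: "integrable (lborel \<Otimes>\<^sub>M lborel) (\<lambda>(t, \<tau>). f t \<tau>)"
  proof (rule lborel_pair.Fubini_integrable)
    show "(\<lambda>(t, \<tau>). f t \<tau>) \<in> borel_measurable (lborel \<Otimes>\<^sub>M lborel)"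
      unfolding f_def[abs_def] by measurable
    show "AE t in lborel. integrable lborel (\<lambda>\<tau>. case (t, \<tau>) of (t, \<tau>) \<Rightarrow> f t \<tau>)"
      using fint by simp
    have mi: "(\<lambda>t. LINT \<tau>|lborel. norm (f t \<tau>)) \<in> borel_measurable lborel"
      unfolding f_def[abs_def] by measurable
    show "integrable lborel (\<lambda>t. LINT \<tau>|lborel. norm (case (t, \<tau>) of (t, \<tau>) \<Rightarrow> f t \<tau>))"
    proof (rule integrable_if_le_inverse_square[where C = "I0 * B"])
      fix t
      have I0: "I0 \<ge> 0" by (simp add: I0_def)
      have "(LINT \<tau>|lborel. norm (f t \<tau>)) \<le> (LINT \<tau>|lborel. norm (exp (of_real (1 - a\<^sup>2) * (- of_real \<tau>)) * half_power \<alpha> \<tau>) * norm (q t))"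
        using fle by (intro integral_mono integrable_norm fint integrable_mult_left I0int)
      also have "\<dots> = I0 * norm (q t)" by (simp add: I0_def)
      also have "\<dots> \<le> I0 * (B / (1 + t\<^sup>2))" by (intro mult_left_mono B I0)
      finally show "norm (LINT \<tau>|lborel. norm (case (t, \<tau>) of (t, \<tau>) \<Rightarrow> f t \<tau>)) \<le> I0 * B / (1 + t\<^sup>2)" by simp
    qed (use mi in simp)
  qed
  have "Gamma \<alpha> * (LINT t|lborel. (1 - p t) powr (- \<alpha>) * q t) = (LINT t|lborel. LINT \<tau>|lborel. f t \<tau>)"
    unfolding f_def integral_mult_left_zero Laplace_half_power[OF \<alpha> Re1p]
    by (simp add: mult.assoc)
  also have "\<dots> = (LINT \<tau>|lborel. LINT t|lborel. f t \<tau>)"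
    using lborel_pair.Fubini_integral[OF pair] by simp
  also have "\<dots> = (LINT \<tau>|lborel. 2 * of_real pi * \<i> * rGamma s * (exp (- of_real \<tau>) * half_power (\<alpha> + s - 1) \<tau>))"
  proof (intro Bochner_Integration.integral_cong refl)
    fix \<tau> :: real
    show "(LINT t|lborel. f t \<tau>) = 2 * of_real pi * \<i> * rGamma s * (exp (- of_real \<tau>) * half_power (\<alpha> + s - 1) \<tau>)"
    proof (cases "\<tau> > 0")
      case True
      \<comment> \<open>For fixed \<open>\<tau>\<close> the integral over \<open>t\<close> is
        Hankel's integral with \<open>x = \<tau>\<close>. Its factor
        \<open>\<tau> powr (s - 1)\<close> raises the exponent of the weight, and a Gamma integral
        is left.\<close>
      have ft: "f t \<tau> = exp (- of_real \<tau>) * half_power \<alpha> \<tau> * (hk1.pkern a \<tau> s t)" for t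
      proof -
        have "exp ((1 - p t) * (- of_real \<tau>)) = exp (- of_real \<tau>) * exp (of_real \<tau> * p t)"
          by (simp add: exp_add[symmetric] algebra_simps)
        then show ?thesis by (simp add: f_def q_def hk1.kern_def p_def mult_ac)
      qed
      have "(LINT t|lborel. f t \<tau>) = exp (- of_real \<tau>) * half_power \<alpha> \<tau> * hk1.V a \<tau> s"
        unfolding ft hk1.V_def by (rule integral_mult_right_zero)
      also have "\<dots> = 2 * of_real pi * \<i> * rGamma s * (exp (- of_real \<tau>) * (of_real \<tau> powr (\<alpha> - 1) * of_real \<tau> powr (s - 1)))"
        using True s by (subst hankel_formula_scaled[OF a(1) True]) (auto simp: half_power_def mult_ac)
      also have "complex_of_real \<tau> powr (\<alpha> - 1) * of_real \<tau> powr (s - 1) = half_power (\<alpha> + s - 1) \<tau>"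
        using True by (simp add: half_power_def powr_add[symmetric] algebra_simps)
      finally show ?thesis .
    qed (simp add: f_def half_power_def)
  qed
  also have "\<dots> = 2 * of_real pi * \<i> * rGamma s * Gamma (\<alpha> + s - 1)"
    using \<alpha> s by (subst integral_mult_right_zero, subst Gamma_integral_lborel) auto
  finally have "Gamma \<alpha> * (LINT t|lborel. (1 - p t) powr (- \<alpha>) * q t) = 2 * of_real pi * \<i> * rGamma s * Gamma (\<alpha> + s - 1)" .
  moreover have "Gamma \<alpha> \<noteq> 0"
    using \<alpha> by (auto simp: Gamma_eq_zero_iff elim!: nonpos_Ints_cases)
  ultimately show ?thesis unfolding p_def q_def by (simp add: field_simps)
qed

section \<open>The Casoratian\<close>

text \<open>The passage \<open>x -> 0\<close> is made along a sequence, to fit dominated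
  convergence; all terms lie strictly between 0 and 1.\<close>

definition null_seq :: "nat \<Rightarrow> real" where
  "null_seq n = 1 / real (n + 2)"

lemma null_seq: "0 < null_seq n" "null_seq n < 1" "null_seq \<longlonglongrightarrow> 0"
proof -
  show "0 < null_seq n" "null_seq n < 1" by (auto simp: null_seq_def)
  have "(\<lambda>n. 1 / real (n + 2)) \<longlonglongrightarrow> 0" by real_asymp
  then show "null_seq \<longlonglongrightarrow> 0" by (simp add: null_seq_def[abs_def])
qed

lemma kern_I_parabola_bound:
  assumes \<alpha>: "Re \<alpha> \<ge> 0" and a: "0 < a" "a < 1"
  obtains K where "K \<ge> 0" "\<And>x t. norm (hankel_kernel.kern (\<lambda>z. (1 - z) powr (- \<alpha>)) x s (parabola a t) * parabola' a t)
     \<le> K * ((a\<^sup>2 + t\<^sup>2) powr (1/2 - Re s) * exp (x * (a\<^sup>2 - t\<^sup>2)))"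
proof -
  interpret I: hankel_kernel "\<lambda>z. (1 - z) powr (- \<alpha>)" "- C2_cut" \<alpha> by (rule hankel_kernel_I[OF \<alpha>])
  show thesis using I.norm_kern_parabola_le[OF admissible_I[OF \<alpha> a]] that by blast
qed

text \<open>The contour stays fixed. The Gaussian factor is lost in the limit, so the power of
  \<open>z\<close> alone has to supply the majorant, whence \<open>Re s \<ge> 3/2\<close>;
  \<open>integral_parabola_beta\<close> evaluates the limit.\<close>

lemma V_I_tendsto:
  assumes \<alpha>: "Re \<alpha> > 0" and a: "0 < a" "a < 1" and s: "Re s \<ge> 3/2"
  shows "(\<lambda>n. hankel_kernel.V (\<lambda>z. (1 - z) powr (- \<alpha>)) a (null_seq n) s)
     \<longlonglongrightarrow> 2 * of_real pi * \<i> * rGamma s * Gamma (\<alpha> + s - 1) / Gamma \<alpha>"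
proof -
  have \<alpha>': "Re \<alpha> \<ge> 0" using \<alpha> by simp
  interpret I: hankel_kernel "\<lambda>z. (1 - z) powr (- \<alpha>)" "- C2_cut" \<alpha> by (rule hankel_kernel_I[OF \<alpha>'])
  have adm: "I.admissible a" by (rule admissible_I[OF \<alpha>' a])
  obtain K where K: "K \<ge> 0" "\<And>x t. norm (I.pkern a x s t)
     \<le> K * ((a\<^sup>2 + t\<^sup>2) powr (1/2 - Re s) * exp (x * (a\<^sup>2 - t\<^sup>2)))"
    using kern_I_parabola_bound[OF \<alpha>' a] by blast
  define B where "B = (a\<^sup>2) powr (1/2 - Re s + 1) / a\<^sup>2"
  have "(\<lambda>n. I.V a (null_seq n) s) \<longlonglongrightarrow> (LINT t|lborel. I.pkern a 0 s t)"
    unfolding I.V_def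
  proof (rule integral_tendsto_if_le_inverse_square[where C = "K * (B * exp (a\<^sup>2))"])
    show "(\<lambda>n. I.pkern a (null_seq n) s t) \<longlonglongrightarrow> I.pkern a 0 s t" for t
      unfolding I.kern_def by (intro tendsto_intros null_seq(3))
    show "norm (I.pkern a (null_seq n) s t) \<le> K * (B * exp (a\<^sup>2)) / (1 + t\<^sup>2)" for n t
    proof -
      have 1: "(a\<^sup>2 + t\<^sup>2) powr (1/2 - Re s) \<le> B / (1 + t\<^sup>2)"
        unfolding B_def using a s by (intro parabola_powr_le) auto
      have "null_seq n * a\<^sup>2 \<le> 1 * a\<^sup>2" "0 \<le> null_seq n * t\<^sup>2"
        using null_seq(1,2)[of n] by (intro mult_right_mono mult_nonneg_nonneg; simp)+
      then have "null_seq n * (a\<^sup>2 - t\<^sup>2) \<le> a\<^sup>2" by (simp add: right_diff_distrib)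
      then have 2: "exp (null_seq n * (a\<^sup>2 - t\<^sup>2)) \<le> exp (a\<^sup>2)" by simp
      have "norm (I.pkern a (null_seq n) s t) \<le> K * (B / (1 + t\<^sup>2) * exp (a\<^sup>2))"
        by (rule order_trans[OF K(2)]) (intro mult_left_mono mult_mono 1 2 K(1); use 1 in \<open>auto intro: order_trans[OF powr_ge_zero]\<close>)
      then show "norm (I.pkern a (null_seq n) s t) \<le> K * (B * exp (a\<^sup>2)) / (1 + t\<^sup>2)" by simp
    qed
  qed (use I.measurable_kern_parabola[OF adm] in simp_all)
  also have "(LINT t|lborel. I.pkern a 0 s t) = 2 * of_real pi * \<i> * rGamma s * Gamma (\<alpha> + s - 1) / Gamma \<alpha>"
    using integral_parabola_beta[OF \<alpha> a s] by (simp add: I.kern_def)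
  finally show ?thesis .
qed

text \<open>Below \<open>Re s = 3/2\<close> the power of \<open>z\<close> no longer gives the
  majorant \<open>C / (1 + t\<^sup>2)\<close>. The factor \<open>x\<close> makes up for it, since
  \<open>x * exp (- (x * t\<^sup>2)) \<le> 2 / (1 + t\<^sup>2)\<close> for
  \<open>0 < x < 1\<close>.\<close>

lemma V_I_mult_tendsto_0:
  assumes \<alpha>: "Re \<alpha> > 0" and a: "0 < a" "a < 1" and s: "Re s \<ge> 1"
  shows "(\<lambda>n. of_real (null_seq n) * hankel_kernel.V (\<lambda>z. (1 - z) powr (- \<alpha>)) a (null_seq n) s) \<longlonglongrightarrow> 0"
proof -
  have \<alpha>': "Re \<alpha> \<ge> 0" using \<alpha> by simp
  interpret I: hankel_kernel "\<lambda>z. (1 - z) powr (- \<alpha>)" "- C2_cut" \<alpha> by (rule hankel_kernel_I[OF \<alpha>'])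
  have adm: "I.admissible a" by (rule admissible_I[OF \<alpha>' a])
  obtain K where K: "K \<ge> 0" "\<And>x t. norm (I.pkern a x s t)
     \<le> K * ((a\<^sup>2 + t\<^sup>2) powr (1/2 - Re s) * exp (x * (a\<^sup>2 - t\<^sup>2)))"
    using kern_I_parabola_bound[OF \<alpha>' a] by blast
  define B where "B = (a\<^sup>2) powr (1/2 - Re s)"
  have "(\<lambda>n. LINT t|lborel. of_real (null_seq n) * (I.pkern a (null_seq n) s t)) \<longlonglongrightarrow> (LINT t|(lborel :: real measure). 0)"
  proof (rule integral_tendsto_if_le_inverse_square[where C = "2 * (K * (B * exp (a\<^sup>2)))"])
    show "(\<lambda>n. of_real (null_seq n) * (I.pkern a (null_seq n) s t)) \<longlonglongrightarrow> 0" for t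
    proof -
      have "(\<lambda>n. of_real (null_seq n) * (I.pkern a (null_seq n) s t)) \<longlonglongrightarrow> of_real 0 * (I.pkern a 0 s t)"
        unfolding I.kern_def by (intro tendsto_intros null_seq(3))
      then show "(\<lambda>n. of_real (null_seq n) * (I.pkern a (null_seq n) s t)) \<longlonglongrightarrow> 0" by simp
    qed
    show "norm (of_real (null_seq n) * (I.pkern a (null_seq n) s t)) \<le> 2 * (K * (B * exp (a\<^sup>2))) / (1 + t\<^sup>2)" for n t
    proof -
      define x where "x = null_seq n"
      have x: "0 < x" "x < 1" using null_seq by (auto simp: x_def)
      have 1: "(a\<^sup>2 + t\<^sup>2) powr (1/2 - Re s) \<le> B"
        unfolding B_def using a s by (intro powr_mono2') auto
      have "x * exp (- (x * t\<^sup>2)) * (1 + t\<^sup>2) = x * exp (- (x * t\<^sup>2)) + (x * t\<^sup>2) * exp (- (x * t\<^sup>2))"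
        by (simp add: algebra_simps)
      also have "\<dots> \<le> 1 + 1"
      proof (rule add_mono)
        have "x * exp (- (x * t\<^sup>2)) \<le> 1 * 1" using x by (intro mult_mono) auto
        then show "x * exp (- (x * t\<^sup>2)) \<le> 1" by simp
        have "x * t\<^sup>2 \<le> exp (x * t\<^sup>2)" using exp_ge_add_one_self[of "x * t\<^sup>2"] by linarith
        then show "(x * t\<^sup>2) * exp (- (x * t\<^sup>2)) \<le> 1" by (simp add: exp_minus field_simps)
      qed
      finally have 2: "x * exp (- (x * t\<^sup>2)) \<le> 2 / (1 + t\<^sup>2)"
        by (simp add: pos_le_divide_eq add_pos_nonneg)
      have 3: "exp (x * a\<^sup>2) \<le> exp (a\<^sup>2)" using x mult_right_mono[of x 1 "a\<^sup>2"] by simp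
      have "norm (of_real x * (I.pkern a x s t)) \<le> x * (K * ((a\<^sup>2 + t\<^sup>2) powr (1/2 - Re s) * exp (x * (a\<^sup>2 - t\<^sup>2))))"
        unfolding norm_mult[of "of_real x"] using x K(2)[of x t] by (simp add: mult_left_mono)
      also have "\<dots> = K * ((a\<^sup>2 + t\<^sup>2) powr (1/2 - Re s) * (exp (x * a\<^sup>2) * (x * exp (- (x * t\<^sup>2)))))"
        by (simp add: exp_add[symmetric] right_diff_distrib)
      also have "\<dots> \<le> K * (B * (exp (a\<^sup>2) * (2 / (1 + t\<^sup>2))))"
        using x by (intro mult_left_mono mult_mono 1 2 3 K(1)) (auto simp: B_def)
      finally show "norm (of_real (null_seq n) * (I.pkern a (null_seq n) s t)) \<le> 2 * (K * (B * exp (a\<^sup>2))) / (1 + t\<^sup>2)"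
        by (simp add: x_def mult_ac)
    qed
  qed (use I.measurable_kern_parabola[OF adm] in simp_all)
  then show ?thesis unfolding I.V_def by simp
qed

text \<open>The loop has to keep surrounding 1, and with \<open>z = w / x\<close> this point becomes
  \<open>x\<close>. On a fixed parabola for \<open>w\<close> the factor
  \<open>(w - x) powr (- \<alpha>)\<close> merges with \<open>w powr (- s)\<close> in the limit,
  which leaves Hankel's integral with exponent \<open>\<alpha> + s\<close>.\<close>

lemma V_H_tendsto:
  assumes \<alpha>: "Re \<alpha> > 0" and a: "a > 1" and s: "Re s \<ge> 0"
  shows "(\<lambda>n. of_real (null_seq n) powr (1 - \<alpha> - s) * hankel_kernel.V (\<lambda>z. (z - 1) powr (- \<alpha>)) a (null_seq n) s)
     \<longlonglongrightarrow> 2 * of_real pi * \<i> * rGamma (\<alpha> + s)"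
proof -
  have \<alpha>': "Re \<alpha> \<ge> 0" using \<alpha> by simp
  interpret H: hankel_kernel "\<lambda>z. (z - 1) powr (- \<alpha>)" "- C1_cut" \<alpha> by (rule hankel_kernel_H[OF \<alpha>'])
  define G where "G x z = (z - of_real x) powr (- \<alpha>) * exp z * z powr (- s)" for x :: real and z :: complex
  have nz: "parabola 2 t - of_real x \<notin> \<real>\<^sub>\<le>\<^sub>0" if "0 \<le> x" "x < 1" for t x :: real
    using that by (cases "t = 0") (auto simp: complex_nonpos_Reals_iff)
  have scale: "of_real x powr (1 - \<alpha> - s) * H.V a x s = (LINT t|lborel. G x (parabola 2 t) * parabola' 2 t)"
    if x: "0 < x" "x < 1" for x
  proof -
    \<comment> \<open>Chosen so that scaling by \<open>x\<close> leads to \<open>parabola 2\<close>,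
      whatever \<open>x\<close> is; \<open>b > 1\<close> because \<open>sqrt x < 1\<close>.\<close>
    define b where "b = 2 / sqrt x"
    have sx: "0 < sqrt x" "sqrt x < 1" using x by auto
    have "b > 1" unfolding b_def pos_less_divide_eq[OF sx(1)] using sx by linarith
    moreover have "b * sqrt x = 2" using x by (simp add: b_def)
    ultimately have b: "b > 1" "b * sqrt x = 2" .
    have "H.V a x s = H.V b x s"
      using s by (intro H.V_unique admissible_H \<alpha>' a b x) auto
    also have "\<dots> = (LINT t|lborel. of_real x powr (\<alpha> + s) * (G x (of_real x * parabola b t) * parabola' b t))"
      unfolding H.V_def
    proof (intro Bochner_Integration.integral_cong refl)
      fix t
      define z where "z = parabola b t"
      have "norm z > 1"
        using one_less_power[OF b(1), of 2] zero_le_power2[of t] unfolding z_def norm_parabola by linarith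
      then have z: "z \<noteq> 0" "z - 1 \<noteq> 0" by auto
      have "of_real x * z - of_real x = of_real x * (z - 1)" by (simp add: algebra_simps)
      then have "G x (of_real x * z) = of_real x powr (- \<alpha>) * of_real x powr (- s) * H.kern x s z"
        unfolding G_def H.kern_def using powr_of_real_mult[OF x(1) z(1), of "- s"] powr_of_real_mult[OF x(1) z(2), of "- \<alpha>"]
        by simp
      moreover have "of_real x powr (\<alpha> + s) * (complex_of_real x powr (- \<alpha>) * of_real x powr (- s)) = 1"
        using x by (simp add: powr_add[symmetric])
      ultimately show "H.pkern b x s t = of_real x powr (\<alpha> + s) * (G x (of_real x * parabola b t) * parabola' b t)"
        unfolding z_def[symmetric] by (metis mult.assoc mult_1)
    qed
    also have "\<dots> = of_real x powr (\<alpha> + s) * ((LINT t|lborel. G x (parabola 2 t) * parabola' 2 t) / of_real x)"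
      unfolding integral_mult_right_zero integral_parabola_scale[OF x(1)] b(2) ..
    finally have "of_real x powr (1 - \<alpha> - s) * H.V a x s =
        (of_real x powr (1 - \<alpha> - s) * of_real x powr (\<alpha> + s)) / of_real x * (LINT t|lborel. G x (parabola 2 t) * parabola' 2 t)"
      by simp
    also have "of_real x powr (1 - \<alpha> - s) * of_real x powr (\<alpha> + s) = complex_of_real x"
      using x by (simp add: powr_add[symmetric])
    finally show ?thesis using x by simp
  qed
  obtain C where C: "C \<ge> 0" "\<And>t. ((2::real)\<^sup>2 + t\<^sup>2) powr (1/2 - Re s) * exp (1 * (2\<^sup>2 - t\<^sup>2)) \<le> C / (1 + t\<^sup>2)"
    by (rule power_mult_exp_le[of 2 1 "1/2 - Re s"]) auto
  obtain K where K: "K \<ge> 0" "\<And>x t. norm (hk1.pkern 2 x s t)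
     \<le> K * ((2\<^sup>2 + t\<^sup>2) powr (1/2 - Re s) * exp (x * (2\<^sup>2 - t\<^sup>2)))"
    using hk1.norm_kern_parabola_le[OF admissible_1[of 2]] by auto
  have Gk: "G x (parabola 2 t) * parabola' 2 t = (parabola 2 t - of_real x) powr (- \<alpha>) * (hk1.pkern 2 1 s t)" for x t
    by (simp add: G_def hk1.kern_def mult_ac)
  have meas: "(\<lambda>t. G x (parabola 2 t) * parabola' 2 t) \<in> borel_measurable lborel" for x
  proof -
    have [measurable]: "(\<lambda>t. hk1.pkern 2 1 s t) \<in> borel_measurable borel"
      using hk1.measurable_kern_parabola[OF admissible_1[of 2]] by simp
    have [measurable]: "parabola 2 \<in> borel_measurable borel"
      by (intro borel_measurable_continuous_onI continuous_intros)
    show ?thesis unfolding Gk powr_def by measurable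
  qed
  \<comment> \<open>Points of \<open>parabola 2\<close> have modulus at least 4, and
    \<open>null_seq n < 1\<close>; hence the base of the power has modulus at least 3.\<close>
  define E where "E = 3 powr (- Re \<alpha>) * exp (pi * \<bar>Im \<alpha>\<bar>)"
  have "(\<lambda>n. LINT t|lborel. G (null_seq n) (parabola 2 t) * parabola' 2 t) \<longlonglongrightarrow> (LINT t|lborel. G 0 (parabola 2 t) * parabola' 2 t)"
  proof (rule integral_tendsto_if_le_inverse_square[OF meas meas, where C = "E * (K * C)"])
    show "(\<lambda>n. G (null_seq n) (parabola 2 t) * parabola' 2 t) \<longlonglongrightarrow> G 0 (parabola 2 t) * parabola' 2 t" for t
      unfolding G_def using nz[of 0]
      by (intro tendsto_intros null_seq(3)) auto
    show "norm (G (null_seq n) (parabola 2 t) * parabola' 2 t) \<le> E * (K * C) / (1 + t\<^sup>2)" for n t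
    proof -
      define w where "w = parabola 2 t - of_real (null_seq n)"
      have "norm (parabola 2 t) - norm (complex_of_real (null_seq n)) \<le> norm w"
        unfolding w_def by (rule norm_triangle_ineq2)
      then have "4 + t\<^sup>2 - null_seq n \<le> norm w" using null_seq(1)[of n] by simp
      then have w: "norm w \<ge> 3" using null_seq(2)[of n] zero_le_power2[of t] by linarith
      then have "norm (w powr (- \<alpha>)) \<le> norm w powr (- Re \<alpha>) * exp (pi * \<bar>Im \<alpha>\<bar>)"
        using norm_powr_le[of w "- \<alpha>"] by force
      also have "\<dots> \<le> E" unfolding E_def using w \<alpha> by (intro mult_right_mono powr_mono2') auto
      finally have 1: "norm (w powr (- \<alpha>)) \<le> E" .
      have "norm (hk1.pkern 2 1 s t) \<le> K * (C / (1 + t\<^sup>2))"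
        by (rule order_trans[OF K(2)]) (intro mult_left_mono C K)
      with 1 have "norm (w powr (- \<alpha>)) * norm (hk1.pkern 2 1 s t) \<le> E * (K * (C / (1 + t\<^sup>2)))"
        by (intro mult_mono) (auto simp: E_def)
      then show "norm (G (null_seq n) (parabola 2 t) * parabola' 2 t) \<le> E * (K * C) / (1 + t\<^sup>2)"
        unfolding Gk w_def by (simp only: norm_mult times_divide_eq_right)
    qed
  qed
  moreover have "(LINT t|lborel. G 0 (parabola 2 t) * parabola' 2 t) = hk1.V 2 1 (\<alpha> + s)"
    unfolding hk1.V_def hk1.kern_def G_def
    using parabola_nonzero[of 2] by (intro Bochner_Integration.integral_cong) (auto simp: powr_add[symmetric] mult_ac)
  moreover have "hk1.V 2 1 (\<alpha> + s) = 2 * of_real pi * \<i> * rGamma (\<alpha> + s)"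
    using hankel_formula_scaled[of 2 1 "\<alpha> + s"] \<alpha> s by simp
  ultimately show ?thesis using scale[OF null_seq(1,2)] by simp
qed

text \<open>
  As a function of \<open>x\<close>, the left-hand side \<open>W\<close> satisfies \<open>x W' = (x + \<alpha> + \<beta>) W\<close>;
  the constant of integration is read off as \<open>x\<close> tends to \<open>0\<close>.
\<close>

lemma V_casoratian:
  assumes \<alpha>: "Re \<alpha> > 0" and \<beta>: "\<beta> > 0" and a: "a > 1" and b: "0 < b" "b < 1" and x: "x > 0"
  shows "hankel_kernel.V (\<lambda>z. (z - 1) powr (- \<alpha>)) a x (of_real \<beta> + 1) * hankel_kernel.V (\<lambda>z. (1 - z) powr (- \<alpha>)) b x (of_real \<beta> + 2)
       - hankel_kernel.V (\<lambda>z. (1 - z) powr (- \<alpha>)) b x (of_real \<beta> + 1) * hankel_kernel.V (\<lambda>z. (z - 1) powr (- \<alpha>)) a x (of_real \<beta> + 2)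
     = (2 * of_real pi * \<i>)\<^sup>2 * (of_real x powr (\<alpha> + of_real \<beta>) * exp (of_real x) / (Gamma \<alpha> * Gamma (of_real \<beta> + 2)))"
proof -
  have \<alpha>': "Re \<alpha> \<ge> 0" using \<alpha> by simp
  interpret H: hankel_kernel "\<lambda>z. (z - 1) powr (- \<alpha>)" "- C1_cut" \<alpha> by (rule hankel_kernel_H[OF \<alpha>'])
  interpret I: hankel_kernel "\<lambda>z. (1 - z) powr (- \<alpha>)" "- C2_cut" \<alpha> by (rule hankel_kernel_I[OF \<alpha>'])
  have admH: "H.admissible a" by (rule admissible_H[OF \<alpha>' a])
  have admI: "I.admissible b" by (rule admissible_I[OF \<alpha>' b])
  define s where "s = complex_of_real \<beta> + 1"
  define W where "W x = H.V a x s * I.V b x (s + 1) - I.V b x s * H.V a x (s + 1)" for x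
  \<comment> \<open>The differential equation for \<open>W\<close> says exactly that its quotient by
    \<open>exp x * x powr (\<alpha> + \<beta>)\<close> is constant.\<close>
  define g where "g x = exp (- of_real x) * of_real x powr (- (\<alpha> + of_real \<beta>)) * W x" for x
  have dW: "(g has_vector_derivative 0) (at x)" if x: "x > 0" for x
  proof -
    have dg: "((\<lambda>x. exp (- complex_of_real x) * of_real x powr (- (\<alpha> + of_real \<beta>))) has_vector_derivative
        - exp (- of_real x) * of_real x powr (- (\<alpha> + of_real \<beta>))
        + exp (- of_real x) * (- (\<alpha> + of_real \<beta>) * of_real x powr (- (\<alpha> + of_real \<beta>) - 1))) (at x)"
    proof -
      have "((\<lambda>z. exp (- z) * z powr (- (\<alpha> + of_real \<beta>))) has_field_derivative
        - exp (- of_real x) * of_real x powr (- (\<alpha> + of_real \<beta>))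
        + exp (- of_real x) * (- (\<alpha> + of_real \<beta>) * of_real x powr (- (\<alpha> + of_real \<beta>) - 1))) (at (of_real x))"
        using x by (auto intro!: derivative_eq_intros simp: complex_nonpos_Reals_iff)
      from has_vector_derivative_real_field[OF this] show ?thesis .
    qed
    have dH: "((\<lambda>x. H.V a x u) has_vector_derivative H.V a x (u - 1)) (at x)" for u
      by (rule H.V_has_vector_derivative[OF admH x])
    have dI: "((\<lambda>x. I.V b x u) has_vector_derivative I.V b x (u - 1)) (at x)" for u
      by (rule I.V_has_vector_derivative[OF admI x])
    \<comment> \<open>As \<open>s + 1 - 1\<close> is again \<open>s\<close>, the two products at
      equal index cancel; what remains pairs \<open>s - 1\<close> with \<open>s + 1\<close>, and the
      recurrence leads these products back to \<open>W\<close>.\<close>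
    define W' where "W' = H.V a x s * I.V b x (s + 1 - 1) + H.V a x (s - 1) * I.V b x (s + 1)
        - (I.V b x s * H.V a x (s + 1 - 1) + I.V b x (s - 1) * H.V a x (s + 1))"
    have dWx: "(W has_vector_derivative W') (at x)"
      unfolding W_def[abs_def] W'_def by (intro has_vector_derivative_diff has_vector_derivative_mult dH dI)
    have "of_real x * W' = (of_real x * H.V a x (s - 1)) * I.V b x (s + 1) - (of_real x * I.V b x (s - 1)) * H.V a x (s + 1)"
      by (simp add: W'_def algebra_simps)
    also have "of_real x * H.V a x (s - 1) = (of_real x + \<alpha> - 1 + s) * H.V a x s - s * H.V a x (s + 1)"
      using H.V_recurrence[OF admH x, of s] by (simp add: algebra_simps)
    also have "of_real x * I.V b x (s - 1) = (of_real x + \<alpha> - 1 + s) * I.V b x s - s * I.V b x (s + 1)"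
      using I.V_recurrence[OF admI x, of s] by (simp add: algebra_simps)
    also have "((of_real x + \<alpha> - 1 + s) * H.V a x s - s * H.V a x (s + 1)) * I.V b x (s + 1)
        - ((of_real x + \<alpha> - 1 + s) * I.V b x s - s * I.V b x (s + 1)) * H.V a x (s + 1) = (of_real x + \<alpha> + of_real \<beta>) * W x"
      by (simp add: W_def s_def algebra_simps)
    finally have xW: "of_real x * W' = (of_real x + \<alpha> + of_real \<beta>) * W x" .
    have P: "of_real x powr (- (\<alpha> + of_real \<beta>) - 1) = of_real x powr (- (\<alpha> + of_real \<beta>)) / of_real x"
      using x by (simp add: powr_diff)
    have "(g has_vector_derivative
       (exp (- of_real x) * of_real x powr (- (\<alpha> + of_real \<beta>))) * W'
       + (- exp (- of_real x) * of_real x powr (- (\<alpha> + of_real \<beta>))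
        + exp (- of_real x) * (- (\<alpha> + of_real \<beta>) * of_real x powr (- (\<alpha> + of_real \<beta>) - 1))) * W x) (at x)"
      unfolding g_def[abs_def] by (intro has_vector_derivative_mult dWx dg)
    also have "(exp (- of_real x) * of_real x powr (- (\<alpha> + of_real \<beta>))) * W'
       + (- exp (- of_real x) * of_real x powr (- (\<alpha> + of_real \<beta>))
        + exp (- of_real x) * (- (\<alpha> + of_real \<beta>) * of_real x powr (- (\<alpha> + of_real \<beta>) - 1))) * W x
       = exp (- of_real x) * of_real x powr (- (\<alpha> + of_real \<beta>)) / of_real x *
          (of_real x * W' - (of_real x + \<alpha> + of_real \<beta>) * W x)"
      unfolding P using x by (simp add: field_simps)
    finally show ?thesis unfolding xW by simp
  qed
  have const: "g y = g x" if "y > 0" "x > 0" for x y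
  proof -
    have "\<exists>c. \<forall>x\<in>{0<..}. g x = c"
    proof (rule has_derivative_zero_constant)
      show "(g has_derivative (\<lambda>h. 0)) (at x within {0<..})" if "x \<in> {0<..}" for x
        using dW[of x] that by (auto simp: has_vector_derivative_def intro: has_derivative_at_withinI)
    qed auto
    then show ?thesis using that by auto
  qed
  define c where "c = 2 * of_real pi * \<i> * rGamma (\<alpha> + s) * (2 * of_real pi * \<i> * rGamma (s + 1) * Gamma (\<alpha> + (s + 1) - 1) / Gamma \<alpha>)"
  have "(\<lambda>n. g (null_seq n)) \<longlonglongrightarrow> c"
  proof -
    \<comment> \<open>\<open>h u\<close> carries the power of \<open>x\<close> required by
      \<open>V_H_tendsto\<close>. For \<open>u = s\<close> this is the power in \<open>g\<close>.
      For \<open>u = s + 1\<close> there is an extra \<open>1 / x\<close>, compensated by attaching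
      \<open>x\<close> to \<open>I.V b x s\<close>; by \<open>V_I_mult_tendsto_0\<close> that
      product tends to 0, so only the first product survives.\<close>
    define h where "h u n = of_real (null_seq n) powr (1 - \<alpha> - u) * H.V a (null_seq n) u" for u n
    have lh: "h u \<longlonglongrightarrow> 2 * of_real pi * \<i> * rGamma (\<alpha> + u)" if "Re u \<ge> 0" for u
      unfolding h_def by (rule V_H_tendsto[OF \<alpha> a that])
    have "(\<lambda>n. exp (- of_real (null_seq n)) * (h s n * I.V b (null_seq n) (s + 1) - (of_real (null_seq n) * I.V b (null_seq n) s) * h (s + 1) n))
       \<longlonglongrightarrow> exp (- of_real 0) * (2 * of_real pi * \<i> * rGamma (\<alpha> + s) * (2 * of_real pi * \<i> * rGamma (s + 1) * Gamma (\<alpha> + (s + 1) - 1) / Gamma \<alpha>)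
          - 0 * (2 * of_real pi * \<i> * rGamma (\<alpha> + (s + 1))))"
      using \<beta> by (intro tendsto_intros null_seq(3) lh V_I_tendsto[OF \<alpha> b] V_I_mult_tendsto_0[OF \<alpha> b]) (auto simp: s_def)
    moreover have "exp (- of_real (null_seq n)) * (h s n * I.V b (null_seq n) (s + 1) - (of_real (null_seq n) * I.V b (null_seq n) s) * h (s + 1) n) = g (null_seq n)" for n
    proof -
      define y where "y = null_seq n"
      have y: "y > 0" using null_seq(1) by (simp add: y_def)
      have e1: "1 - \<alpha> - s = - (\<alpha> + of_real \<beta>)" by (simp add: s_def)
      have "of_real y * complex_of_real y powr (1 - \<alpha> - (s + 1)) = of_real y powr (1 + (1 - \<alpha> - (s + 1)))"
        using y unfolding powr_add by simp
      also have "1 + (1 - \<alpha> - (s + 1)) = - (\<alpha> + of_real \<beta>)" by (simp add: s_def)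
      finally have e2: "of_real y * complex_of_real y powr (1 - \<alpha> - (s + 1)) = of_real y powr (- (\<alpha> + of_real \<beta>))" .
      have e3: "(of_real y * I.V b y s) * (of_real y powr (1 - \<alpha> - (s + 1)) * H.V a y (s + 1)) =
         of_real y powr (- (\<alpha> + of_real \<beta>)) * (I.V b y s * H.V a y (s + 1))"
        unfolding e2[symmetric] by (simp only: mult_ac)
      show ?thesis
        unfolding h_def g_def W_def y_def[symmetric] e1 e3 by (simp add: algebra_simps)
    qed
    ultimately show ?thesis unfolding c_def by simp
  qed
  moreover have "g (null_seq n) = g x" for n using const[OF null_seq(1) x] .
  ultimately have gx: "g x = c" by (simp add: LIMSEQ_const_iff)
  have "of_real x powr (\<alpha> + of_real \<beta>) * complex_of_real x powr (- (\<alpha> + of_real \<beta>)) = 1"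
    unfolding powr_minus using x by simp
  moreover have "exp (of_real x) * exp (- complex_of_real x) = 1" by (simp add: exp_minus)
  ultimately have "W x = (exp (of_real x) * exp (- of_real x)) * (of_real x powr (\<alpha> + of_real \<beta>) * of_real x powr (- (\<alpha> + of_real \<beta>))) * W x"
    by (simp only: mult_1)
  also have "\<dots> = exp (of_real x) * of_real x powr (\<alpha> + of_real \<beta>) * g x"
    by (simp add: g_def mult_ac)
  also have "\<dots> = (2 * of_real pi * \<i>)\<^sup>2 * (of_real x powr (\<alpha> + of_real \<beta>) * exp (of_real x) / (Gamma \<alpha> * Gamma (of_real \<beta> + 2)))"
  proof -
    have "\<alpha> + s \<notin> \<int>\<^sub>\<le>\<^sub>0"
      using \<alpha> \<beta> by (auto simp: s_def elim!: nonpos_Ints_cases dest!: arg_cong[of _ _ Re])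
    then have "rGamma (\<alpha> + s) * Gamma (\<alpha> + s) = 1" by (simp add: Gamma_def rGamma_eq_zero_iff)
    moreover have "s + 1 = of_real \<beta> + 2" by (simp add: s_def)
    moreover have "c = (2 * of_real pi * \<i>)\<^sup>2 * ((rGamma (\<alpha> + s) * Gamma (\<alpha> + s)) * rGamma (s + 1) / Gamma \<alpha>)"
      by (simp add: c_def power2_eq_square)
    ultimately have "c = (2 * of_real pi * \<i>)\<^sup>2 / (Gamma \<alpha> * Gamma (of_real \<beta> + 2))"
      by (simp add: Gamma_def field_simps)
    then show ?thesis unfolding gx by (simp add: field_simps)
  qed
  finally have "W x = (2 * of_real pi * \<i>)\<^sup>2 * (of_real x powr (\<alpha> + of_real \<beta>) * exp (of_real x) / (Gamma \<alpha> * Gamma (of_real \<beta> + 2)))" .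
  moreover have "s + 1 = of_real \<beta> + 2" by (simp add: s_def)
  ultimately show ?thesis unfolding W_def s_def by (simp only:)
qed

section \<open>The Erlang A model\<close>

context
  fixes r \<rho> :: real and \<theta> :: complex
  assumes r: "0 < r" "r < 1"
begin

definition F_integrand :: "int \<Rightarrow> complex \<Rightarrow> complex" where
  "F_integrand k z = exp (of_real \<rho> * z) / (z powi (k + 1) * (1 - z) powr \<theta>)"

lemma one_minus_not_nonpos: "norm (z::complex) < 1 \<Longrightarrow> 1 - z \<notin> \<real>\<^sub>\<le>\<^sub>0"
  using complex_Re_le_cmod[of z] by (auto simp: complex_nonpos_Reals_iff)

lemma one_minus_nonzero: "norm (z::complex) < 1 \<Longrightarrow> 1 - z \<noteq> 0"
  by auto

lemma has_contour_integral_erlang_F: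
  "(F_integrand k has_contour_integral 2 * of_real pi * \<i> * erlang_F r \<rho> k \<theta>) (circlepath 0 r)"
proof -
  have "F_integrand k holomorphic_on (ball 0 1 - {0})"
    unfolding F_integrand_def[abs_def]
    using one_minus_not_nonpos one_minus_nonzero
    by (intro holomorphic_intros) (auto simp: powr_def)
  then have "F_integrand k contour_integrable_on circlepath 0 r"
    using r by (intro contour_integrable_holomorphic_simple[of _ "ball 0 1 - {0}"]) (auto simp: open_delete)
  then have "(F_integrand k has_contour_integral contour_integral (circlepath 0 r) (F_integrand k)) (circlepath 0 r)"
    by (rule has_contour_integral_integral)
  then show ?thesis unfolding erlang_F_def F_integrand_def[abs_def] by simp
qed

text \<open>\<open>P\<close> is the analogue of the primitive in \<open>V_recurrence\<close>: the
  factor \<open>1 - z\<close> absorbs the derivative of \<open>(1 - z) powr (- \<theta>)\<close>.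
  Since the powers of \<open>z\<close> are integral, \<open>P\<close> is single-valued on the
  punctured disc, and the closed contour leaves no boundary term.\<close>

lemma erlang_F_recurrence:
  "(of_int k + 1) * erlang_F r \<rho> (k + 1) \<theta> + of_real \<rho> * erlang_F r \<rho> (k - 1) \<theta>
     = (of_real \<rho> + of_int k + \<theta>) * erlang_F r \<rho> k \<theta>"
proof -
  define P where "P z = (1 - z) * F_integrand k z" for z
  define Q where "Q z = (of_real \<rho> + of_int k + \<theta>) * F_integrand k z - of_real \<rho> * F_integrand (k - 1) z
      - (of_int k + 1) * F_integrand (k + 1) z" for z
  have dP: "(P has_field_derivative Q z) (at z)" if z: "z \<in> ball 0 1 - {0}" for z
  proof -
    have z0: "z \<noteq> 0" "1 - z \<notin> \<real>\<^sub>\<le>\<^sub>0" "1 - z \<noteq> 0" using z one_minus_not_nonpos one_minus_nonzero by auto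
    define e where "e = exp (of_real \<rho> * z)"
    define u where "u = (1 - z) powr (- \<theta>)"
    \<comment> \<open>The lowest power of \<open>z\<close> that occurs; the others are
      \<open>v * z\<close> and \<open>v * z * z\<close>, so that the identity becomes polynomial in
      \<open>z\<close>.\<close>
    define v where "v = z powi (- (k + 2))"
    have Fk: "F_integrand j z = e * u * z powi (- (j + 1))" for j
    proof -
      have "z powi (- (j + 1)) = inverse (z powi (j + 1))" by (rule power_int_minus)
      then show ?thesis
        unfolding F_integrand_def e_def u_def powr_minus divide_inverse by (simp add: mult_ac)
    qed
    have "(\<lambda>z. (1 - z) * (exp (of_real \<rho> * z) * (1 - z) powr (- \<theta>) * z powi (- (k + 1)))) = P"
      unfolding P_def[abs_def] F_integrand_def power_int_minus powr_minus divide_inverse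
      by (auto simp: fun_eq_iff mult_ac)
    moreover have "((\<lambda>z. (1 - z) * (exp (of_real \<rho> * z) * (1 - z) powr (- \<theta>) * z powi (- (k + 1)))) has_field_derivative
       - (e * u * z powi (- (k + 1))) + (1 - z) * ((of_real \<rho> * e * u + e * (\<theta> * (1 - z) powr (- \<theta> - 1))) * z powi (- (k + 1))
          + e * u * (- (of_int k + 1) * z powi (- (k + 1) - 1)))) (at z)"
      unfolding e_def u_def
      by (rule derivative_eq_intros refl | use z0 in \<open>simp; fail\<close>)+
    moreover have "(1 - z) powr (- \<theta> - 1) * (1 - z) = u"
      using z0 by (simp add: powr_diff u_def)
    moreover have "z powi (- (k + 1)) = v * z" "z powi (- k) = v * z * z" "z powi (- (k + 1) - 1) = v"
    proof -
      have "z powi (- (k + 2) + 1) = z powi (- (k + 2)) * z powi 1" by (rule power_int_add) (simp add: z0)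
      then have "z powi (- (k + 2) + 1) = v * z" unfolding v_def power_int_1_right .
      moreover have "z powi (- (k + 2) + 2) = z powi (- (k + 2)) * z powi 2" by (rule power_int_add) (simp add: z0)
      then have "z powi (- (k + 2) + 2) = v * z * z"
        unfolding v_def power_int_numeral power2_eq_square by (simp only: mult.assoc)
      moreover have "- (k + 2) + 1 = - (k + 1)" "- (k + 2) + 2 = - k" by simp_all
      ultimately show "z powi (- (k + 1)) = v * z" "z powi (- k) = v * z * z" by (simp_all only:)
      show "z powi (- (k + 1) - 1) = v" unfolding v_def by (rule arg_cong[of _ _ "\<lambda>j. z powi j"]) simp
    qed
    moreover have "Q z = (of_real \<rho> + of_int k + \<theta>) * (e * u * z powi (- (k + 1))) - of_real \<rho> * (e * u * z powi (- k))
      - (of_int k + 1) * (e * u * v)"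
    proof -
      have e12: "- (k + 1 + 1) = - (k + 2)" "- (k - 1 + 1) = - k" by simp_all
      show ?thesis unfolding Q_def Fk e12 v_def ..
    qed
    moreover have "- (e * u * (v * z)) + (1 - z) * ((of_real \<rho> * e * u + e * (\<theta> * w)) * (v * z) + e * u * (- (of_int k + 1) * v))
       = (of_real \<rho> + of_int k + \<theta>) * (e * u * (v * z)) - of_real \<rho> * (e * u * (v * z * z)) - (of_int k + 1) * (e * u * v)"
      if "w * (1 - z) = u" for w
    proof -
      have "- (e * u * (v * z)) + (1 - z) * ((of_real \<rho> * e * u + e * (\<theta> * w)) * (v * z) + e * u * (- (of_int k + 1) * v))
        = - (e * u * (v * z)) + (1 - z) * (of_real \<rho> * e * u * (v * z) + e * u * (- (of_int k + 1) * v)) + e * \<theta> * (w * (1 - z)) * (v * z)"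
        by (simp add: algebra_simps)
      also have "\<dots> = (of_real \<rho> + of_int k + \<theta>) * (e * u * (v * z)) - of_real \<rho> * (e * u * (v * z * z)) - (of_int k + 1) * (e * u * v)"
        unfolding that by (simp add: algebra_simps)
      finally show ?thesis .
    qed
    ultimately show ?thesis by simp
  qed
  have "(Q has_contour_integral 0) (circlepath 0 r)"
    by (rule Cauchy_theorem_primitive[of "ball 0 1 - {0}" P])
       (use r in \<open>auto intro!: DERIV_subset[OF dP]\<close>)
  moreover have "(Q has_contour_integral
      ((of_real \<rho> + of_int k + \<theta>) * (2 * of_real pi * \<i> * erlang_F r \<rho> k \<theta>)
      - of_real \<rho> * (2 * of_real pi * \<i> * erlang_F r \<rho> (k - 1) \<theta>)
      - (of_int k + 1) * (2 * of_real pi * \<i> * erlang_F r \<rho> (k + 1) \<theta>))) (circlepath 0 r)"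
    unfolding Q_def[abs_def]
    by (intro has_contour_integral_diff has_contour_integral_lmul has_contour_integral_erlang_F)
  ultimately have "(of_real \<rho> + of_int k + \<theta>) * (2 * of_real pi * \<i> * erlang_F r \<rho> k \<theta>)
      - of_real \<rho> * (2 * of_real pi * \<i> * erlang_F r \<rho> (k - 1) \<theta>)
      - (of_int k + 1) * (2 * of_real pi * \<i> * erlang_F r \<rho> (k + 1) \<theta>) = 0"
    by (rule has_contour_integral_unique[symmetric])
  then have "2 * of_real pi * \<i> * ((of_int k + 1) * erlang_F r \<rho> (k + 1) \<theta> + of_real \<rho> * erlang_F r \<rho> (k - 1) \<theta>)
     = 2 * of_real pi * \<i> * ((of_real \<rho> + of_int k + \<theta>) * erlang_F r \<rho> k \<theta>)"
    by (simp add: algebra_simps)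
  moreover have "2 * of_real pi * \<i> \<noteq> 0" by simp
  ultimately show ?thesis using mult_left_cancel by blast
qed

lemma erlang_F_0: "erlang_F r \<rho> 0 \<theta> = 1"
proof -
  have "((\<lambda>z. (exp (of_real \<rho> * z) * (1 - z) powr (- \<theta>)) / (z - 0)) has_contour_integral
      2 * of_real pi * \<i> * (exp (of_real \<rho> * 0) * (1 - 0) powr (- \<theta>))) (circlepath 0 r)"
    using r by (intro Cauchy_integral_circlepath_simple holomorphic_intros) (auto intro!: one_minus_not_nonpos)
  also have "(\<lambda>z. (exp (of_real \<rho> * z) * (1 - z) powr (- \<theta>)) / (z - 0)) = F_integrand 0"
    by (auto simp: F_integrand_def fun_eq_iff powr_minus field_simps)
  finally have "2 * of_real pi * \<i> * erlang_F r \<rho> 0 \<theta> = 2 * of_real pi * \<i> * (exp (of_real \<rho> * 0) * (1 - 0) powr (- \<theta>))"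
    using has_contour_integral_erlang_F[of 0] has_contour_integral_unique by blast
  then show ?thesis by simp
qed

text \<open>The integrand has no pole at 0. This supplies the boundary condition: at
  \<open>k = 0\<close> the lower term of the recurrence drops out, in accordance with the death rate
  0 in state 0.\<close>

lemma erlang_F_minus_1: "erlang_F r \<rho> (- 1) \<theta> = 0"
proof -
  have "F_integrand (- 1) holomorphic_on ball 0 1"
    unfolding F_integrand_def[abs_def]
    using one_minus_not_nonpos one_minus_nonzero
    by (intro holomorphic_intros) (auto simp: powr_def)
  then have "(F_integrand (- 1) has_contour_integral 0) (circlepath 0 r)"
    using r by (intro Cauchy_theorem_convex_simple[of _ "ball 0 1"]) auto
  then have "2 * of_real pi * \<i> * erlang_F r \<rho> (- 1) \<theta> = 0"
    using has_contour_integral_erlang_F[of "-1"] has_contour_integral_unique by blast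
  then show ?thesis by simp
qed

end

text \<open>As \<open>Re \<theta> > 0\<close>, the modulus of
  \<open>birth i + death i + \<theta>\<close> exceeds \<open>birth i + death i\<close>, and the
  triangle inequality passes \<open>norm (\<phi> (i - 1)) \<le> norm (\<phi> i)\<close> on to the
  next state, strictly. The induction starts with an equality, because \<open>0 - 1\<close> is
  \<open>0\<close>.\<close>

lemma generator_solution_nonzero:
  fixes \<phi> :: "nat \<Rightarrow> complex"
  assumes \<theta>: "Re \<theta> > 0" and \<phi>0: "\<phi> 0 \<noteq> 0"
    and birth: "\<And>i. birth i > 0" and death: "\<And>i. death i \<ge> 0"
    and gen: "\<And>i. i < b \<Longrightarrow> of_real (birth i) * \<phi> (Suc i) + of_real (death i) * \<phi> (i - 1)
               = (of_real (birth i + death i) + \<theta>) * \<phi> i"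
    and "k \<le> b"
  shows "\<phi> k \<noteq> 0"
proof -
  have "\<phi> k \<noteq> 0 \<and> norm (\<phi> (k - 1)) \<le> norm (\<phi> k)" if "k \<le> b" for k
    using that
  proof (induction k)
    case 0
    then show ?case using \<phi>0 by simp
  next
    case (Suc k)
    then have IH: "\<phi> k \<noteq> 0" "norm (\<phi> (k - 1)) \<le> norm (\<phi> k)" and k: "k < b" by auto
    have "birth k + death k < Re (of_real (birth k + death k) + \<theta>)" using \<theta> by simp
    also have "\<dots> \<le> norm (of_real (birth k + death k) + \<theta>)" by (rule complex_Re_le_cmod)
    finally have "(birth k + death k) * norm (\<phi> k) < norm ((of_real (birth k + death k) + \<theta>) * \<phi> k)"
      unfolding norm_mult using IH(1) by (intro mult_strict_right_mono) auto
    also have "\<dots> = norm (of_real (birth k) * \<phi> (Suc k) + of_real (death k) * \<phi> (k - 1))"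
      using gen[OF k] by simp
    also have "\<dots> \<le> norm (of_real (birth k) * \<phi> (Suc k)) + norm (of_real (death k) * \<phi> (k - 1))"
      by (rule norm_triangle_ineq)
    also have "\<dots> = birth k * norm (\<phi> (Suc k)) + death k * norm (\<phi> (k - 1))"
      using birth[of k] death[of k] by (simp add: norm_mult)
    also have "\<dots> \<le> birth k * norm (\<phi> (Suc k)) + death k * norm (\<phi> k)"
      using IH(2) death[of k] by (intro add_left_mono mult_left_mono)
    finally have "birth k * norm (\<phi> k) < birth k * norm (\<phi> (Suc k))" by (simp add: algebra_simps)
    then have "norm (\<phi> k) < norm (\<phi> (Suc k))" using birth[of k] by simp
    then show ?case using IH(1) by auto
  qed
  then show ?thesis using \<open>k \<le> b\<close> by blast
qed

section \<open>The functions \<open>H\<close> and \<open>I\<close> as integrals over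
  parabolas\<close>

lemma powr_neg_int_plus:
  fixes z \<beta> :: complex
  assumes "z \<noteq> 0"
  shows "z powr (- (of_int j + \<beta>)) = 1 / (z powi j * z powr \<beta>)"
proof -
  have "z powr (- (of_int j + \<beta>)) = 1 / (z powr of_int j * z powr \<beta>)"
    unfolding powr_minus powr_add by (simp add: divide_inverse)
  then show ?thesis using assms by (simp add: complex_powr_of_int)
qed

lemma (in hankel_kernel) line_contour_integral_eq_V:
  assumes path: "hankel_path D C" and adm: "admissible a" and \<rho>: "\<rho> > 0" and \<eta>: "\<eta> > 0" and k: "k \<ge> m"
  shows "line_contour_integral C (\<lambda>z. exp (of_real \<rho> * z / of_real \<eta>) * A z /
            (z powi (int k + 1 - int m) * z powr (of_nat m / of_real \<eta>))) =
     V a (\<rho> / \<eta>) (of_nat (k - m) + 1 + of_real (real m / \<eta>))"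
proof -
  define s where "s = complex_of_nat (k - m) + 1 + of_real (real m / \<eta>)"
  have "((\<lambda>t. kern (\<rho> / \<eta>) s (C t) * vector_derivative C (at t)) has_integral V a (\<rho> / \<eta>) s) UNIV"
    using \<rho> \<eta> by (intro has_integral_hankel_path path adm) (auto simp: s_def)
  then have "integral UNIV (\<lambda>t. kern (\<rho> / \<eta>) s (C t) * vector_derivative C (at t)) = V a (\<rho> / \<eta>) s"
    by (rule integral_unique)
  moreover have "kern (\<rho> / \<eta>) s (C t) = exp (of_real \<rho> * C t / of_real \<eta>) * A (C t) /
            (C t powi (int k + 1 - int m) * C t powr (of_nat m / of_real \<eta>))" for t
  proof -
    have "C t \<in> D" using path unfolding hankel_path_def by blast
    then have nz: "C t \<noteq> 0" by (rule D_nonzero)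
    have "s = of_int (int k + 1 - int m) + of_nat m / of_real \<eta>"
      using k by (simp add: s_def of_nat_diff)
    then show ?thesis
      unfolding kern_def using powr_neg_int_plus[OF nz, of "int k + 1 - int m" "of_nat m / of_real \<eta>"]
      by (simp add: divide_inverse mult_ac)
  qed
  ultimately show ?thesis unfolding line_contour_integral_def s_def by simp
qed

text \<open>The parameter 2 of the parabola is an arbitrary choice above 1, as is 1/2 below 1 in
  \<open>erlang_I_eq_V\<close>. With \<open>k \<ge> m\<close> the exponent has real part at least 1,
  well inside the range in which contours may be exchanged.\<close>

lemma erlang_H_eq_V:
  assumes C: "hankel_contour C1_cut C" and \<rho>: "\<rho> > 0" and \<eta>: "\<eta> > 0" and \<theta>: "Re \<theta> > 0" and k: "k \<ge> m"
  shows "2 * of_real pi * \<i> * erlang_H C \<rho> \<eta> (int k) \<theta> m =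
     hankel_kernel.V (\<lambda>z. (z - 1) powr (- (\<theta> / of_real \<eta>))) 2 (\<rho> / \<eta>) (of_nat (k - m) + 1 + of_real (real m / \<eta>))"
proof -
  have \<alpha>: "Re (\<theta> / of_real \<eta>) \<ge> 0" using \<theta> \<eta> by simp
  have eq: "(\<lambda>z. exp (of_real \<rho> * z / of_real \<eta>) / ((z - 1) powr (\<theta> / of_real \<eta>) *
        z powi (int k + 1 - int m) * z powr (of_nat m / of_real \<eta>))) =
      (\<lambda>z. exp (of_real \<rho> * z / of_real \<eta>) * (z - 1) powr (- (\<theta> / of_real \<eta>)) /
        (z powi (int k + 1 - int m) * z powr (of_nat m / of_real \<eta>)))"
    unfolding powr_minus by (simp add: fun_eq_iff divide_inverse mult_ac)
  show ?thesis
    unfolding erlang_H_def eq hankel_kernel.line_contour_integral_eq_V[OF hankel_kernel_H[OF \<alpha>]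
        hankel_contour_imp_hankel_path[OF C] admissible_H[OF \<alpha>, of 2, simplified] \<rho> \<eta> k]
    by simp
qed

lemma erlang_I_eq_V:
  assumes C: "hankel_contour C2_cut C" and \<rho>: "\<rho> > 0" and \<eta>: "\<eta> > 0" and \<theta>: "Re \<theta> > 0" and k: "k \<ge> m"
  shows "2 * of_real pi * \<i> * erlang_I C \<rho> \<eta> (int k) \<theta> m =
     hankel_kernel.V (\<lambda>z. (1 - z) powr (- (\<theta> / of_real \<eta>))) (1/2) (\<rho> / \<eta>) (of_nat (k - m) + 1 + of_real (real m / \<eta>))"
proof -
  have \<alpha>: "Re (\<theta> / of_real \<eta>) \<ge> 0" using \<theta> \<eta> by simp
  have eq: "(\<lambda>z. exp (of_real \<rho> * z / of_real \<eta>) / ((1 - z) powr (\<theta> / of_real \<eta>) *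
        z powi (int k + 1 - int m) * z powr (of_nat m / of_real \<eta>))) =
      (\<lambda>z. exp (of_real \<rho> * z / of_real \<eta>) * (1 - z) powr (- (\<theta> / of_real \<eta>)) /
        (z powi (int k + 1 - int m) * z powr (of_nat m / of_real \<eta>)))"
    unfolding powr_minus by (simp add: fun_eq_iff divide_inverse mult_ac)
  show ?thesis
    unfolding erlang_I_def eq hankel_kernel.line_contour_integral_eq_V[OF hankel_kernel_I[OF \<alpha>]
        hankel_contour_imp_hankel_path[OF C] admissible_I[OF \<alpha>, of "1/2", simplified] \<rho> \<eta> k]
    by simp
qed

text \<open>The recurrence multiplied by \<open>\<eta>\<close>: its coefficients are the rates in the states \<open>\<ge> m\<close>.\<close>

lemma V_recurrence_rates:
  fixes \<theta> :: complex and \<rho> \<eta> :: real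
  assumes hk: "hankel_kernel A D (\<theta> / of_real \<eta>)" and adm: "hankel_kernel.admissible A D a"
    and \<rho>: "\<rho> > 0" and \<eta>: "\<eta> > 0" and k: "k > m"
  defines "v \<equiv> \<lambda>k. hankel_kernel.V A a (\<rho> / \<eta>) (of_nat (k - m) + 1 + of_real (real m / \<eta>))"
  shows "of_real (erlang_A_death m \<eta> (Suc k)) * v (Suc k) + of_real \<rho> * v (k - 1)
     = (of_real (\<rho> + erlang_A_death m \<eta> k) + \<theta>) * v k"
proof -
  interpret hankel_kernel A D "\<theta> / of_real \<eta>" by fact
  define s where "s = complex_of_nat (k - m) + 1 + of_real (real m / \<eta>)"
  have x: "\<rho> / \<eta> > 0" using \<rho> \<eta> by simp
  \<comment> \<open>Here \<open>k > m\<close> matters: the subtraction \<open>k - 1 - m\<close> must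
    not be truncated.\<close>
  have e: "complex_of_nat (Suc k - m) + 1 + of_real (real m / \<eta>) = s + 1"
    "complex_of_nat (k - 1 - m) + 1 + of_real (real m / \<eta>) = s - 1"
    using k by (simp_all add: s_def of_nat_diff)
  have "of_real \<eta> * (s * V a (\<rho> / \<eta>) (s + 1) + of_real (\<rho> / \<eta>) * V a (\<rho> / \<eta>) (s - 1))
      = of_real \<eta> * ((of_real (\<rho> / \<eta>) + \<theta> / of_real \<eta> - 1 + s) * V a (\<rho> / \<eta>) s)"
    using V_recurrence[OF adm x, of s] by simp
  then have "(of_real \<eta> * s) * V a (\<rho> / \<eta>) (s + 1) + (of_real \<eta> * of_real (\<rho> / \<eta>)) * V a (\<rho> / \<eta>) (s - 1)
      = (of_real \<eta> * of_real (\<rho> / \<eta>) + of_real \<eta> * (\<theta> / of_real \<eta>) - of_real \<eta> + of_real \<eta> * s) * V a (\<rho> / \<eta>) s"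
    by (simp only: distrib_left right_diff_distrib distrib_right left_diff_distrib mult.assoc mult_1_right mult_1_left)
  moreover have "of_real \<eta> * complex_of_real (\<rho> / \<eta>) = of_real \<rho>" "of_real \<eta> * (\<theta> / of_real \<eta>) = \<theta>"
    using \<eta> by simp_all
  \<comment> \<open>\<open>\<eta> * s = (k + 1 - m) * \<eta> + m\<close> is the death rate in state
    \<open>k + 1\<close>, one above the state of the equation.\<close>
  moreover have "of_real \<eta> * s = of_real (erlang_A_death m \<eta> (Suc k))"
    "of_real \<rho> + \<theta> - of_real \<eta> + of_real (erlang_A_death m \<eta> (Suc k)) = of_real (\<rho> + erlang_A_death m \<eta> k) + \<theta>"
    using \<eta> k by (simp_all add: s_def erlang_A_death_def of_nat_diff algebra_simps)
  ultimately show ?thesis unfolding v_def e s_def[symmetric] by simp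
qed

theorem theorem3:
  fixes M :: "'a measure" and N :: "real \<Rightarrow> 'a \<Rightarrow> nat"
    and m nstar n :: nat and \<rho> \<eta> r :: real and \<theta> :: complex
    and C1 C2 :: "real \<Rightarrow> complex"
  assumes "m \<ge> 1" and "\<rho> > 0" and "\<eta> > 0" and "nstar > m"
    and "erlang_A_process M N m \<rho> \<eta>"
    and "measure M {\<omega>\<in>space M. N 0 \<omega> = n} > 0"
    and "Re \<theta> > 0"
    and "0 < r" and "r < 1"
    and "hankel_contour C1_cut C1" and "hankel_contour C2_cut C2"
  shows
    "let F = (\<lambda>k::nat. erlang_F r \<rho> (int k) \<theta>);
         H = (\<lambda>k::nat. erlang_H C1 \<rho> \<eta> (int k) \<theta> m);
         I = (\<lambda>k::nat. erlang_I C2 \<rho> \<eta> (int k) \<theta> m);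
         Q = hitting_laplace M N nstar \<theta> n
     in
       (n \<le> m \<longrightarrow>
          Q = of_real \<rho> ^ (nstar - n) * (fact n / fact m)
              * of_real \<eta> powi (int m - int nstar + 1)
              * of_real (\<rho> / \<eta>) powr ((of_nat m + \<theta>) / of_real \<eta>)
              * (exp (of_real (\<rho> / \<eta>))
                 / (Gamma (\<theta> / of_real \<eta>)
                    * Gamma (of_nat nstar - of_nat m + 1 + of_nat m / of_real \<eta>)))
              * (F n
                 / ((of_nat m + of_real \<eta>)
                      * (H nstar * I (m + 1) - I nstar * H (m + 1)) * F m
                    + (of_nat m + 1)
                      * (H m * I nstar - H nstar * I m) * F (m + 1))))
       \<and>
       (m \<le> n \<and> n \<le> nstar \<longrightarrow>
          Q = of_real \<rho> ^ (nstar - n) * of_real \<eta> powi (int n - int nstar)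
              * (Gamma (of_nat n - of_nat m + 1 + of_nat m / of_real \<eta>)
                 / Gamma (of_nat nstar - of_nat m + 1 + of_nat m / of_real \<eta>))
              * (((of_nat m + of_real \<eta>)
                      * (H n * I (m + 1) - I n * H (m + 1)) * F m
                    + (of_nat m + 1)
                      * (H m * I n - H n * I m) * F (m + 1))
                 / ((of_nat m + of_real \<eta>)
                      * (H nstar * I (m + 1) - I nstar * H (m + 1)) * F m
                    + (of_nat m + 1)
                      * (H m * I nstar - H nstar * I m) * F (m + 1))))"
proof -
  define \<alpha> where "\<alpha> = \<theta> / of_real \<eta>"
  define \<beta> where "\<beta> = complex_of_real (real m / \<eta>)"
  define x where "x = \<rho> / \<eta>"
  define c where "c = 2 * of_real pi * \<i>"
  define F where "F k = erlang_F r \<rho> (int k) \<theta>" for k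
  define H where "H k = erlang_H C1 \<rho> \<eta> (int k) \<theta> m" for k
  define I where "I k = erlang_I C2 \<rho> \<eta> (int k) \<theta> m" for k
  define d where "d = erlang_A_death m \<eta>"
  \<comment> \<open>The combination of \<open>H\<close> and \<open>I\<close> whose values at
    \<open>m\<close> and \<open>m + 1\<close> are \<open>(m + \<eta>) * F m\<close> and
    \<open>(m + 1) * F (m + 1)\<close>, up to the common factor \<open>W\<close>.\<close>
  define X where "X k = (of_nat m + of_real \<eta>) * (H k * I (m + 1) - I k * H (m + 1)) * F m
       + (of_nat m + 1) * (H m * I k - H k * I m) * F (m + 1)" for k
  define W where "W = H m * I (m + 1) - I m * H (m + 1)"
  define G where "G k = Gamma (of_nat k - of_nat m + 1 + of_nat m / of_real \<eta> :: complex)" for k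
  define R where "R = complex_of_real \<rho>"
  define E where "E = complex_of_real \<eta>"
  \<comment> \<open>Chosen so that \<open>low m = high m\<close>. Through \<open>\<kappa>\<close>
    the Casoratian \<open>W\<close> enters the formula for \<open>n \<le> m\<close>; the formula for
    \<open>n \<ge> m\<close> is a quotient of two values of \<open>high\<close> and free of
    it.\<close>
  define \<kappa> where "\<kappa> = E ^ m * Gamma (1 + \<beta>) * (of_nat m + E) * W / fact m"
  define low where "low k = \<kappa> * fact k / R ^ k * F k" for k
  define high where "high k = E ^ k / R ^ k * G k * X k" for k
  \<comment> \<open>The branches agree at both \<open>m\<close> and \<open>m + 1\<close>. Hence the
    recurrence of \<open>low\<close> covers all states up to \<open>m\<close> and that of
    \<open>high\<close> all later ones, with no extra case at the junction.\<close>
  define \<phi> where "\<phi> k = (if k \<le> m then low k else high k)" for k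
  have m: "m \<ge> 1" and \<rho>: "\<rho> > 0" and \<eta>: "\<eta> > 0" and mn: "m < nstar" and \<theta>: "Re \<theta> > 0" and r: "0 < r" "r < 1"
    using assms by auto
  have R: "R \<noteq> 0" and E: "E \<noteq> 0" using \<rho> \<eta> by (auto simp: R_def E_def)
  have \<alpha>: "Re \<alpha> > 0" using \<theta> \<eta> by (simp add: \<alpha>_def)
  have \<beta>: "Re \<beta> > 0" using m \<eta> by (simp add: \<beta>_def)
  have c: "c \<noteq> 0" by (simp add: c_def)
  have Gnz: "Gamma (of_nat j + 1 + \<beta>) \<noteq> 0" for j
  proof -
    have "of_nat j + 1 + \<beta> \<notin> \<int>\<^sub>\<le>\<^sub>0"
      using \<beta> by (auto elim!: nonpos_Ints_cases dest!: arg_cong[of _ _ Re])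
    then show ?thesis by (simp add: Gamma_eq_zero_iff)
  qed
  have G_eq: "G k = Gamma (of_nat (k - m) + 1 + \<beta>)" if "k \<ge> m" for k
    using that by (simp add: G_def \<beta>_def of_nat_diff)
  have d_eq: "of_real (d (Suc k)) = E * (of_nat (k - m) + 1 + \<beta>)" if "k \<ge> m" for k
    using that \<eta> by (simp add: d_def erlang_A_death_def E_def \<beta>_def of_nat_diff algebra_simps)
  \<comment> \<open>In the recurrence for \<open>X\<close> the death rate of \<open>k + 1\<close>
    stands at the upper neighbour, while the equation for \<open>\<phi>\<close> has the death rate
    of \<open>k\<close> at the lower one; the Gamma factor performs this exchange.\<close>
  have G_Suc: "E * G (Suc k) = of_real (d (Suc k)) * G k" if k: "k \<ge> m" for k
  proof -
    have "of_nat (k - m) + 1 + \<beta> \<notin> \<int>\<^sub>\<le>\<^sub>0"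
      using \<beta> by (auto elim!: nonpos_Ints_cases dest!: arg_cong[of _ _ Re])
    from Gamma_plus1[OF this]
    have "Gamma (of_nat (Suc k - m) + 1 + \<beta>) = (of_nat (k - m) + 1 + \<beta>) * Gamma (of_nat (k - m) + 1 + \<beta>)"
      using k by (simp add: Suc_diff_le algebra_simps)
    then show ?thesis using k by (simp add: G_eq d_eq)
  qed
  define vH where "vH k = hankel_kernel.V (\<lambda>z. (z - 1) powr (- (\<theta> / of_real \<eta>))) 2 (\<rho> / \<eta>) (of_nat (k - m) + 1 + of_real (real m / \<eta>))" for k
  define vI where "vI k = hankel_kernel.V (\<lambda>z. (1 - z) powr (- (\<theta> / of_real \<eta>))) (1/2) (\<rho> / \<eta>) (of_nat (k - m) + 1 + of_real (real m / \<eta>))" for k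
  have HV: "c * H k = vH k" if "k \<ge> m" for k
    unfolding c_def H_def vH_def by (rule erlang_H_eq_V[OF assms(10) \<rho> \<eta> \<theta> that])
  have IV: "c * I k = vI k" if "k \<ge> m" for k
    unfolding c_def I_def vI_def by (rule erlang_I_eq_V[OF assms(11) \<rho> \<eta> \<theta> that])
  have H_div: "H k = vH k / c" and I_div: "I k = vI k / c" if "k \<ge> m" for k
    using HV[OF that] IV[OF that] c by (simp_all add: nonzero_eq_divide_eq mult.commute)
  have \<alpha>0: "Re (\<theta> / of_real \<eta>) \<ge> 0" using \<alpha> by (simp add: \<alpha>_def)
  have recH: "of_real (d (Suc k)) * H (Suc k) + R * H (k - 1) = (of_real (\<rho> + d k) + \<theta>) * H k" if k: "k > m" for k
  proof -
    have "of_real (d (Suc k)) * vH (Suc k) + R * vH (k - 1) = (of_real (\<rho> + d k) + \<theta>) * vH k"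
      unfolding d_def vH_def R_def
      by (rule V_recurrence_rates[OF hankel_kernel_H[OF \<alpha>0] admissible_H[OF \<alpha>0] \<rho> \<eta> k]) simp
    moreover have "H (Suc k) = vH (Suc k) / c" "H (k - 1) = vH (k - 1) / c" "H k = vH k / c"
      using k by (simp_all add: H_div)
    ultimately show ?thesis by (simp add: add_divide_distrib[symmetric])
  qed
  have recI: "of_real (d (Suc k)) * I (Suc k) + R * I (k - 1) = (of_real (\<rho> + d k) + \<theta>) * I k" if k: "k > m" for k
  proof -
    have "of_real (d (Suc k)) * vI (Suc k) + R * vI (k - 1) = (of_real (\<rho> + d k) + \<theta>) * vI k"
      unfolding d_def vI_def R_def
      by (rule V_recurrence_rates[OF hankel_kernel_I[OF \<alpha>0] admissible_I[OF \<alpha>0] \<rho> \<eta> k]) auto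
    moreover have "I (Suc k) = vI (Suc k) / c" "I (k - 1) = vI (k - 1) / c" "I k = vI k / c"
      using k by (simp_all add: I_div)
    ultimately show ?thesis by (simp add: add_divide_distrib[symmetric])
  qed
  have recX: "of_real (d (Suc k)) * X (Suc k) + R * X (k - 1) = (of_real (\<rho> + d k) + \<theta>) * X k" if k: "k > m" for k
  proof -
    define p where "p = (of_nat m + of_real \<eta>) * I (m + 1) * F m - (of_nat m + 1) * I m * F (m + 1)"
    define q where "q = (of_nat m + 1) * H m * F (m + 1) - (of_nat m + of_real \<eta>) * H (m + 1) * F m"
    have Xpq: "X j = p * H j + q * I j" for j by (simp add: X_def p_def q_def algebra_simps)
    have "of_real (d (Suc k)) * X (Suc k) + R * X (k - 1) =
        p * (of_real (d (Suc k)) * H (Suc k) + R * H (k - 1)) + q * (of_real (d (Suc k)) * I (Suc k) + R * I (k - 1))"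
      unfolding Xpq by (simp add: algebra_simps)
    also have "\<dots> = (of_real (\<rho> + d k) + \<theta>) * X k"
      unfolding recH[OF k] recI[OF k] Xpq by (simp add: algebra_simps)
    finally show ?thesis .
  qed
  \<comment> \<open>The value \<open>F (-1) = 0\<close> is built into the case \<open>k = 0\<close>,
    because \<open>F\<close> is indexed by natural numbers here.\<close>
  have recF: "of_nat (Suc k) * F (Suc k) + R * (if k = 0 then 0 else F (k - 1)) = (R + of_nat k + \<theta>) * F k" for k
    using erlang_F_recurrence[OF r, of "int k" \<rho> \<theta>] erlang_F_minus_1[OF r, of \<rho> \<theta>]
    by (cases k) (simp_all add: F_def R_def add.commute)
  have X_m: "X m = (of_nat m + E) * W * F m" "X (m + 1) = (of_nat m + 1) * W * F (m + 1)"
    by (simp_all add: X_def W_def E_def algebra_simps)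
  have low_m: "low m = high m"
    unfolding low_def high_def X_m(1) using G_eq[of m] by (simp add: \<kappa>_def mult_ac)
  have low_Suc_m: "low (Suc m) = high (Suc m)"
  proof -
    \<comment> \<open>This rate is the factor \<open>m + \<eta>\<close> in \<open>\<kappa>\<close>;
      the factor \<open>m + 1\<close> of \<open>X (m + 1)\<close> turns \<open>fact m\<close> into
      \<open>fact (m + 1)\<close>.\<close>
    have dm: "of_real (d (Suc m)) = of_nat m + E"
      using \<eta> by (simp add: d_def erlang_A_death_def E_def)
    have "high (Suc m) = (E * G (Suc m)) * E ^ m / R ^ Suc m * ((of_nat m + 1) * W * F (Suc m))"
      using X_m(2) by (simp add: high_def mult_ac)
    also have "E * G (Suc m) = (of_nat m + E) * Gamma (1 + \<beta>)"
      using G_Suc[of m] G_eq[of m] by (simp add: dm)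
    also have "(of_nat m + E) * Gamma (1 + \<beta>) * E ^ m / R ^ Suc m * ((of_nat m + 1) * W * F (Suc m)) = low (Suc m)"
    proof -
      have "\<kappa> * fact m = E ^ m * Gamma (1 + \<beta>) * (of_nat m + E) * W" by (simp add: \<kappa>_def)
      moreover have "\<kappa> * fact (Suc m) = (\<kappa> * fact m) * (of_nat m + 1)" by (simp add: algebra_simps)
      ultimately have "\<kappa> * fact (Suc m) = E ^ m * Gamma (1 + \<beta>) * (of_nat m + E) * W * (of_nat m + 1)"
        by (simp only:)
      then show ?thesis unfolding low_def by (simp only: mult_ac times_divide_eq_left times_divide_eq_right)
    qed
    finally show ?thesis ..
  qed
  have gen_low: "R * low (Suc k) + of_nat k * low (k - 1) = (R + of_nat k + \<theta>) * low k" for k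
  proof (cases k)
    case 0
    have "R * low (Suc 0) = \<kappa> * F 1" using R by (simp add: low_def)
    also have "F 1 = (R + \<theta>) * F 0" using recF[of 0] by simp
    finally show ?thesis using 0 by (simp add: low_def)
  next
    case (Suc j)
    have "R * low (Suc k) + of_nat k * low (k - 1) = \<kappa> * fact k / R ^ k * (of_nat (Suc k) * F (Suc k) + R * F j)"
      using R Suc by (simp add: low_def field_simps)
    also have "of_nat (Suc k) * F (Suc k) + R * F j = (R + of_nat k + \<theta>) * F k" using recF[of k] Suc by simp
    finally show ?thesis by (simp add: low_def)
  qed
  have gen_high: "R * high (Suc k) + of_real (d k) * high (k - 1) = (of_real (\<rho> + d k) + \<theta>) * high k" if k: "k > m" for k
  proof -
    obtain j where j: "k = Suc j" "j \<ge> m" using k by (cases k) auto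
    have "R * high (Suc k) = E ^ k / R ^ k * (E * G (Suc k)) * X (Suc k)"
      using R by (simp add: high_def field_simps)
    also have "E * G (Suc k) = of_real (d (Suc k)) * G k" using k by (intro G_Suc) simp
    finally have 1: "R * high (Suc k) = E ^ k / R ^ k * G k * (of_real (d (Suc k)) * X (Suc k))" by (simp add: mult_ac)
    have "of_real (d k) * high (k - 1) = E ^ j / R ^ j * (of_real (d (Suc j)) * G j) * X j"
      by (simp add: high_def j(1) mult_ac)
    also have "of_real (d (Suc j)) * G j = E * G (Suc j)" using j(2) by (rule G_Suc[symmetric])
    also have "E ^ j / R ^ j * (E * G (Suc j)) * X j = E ^ k / R ^ k * G k * (R * X (k - 1))"
      using R by (simp add: j(1) field_simps)
    finally have 2: "of_real (d k) * high (k - 1) = E ^ k / R ^ k * G k * (R * X (k - 1))" .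
    have "R * high (Suc k) + of_real (d k) * high (k - 1) = E ^ k / R ^ k * G k * (of_real (d (Suc k)) * X (Suc k) + R * X (k - 1))"
      unfolding 1 2 by (rule distrib_left[symmetric])
    then show ?thesis unfolding recX[OF k] by (simp add: high_def mult_ac)
  qed
  have gen: "of_real \<rho> * \<phi> (Suc k) + of_real (d k) * \<phi> (k - 1) = (of_real (\<rho> + d k) + \<theta>) * \<phi> k" for k
  proof (cases "k \<le> m")
    case True
    have "\<phi> (Suc k) = low (Suc k)" "\<phi> (k - 1) = low (k - 1)" "\<phi> k = low k"
      using True low_Suc_m by (auto simp: \<phi>_def le_Suc_eq dest!: le_antisym)
    moreover have "d k = real k" using True by (simp add: d_def erlang_A_death_def)
    ultimately show ?thesis using gen_low[of k] by (simp add: R_def)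
  next
    case False
    have "\<phi> (Suc k) = high (Suc k)" "\<phi> (k - 1) = high (k - 1)" "\<phi> k = high k"
      using False low_m by (auto simp: \<phi>_def dest!: le_antisym)
    then show ?thesis using gen_high[of k] False by (simp add: R_def)
  qed
  have W: "W = of_real x powr (\<alpha> + \<beta>) * exp (of_real x) / (Gamma \<alpha> * Gamma (2 + \<beta>))"
  proof -
    have \<beta>': "real m / \<eta> > 0" using m \<eta> by simp
    have x: "x > 0" using \<rho> \<eta> by (simp add: x_def)
    \<comment> \<open>Each of \<open>H\<close> and \<open>I\<close> carries a prefactor
      \<open>1 / c\<close>, so the square of \<open>c\<close> here cancels against that of
      \<open>V_casoratian\<close>.\<close>
    have "vH m * vI (m + 1) - vI m * vH (m + 1) =
        c\<^sup>2 * (of_real x powr (\<alpha> + \<beta>) * exp (of_real x) / (Gamma \<alpha> * Gamma (\<beta> + 2)))"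
      using V_casoratian[OF \<alpha> \<beta>' _ _ _ x, of 2 "1/2"]
      by (simp add: vH_def vI_def \<alpha>_def \<beta>_def x_def c_def add.commute)
    moreover have "vH m * vI (m + 1) - vI m * vH (m + 1) = c\<^sup>2 * W"
      by (simp add: HV[symmetric] IV[symmetric] W_def power2_eq_square algebra_simps)
    ultimately have "c\<^sup>2 * W = c\<^sup>2 * (of_real x powr (\<alpha> + \<beta>) * exp (of_real x) / (Gamma \<alpha> * Gamma (\<beta> + 2)))"
      by (simp only:)
    moreover have "c\<^sup>2 \<noteq> 0" using c by simp
    ultimately have "W = of_real x powr (\<alpha> + \<beta>) * exp (of_real x) / (Gamma \<alpha> * Gamma (\<beta> + 2))"
      using mult_left_cancel by blast
    then show ?thesis by (simp only: add.commute)
  qed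
  have \<kappa>: "\<kappa> = E ^ (m + 1) * (of_real x powr (\<alpha> + \<beta>) * exp (of_real x) / Gamma \<alpha>) / fact m"
  proof -
    \<comment> \<open>From \<open>\<eta> * (1 + \<beta>) = m + \<eta>\<close> the product of
      \<open>Gamma (1 + \<beta>)\<close> and \<open>m + \<eta>\<close> is
      \<open>\<eta> * Gamma (2 + \<beta>)\<close>, which cancels the second Gamma factor in
      \<open>W\<close> and leaves one more power of \<open>\<eta>\<close>.\<close>
    have "1 + \<beta> \<notin> \<int>\<^sub>\<le>\<^sub>0"
      using \<beta> by (auto elim!: nonpos_Ints_cases dest!: arg_cong[of _ _ Re])
    then have "Gamma (2 + \<beta>) = (1 + \<beta>) * Gamma (1 + \<beta>)"
      using Gamma_plus1[of "1 + \<beta>"] by (simp add: add.commute add.left_commute)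
    moreover have "E * (1 + \<beta>) = of_nat m + E" using \<eta> by (simp add: E_def \<beta>_def distrib_left)
    ultimately have "Gamma (1 + \<beta>) * (of_nat m + E) = E * Gamma (2 + \<beta>)" by (metis mult.assoc mult.commute)
    moreover have "Gamma (2 + \<beta>) \<noteq> 0" using Gnz[of 1] by simp
    ultimately have "Gamma (1 + \<beta>) * (of_nat m + E) * W = E * (of_real x powr (\<alpha> + \<beta>) * exp (of_real x) / Gamma \<alpha>)"
      unfolding W by simp
    then show ?thesis unfolding \<kappa>_def by (simp add: mult.assoc)
  qed
  have "\<kappa> \<noteq> 0"
  proof -
    have "Gamma \<alpha> \<noteq> 0" using \<alpha> by (auto simp: Gamma_eq_zero_iff elim!: nonpos_Ints_cases)
    moreover have "x \<noteq> 0" using \<rho> \<eta> by (simp add: x_def)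
    ultimately show ?thesis unfolding \<kappa> using E by simp
  qed
  \<comment> \<open>Since \<open>F 0 = 1\<close>, the value of \<open>\<phi>\<close> at 0 is
    \<open>\<kappa>\<close> itself.\<close>
  then have "\<phi> 0 \<noteq> 0" using erlang_F_0[OF r, of \<rho> \<theta>] by (simp add: \<phi>_def low_def F_def)
  then have \<phi>nz: "\<phi> nstar \<noteq> 0"
    by (rule generator_solution_nonzero[OF \<theta>, of \<phi> "\<lambda>_. \<rho>" d nstar nstar])
       (use \<rho> \<eta> gen in \<open>auto simp: d_def erlang_A_death_def\<close>)
  have Q: "hitting_laplace M N nstar \<theta> n = \<phi> n / \<phi> nstar" if "n \<le> nstar"
  proof -
    have "\<phi> nstar * hitting_laplace M N nstar \<theta> n = \<phi> n"
      using gen by (intro hitting_laplace_generator[OF assms(5)[unfolded erlang_A_process_def] assms(6) \<theta> that])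
        (auto simp: d_def erlang_A_death_def)
    then show ?thesis using \<phi>nz by (simp add: field_simps)
  qed
  have \<phi>star: "\<phi> nstar = E ^ nstar / R ^ nstar * G nstar * X nstar" using mn by (simp add: \<phi>_def high_def)
  have part1: "hitting_laplace M N nstar \<theta> n = R ^ (nstar - n) * (fact n / fact m) * E powi (int m - int nstar + 1)
      * of_real (\<rho> / \<eta>) powr ((of_nat m + \<theta>) / E) * (exp (of_real (\<rho> / \<eta>)) / (Gamma (\<theta> / E) * G nstar)) * (F n / X nstar)"
    if n: "n \<le> m"
  proof -
    have "(of_nat m + \<theta>) / E = \<alpha> + \<beta>" by (simp add: \<alpha>_def \<beta>_def E_def add_divide_distrib)
    \<comment> \<open>The \<open>+ 1\<close> in the exponent is the extra power of
      \<open>\<eta>\<close> contained in \<open>\<kappa>\<close>.\<close>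
    moreover have "E powi (int m - int nstar + 1) = E ^ (m + 1) / E ^ nstar"
    proof -
      have "E powi (int m - int nstar + 1) = E powi (int (m + 1) - int nstar)" by (simp add: algebra_simps)
      then show ?thesis using E by (simp only: power_int_diff power_int_of_nat simp_thms)
    qed
    moreover have "R ^ (nstar - n) = R ^ nstar / R ^ n" using n mn R by (simp add: power_diff)
    moreover have "hitting_laplace M N nstar \<theta> n = (\<kappa> * fact n / R ^ n * F n) / (E ^ nstar / R ^ nstar * G nstar * X nstar)"
      using Q n mn \<phi>star by (simp add: \<phi>_def low_def)
    ultimately show ?thesis unfolding \<kappa> by (simp add: x_def \<alpha>_def E_def mult_ac)
  qed
  have part2: "hitting_laplace M N nstar \<theta> n = R ^ (nstar - n) * E powi (int n - int nstar) * (G n / G nstar) * (X n / X nstar)"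
    if n: "m \<le> n" "n \<le> nstar"
  proof -
    have "E powi (int n - int nstar) = E ^ n / E ^ nstar" using E by (simp only: power_int_diff power_int_of_nat simp_thms)
    moreover have "R ^ (nstar - n) = R ^ nstar / R ^ n" using n R by (simp add: power_diff)
    moreover have "\<phi> n = high n" using n low_m by (auto simp: \<phi>_def dest!: le_antisym)
    ultimately show ?thesis using Q[OF n(2)] \<phi>star by (simp add: high_def mult_ac)
  qed
  show ?thesis
    unfolding Let_def using part1 part2
    unfolding F_def G_def X_def H_def I_def E_def R_def by blast
qed

end
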